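(* Let $H$ be a complex Hilbert space with $\dim H\ge 3$. Let $I$ be a finite index set with $|I|\ge 3$, let $\sigma=\{a_i\}_{i\in I}$ be mutually distinct real numbers and $d=\{n_i\}_{i\in I}$ positive integers or $\infty$ with $\sum_{i\in I}n_i=\dim H$, at most one $n_i$ infinite, and $a_i=0$ whenever $n_i=\infty$. If $f$ is an automorphism of the graph $\Gamma(\sigma,d)$, then there exist a unitary or anti-unitary operator $U$ on $H$ and a permutation $\delta\in S(d)$ such that $$f(A)=U\delta(A)U^{*}\qquad\text{for all }A\in\mathcal{G}(\sigma,d).$$
   Context: For a closed subspace $X\subset H$, $P_X$ denotes the orthogonal projection onto $X$. $\mathcal{G}(\sigma,d)$ is the set of all operators $A=\sum_{i\in I}a_iP_{X_i}$, where $\{X_i\}_{i\in I}$ are mutually orthogonal closed subspaces of $H$ whose sum is $H$ and $\dim X_i=n_i$ for all $i$; $X_i$ is the eigenspace of $A$ corresponding to $a_i$. (This is a unitary conjugacy class of finite-rank self-adjoint operators.) Two closed subspaces $X,Y$ of the same finite dimension or the same finite codimension are adjacent if $X\cap Y$ is a hyperplane in both $X$ and $Y$. For distinct $i,j\in I$, operators $A,B\in\mathcal{G}(\sigma,d)$ with eigenspaces $X_t$ (of $A$) and $Y_t$ (of $B$) corresponding to $a_t$ are called $(i,j)$-adjacent if $X_i$ is adjacent to $Y_i$, $X_j$ is adjacent to $Y_j$, and $X_t=Y_t$ for all $t\in I\setminus\{i,j\}$. $A,B$ are adjacent if they are $(i,j)$-adjacent for some distinct $i,j$ (equivalently, $B-A$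 has rank $2$ and $\operatorname{Im}(B-A)$, $\operatorname{Ker}(B-A)$ are invariant under both $A$ and $B$). $\Gamma(\sigma,d)$ is the simple graph with vertex set $\mathcal{G}(\sigma,d)$ whose edges join adjacent operators. $S(d)$ is the group of permutations $\delta$ of $I$ with $n_{\delta(i)}=n_i$ for all $i$, and for $A=\sum_{i}a_iP_{X_i}$ one sets $\delta(A)=\sum_{i\in I}a_iP_{X_{\delta(i)}}$. *)

theory Defs
  imports "HOL-Analysis.Analysis" "HOL-Library.Extended_Nat"
begin

section \<open>Complex Hilbert spaces\<close>

text \<open>The real vector space structure, the norm and completeness come from class
  \<^class>\<open>banach\<close>; the axioms below say that the real scaling and the norm are the ones
  induced by the complex structure. The inner product is linear in its second argument.\<close>

class chilbert_space = banach +
  fixes scaleC :: "complex \<Rightarrow> 'a \<Rightarrow> 'a" (infixr "*\<^sub>C" 75)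
    and cinner :: "'a \<Rightarrow> 'a \<Rightarrow> complex"
  assumes scaleC_add_right: "c *\<^sub>C (x + y) = c *\<^sub>C x + c *\<^sub>C y"
    and scaleC_add_left: "(b + c) *\<^sub>C x = b *\<^sub>C x + c *\<^sub>C x"
    and scaleC_scaleC: "b *\<^sub>C c *\<^sub>C x = (b * c) *\<^sub>C x"
    and scaleC_of_real: "complex_of_real r *\<^sub>C x = r *\<^sub>R x"
    and cinner_commute: "cinner x y = cnj (cinner y x)"
    and cinner_add_right: "cinner x (y + z) = cinner x y + cinner x z"
    and cinner_scaleC_right: "cinner x (c *\<^sub>C y) = c * cinner x y"
    and cinner_self: "cinner x x = complex_of_real ((norm x)\<^sup>2)"

global_interpretation complex_vector: vector_space "scaleC :: complex \<Rightarrow> 'a \<Rightarrow> 'a::chilbert_space"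
  defines csubspace = complex_vector.subspace
    and cspan = complex_vector.span
    and cdependent = complex_vector.dependent
    and cdim_nat = complex_vector.dim
proof
  fix x :: 'a
  show "1 *\<^sub>C x = x"
    using scaleC_of_real[of 1 x] by simp
qed (simp_all add: scaleC_add_right scaleC_add_left scaleC_scaleC)

definition cdim :: "'a::chilbert_space set \<Rightarrow> enat" where
  "cdim X = (if \<exists>B. finite B \<and> X \<subseteq> cspan B then enat (cdim_nat X) else \<infinity>)"

definition closed_csubspace :: "'a::chilbert_space set \<Rightarrow> bool" where
  "closed_csubspace X \<longleftrightarrow> csubspace X \<and> closed X"

definition corthogonal :: "'a::chilbert_space set \<Rightarrow> 'a set \<Rightarrow> bool" where
  "corthogonal X Y \<longleftrightarrow> (\<forall>x\<in>X. \<forall>y\<in>Y. cinner x y = 0)"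

definition corth_comp :: "'a::chilbert_space set \<Rightarrow> 'a set" where
  "corth_comp X = {y. \<forall>x\<in>X. cinner x y = 0}"

text \<open>For a closed subspace the codimension is the dimension of its orthogonal complement.\<close>

definition ccodim :: "'a::chilbert_space set \<Rightarrow> enat" where
  "ccodim X = cdim (corth_comp X)"

definition cproj :: "'a::chilbert_space set \<Rightarrow> 'a \<Rightarrow> 'a" where
  "cproj X x = (THE y. y \<in> X \<and> x - y \<in> corth_comp X)"

definition eigenspace :: "('a::chilbert_space \<Rightarrow> 'a) \<Rightarrow> complex \<Rightarrow> 'a set" where
  "eigenspace A c = {x. A x = c *\<^sub>C x}"

definition unitary :: "('a::chilbert_space \<Rightarrow> 'a) \<Rightarrow> bool" where
  "unitary U \<longleftrightarrow> surj U \<and> (\<forall>x y. U (x + y) = U x + U y) \<and> (\<forall>c x. U (c *\<^sub>C x) = c *\<^sub>C U x)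
     \<and> (\<forall>x y. cinner (U x) (U y) = cinner x y)"

definition antiunitary :: "('a::chilbert_space \<Rightarrow> 'a) \<Rightarrow> bool" where
  "antiunitary U \<longleftrightarrow> surj U \<and> (\<forall>x y. U (x + y) = U x + U y) \<and> (\<forall>c x. U (c *\<^sub>C x) = cnj c *\<^sub>C U x)
     \<and> (\<forall>x y. cinner (U x) (U y) = cnj (cinner x y))"

definition cadjoint :: "('a::chilbert_space \<Rightarrow> 'a) \<Rightarrow> 'a \<Rightarrow> 'a" where
  "cadjoint U = (SOME V. \<forall>x y. cinner (U x) y = cinner x (V y))"

text \<open>The adjoint of a conjugate-linear operator.\<close>

definition conj_adjoint :: "('a::chilbert_space \<Rightarrow> 'a) \<Rightarrow> 'a \<Rightarrow> 'a" where
  "conj_adjoint U = (SOME V. \<forall>x y. cinner (U x) y = cnj (cinner x (V y)))"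

section \<open>The conjugacy class and its graph\<close>

definition orth_decomp :: "'i set \<Rightarrow> ('i \<Rightarrow> 'a::chilbert_space set) \<Rightarrow> bool" where
  "orth_decomp I X \<longleftrightarrow> (\<forall>i\<in>I. closed_csubspace (X i))
     \<and> (\<forall>i\<in>I. \<forall>j\<in>I. i \<noteq> j \<longrightarrow> corthogonal (X i) (X j))
     \<and> (\<forall>x. \<exists>y. (\<forall>i\<in>I. y i \<in> X i) \<and> x = (\<Sum>i\<in>I. y i))"

definition spectral_op :: "'i set \<Rightarrow> ('i \<Rightarrow> real) \<Rightarrow> ('i \<Rightarrow> 'a::chilbert_space set) \<Rightarrow> 'a \<Rightarrow> 'a" where
  "spectral_op I a X = (\<lambda>x. \<Sum>i\<in>I. complex_of_real (a i) *\<^sub>C cproj (X i) x)"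

definition op_class :: "'i set \<Rightarrow> ('i \<Rightarrow> real) \<Rightarrow> ('i \<Rightarrow> enat) \<Rightarrow> ('a::chilbert_space \<Rightarrow> 'a) set" where
  "op_class I a n =
     {spectral_op I a X | X. orth_decomp I X \<and> (\<forall>i\<in>I. cdim (X i) = n i)}"

definition hyperplane_in :: "'a::chilbert_space set \<Rightarrow> 'a set \<Rightarrow> bool" where
  "hyperplane_in Z X \<longleftrightarrow> closed_csubspace Z \<and> (\<exists>v. v \<notin> Z \<and> X = cspan (insert v Z))"

definition adjacent_subspaces :: "'a::chilbert_space set \<Rightarrow> 'a set \<Rightarrow> bool" where
  "adjacent_subspaces X Y \<longleftrightarrow> closed_csubspace X \<and> closed_csubspace Y
     \<and> (cdim X = cdim Y \<and> cdim X \<noteq> \<infinity> \<or> ccodim X = ccodim Y \<and> ccodim X \<noteq> \<infinity>)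
     \<and> hyperplane_in (X \<inter> Y) X \<and> hyperplane_in (X \<inter> Y) Y"

definition ij_adjacent ::
  "'i set \<Rightarrow> ('i \<Rightarrow> real) \<Rightarrow> 'i \<Rightarrow> 'i \<Rightarrow> ('a::chilbert_space \<Rightarrow> 'a) \<Rightarrow> ('a \<Rightarrow> 'a) \<Rightarrow> bool" where
  "ij_adjacent I a i j A B \<longleftrightarrow>
     adjacent_subspaces (eigenspace A (a i)) (eigenspace B (a i))
     \<and> adjacent_subspaces (eigenspace A (a j)) (eigenspace B (a j))
     \<and> (\<forall>t\<in>I - {i, j}. eigenspace A (a t) = eigenspace B (a t))"

definition adjacent_ops ::
  "'i set \<Rightarrow> ('i \<Rightarrow> real) \<Rightarrow> ('a::chilbert_space \<Rightarrow> 'a) \<Rightarrow> ('a \<Rightarrow> 'a) \<Rightarrow> bool" where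
  "adjacent_ops I a A B \<longleftrightarrow> (\<exists>i\<in>I. \<exists>j\<in>I. i \<noteq> j \<and> ij_adjacent I a i j A B)"

text \<open>A simple graph is a pair of a vertex set and a set of two-element edges.\<close>

definition op_graph ::
  "'i set \<Rightarrow> ('i \<Rightarrow> real) \<Rightarrow> ('i \<Rightarrow> enat)
     \<Rightarrow> ('a::chilbert_space \<Rightarrow> 'a) set \<times> ('a \<Rightarrow> 'a) set set" where
  "op_graph I a n =
     (op_class I a n,
      {{A, B} | A B. A \<in> op_class I a n \<and> B \<in> op_class I a n \<and> adjacent_ops I a A B})"

definition graph_automorphism :: "'v set \<times> 'v set set \<Rightarrow> ('v \<Rightarrow> 'v) \<Rightarrow> bool" where
  "graph_automorphism G f \<longleftrightarrow> bij_betw f (fst G) (fst G)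
     \<and> (\<forall>u\<in>fst G. \<forall>v\<in>fst G. {u, v} \<in> snd G \<longleftrightarrow> {f u, f v} \<in> snd G)"

definition dim_perms :: "'i set \<Rightarrow> ('i \<Rightarrow> enat) \<Rightarrow> ('i \<Rightarrow> 'i) set" where
  "dim_perms I n = {\<delta>. \<delta> permutes I \<and> (\<forall>i\<in>I. n (\<delta> i) = n i)}"

definition perm_op ::
  "'i set \<Rightarrow> ('i \<Rightarrow> real) \<Rightarrow> ('i \<Rightarrow> 'i) \<Rightarrow> ('a::chilbert_space \<Rightarrow> 'a) \<Rightarrow> 'a \<Rightarrow> 'a" where
  "perm_op I a \<delta> A = spectral_op I a (\<lambda>i. eigenspace A (a (\<delta> i)))"

end

theory Submission
  imports Defs
begin

text \<open>Every edge at a frame $X$ (an orthogonal decomposition) arises from a reflection in a vector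
  $x + y$ with nonzero $x \<in> X_i$ and $y \<in> X_j$; its type is the pair $ij$. Triangles have a single
  type, and any two neighbours of $X$ of the same type are joined inside the neighbourhood of $X$, so an
  automorphism permutes the types at each vertex. Squares transport types along an edge, unless the
  edge exchanges two lines; these exceptional edges are recognised by their squares, and each is
  bypassed by two ordinary ones. Hence the permutation of types is the same at all vertices. It preserves
  triangles of types, which are visible in 4-cycles, so it comes from a permutation $\delta$ of the indices.

  Frames with the same $X_i$ are connected by edges whose type avoids $i$. Therefore the space in slot
  $\delta(i)$ of the image frame depends only on $X_i$, and this defines maps $g_i$ between the
  Grassmannians which preserve orthogonality between different slots. Orthogonality determines
  adjacency of finite-dimensional subspaces, and the resulting stars allow $g_i$ to be carried
  down to lines. A comparison through a third slot shows that two such line maps agree; the common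
  line map preserves orthogonality and is induced by a unitary or antiunitary operator, which then
  induces all the $g_i$.\<close>

subsection \<open>Inner products and finite-dimensional subspaces\<close>

text \<open>Writing edges as reflections turns transport along an edge into conjugation:
  \<open>act w\<close> carries the edge of \<open>v\<close> at \<open>X\<close> to the edge of
  \<open>refl_at w v\<close> at \<open>act w X\<close>. The obstacle is an edge with
  \<open>norm x = norm y\<close>: it acts as a transposition on two lines, so one vector
  \<open>v\<close> can have different types at its two ends, and transport of types along that edge
  is ambiguous.

  An infinite-dimensional slot cannot be filled vector by vector. It is recovered as the orthogonal
  complement of the other slots, and line maps are constructed on finite slots only.

  The assumption that there are three slots enters in several ways: a third slot exposes the
  exchange edges, supplies the spare dimension that makes double complements exact, and allows the
  line maps of two slots to be compared.

  Apart from an infinite slot being fixed, nothing is known about dimensions under \<delta> until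
  the isometry exists. The descent to lines therefore carries separate dimensions for source and
  target, and equality of dimensions is read off from \<open>U\<close> at the end.\<close>

lemma cinner_add_left: "cinner (x + y) z = cinner x z + cinner y z"
  by (subst (1 2 3) cinner_commute) (simp add: cinner_add_right)

lemma cinner_scaleC_left: "cinner (c *\<^sub>C x) y = cnj c * cinner x y"
  by (subst (1 2) cinner_commute) (simp add: cinner_scaleC_right)

lemma scaleC_one [simp]: "1 *\<^sub>C x = x"
  by (rule complex_vector.scale_one)

lemma scaleC_minus1: "(-1) *\<^sub>C x = - x"
  by (simp add: complex_vector.scale_minus_left)

lemmas scaleC_diff_left = complex_vector.scale_left_diff_distrib
lemmas scaleC_diff_right = complex_vector.scale_right_diff_distrib

lemma cinner_zero_right [simp]: "cinner x 0 = 0"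
  using cinner_scaleC_right[of x 0 0] by simp

lemma cinner_zero_left [simp]: "cinner 0 x = 0"
  using cinner_scaleC_left[of 0 0 x] by simp

lemma cinner_minus_right [simp]: "cinner x (- y) = - cinner x y"
  using cinner_scaleC_right[of x "-1" y] by (simp add: scaleC_minus1)

lemma cinner_minus_left [simp]: "cinner (- x) y = - cinner x y"
  using cinner_scaleC_left[of "-1" x y] by (simp add: scaleC_minus1)

lemma cinner_diff_right: "cinner x (y - z) = cinner x y - cinner x z"
  using cinner_add_right[of x y "- z"] by simp

lemma cinner_diff_left: "cinner (x - y) z = cinner x z - cinner y z"
  using cinner_add_left[of x "- y" z] by simp

lemma cinner_sum_right: "cinner x (sum f S) = (\<Sum>i\<in>S. cinner x (f i))"
  by (induction S rule: infinite_finite_induct) (simp_all add: cinner_add_right)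

lemma cinner_sum_left: "cinner (sum f S) x = (\<Sum>i\<in>S. cinner (f i) x)"
  by (induction S rule: infinite_finite_induct) (simp_all add: cinner_add_left)

lemmas cinner_simps = cinner_add_left cinner_add_right cinner_diff_left cinner_diff_right
  cinner_scaleC_left cinner_scaleC_right cinner_sum_left cinner_sum_right

lemma cinner_self_eq_0 [simp]: "cinner x x = 0 \<longleftrightarrow> x = 0"
  by (simp add: cinner_self)

lemma cinner_eq_0_commute: "cinner x y = 0 \<longleftrightarrow> cinner y x = 0"
  using cinner_commute[of x y] by simp

lemma cnj_cinner_self [simp]: "cnj (cinner x x) = cinner x x"
  by (simp add: cinner_self)

lemma norm_scaleC: "norm (c *\<^sub>C x) = cmod c * norm x"
proof -
  have "cinner (c *\<^sub>C x) (c *\<^sub>C x) = (c * cnj c) * cinner x x"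
    by (simp add: cinner_scaleC_left cinner_scaleC_right)
  then have "complex_of_real ((norm (c *\<^sub>C x))\<^sup>2) = complex_of_real ((cmod c)\<^sup>2 * (norm x)\<^sup>2)"
    by (simp only: cinner_self complex_norm_square[symmetric] of_real_mult)
  then have "(norm (c *\<^sub>C x))\<^sup>2 = (cmod c * norm x)\<^sup>2"
    by (simp only: of_real_eq_iff power_mult_distrib)
  then show ?thesis
    by (simp add: power2_eq_iff_nonneg)
qed

lemma norm_add_orth:
  assumes "cinner x y = 0"
  shows "(norm (x + y))\<^sup>2 = (norm x)\<^sup>2 + (norm y)\<^sup>2"
proof -
  have "cinner y x = 0" using assms cinner_eq_0_commute by blast
  then have "complex_of_real ((norm (x + y))\<^sup>2) = complex_of_real ((norm x)\<^sup>2 + (norm y)\<^sup>2)"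
    unfolding cinner_self[symmetric] of_real_add using assms
    by (simp add: cinner_add_left cinner_add_right)
  then show ?thesis by (simp only: of_real_eq_iff)
qed

lemma Re_cinner_polar: "4 * Re (cinner x y) = (norm (x + y))\<^sup>2 - (norm (x - y))\<^sup>2"
proof -
  have "complex_of_real ((norm (x + y))\<^sup>2) = cinner x x + cinner x y + cnj (cinner x y) + cinner y y"
    unfolding cinner_self[symmetric] using cinner_commute[of y x]
    by (simp add: cinner_simps)
  moreover have "complex_of_real ((norm (x - y))\<^sup>2) = cinner x x - cinner x y - cnj (cinner x y) + cinner y y"
    unfolding cinner_self[symmetric] using cinner_commute[of y x]
    by (simp add: cinner_simps)
  ultimately have "complex_of_real ((norm (x + y))\<^sup>2 - (norm (x - y))\<^sup>2) = complex_of_real (4 * Re (cinner x y))"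
    by (simp add: complex_eq_iff)
  then show ?thesis by (simp only: of_real_eq_iff)
qed

text \<open>Polarisation expresses the real part of \<open>cinner x y\<close> by norms; the
  imaginary part is the real part of the inner product of \<open>- \<i> *\<^sub>C x\<close> with
  \<open>- y\<close>. Continuity in \<open>y\<close> then comes from that of the norm.\<close>

lemma closed_cinner_eq_0: "closed {y::'a::chilbert_space. cinner x y = 0}"
proof -
  have "(\<lambda>y. cinner x y) = (\<lambda>y. Complex (((norm (x + y))\<^sup>2 - (norm (x - y))\<^sup>2) / 4)
      (((norm (- \<i> *\<^sub>C x + - y))\<^sup>2 - (norm (- \<i> *\<^sub>C x - - y))\<^sup>2) / 4))"
  proof
    fix y
    have "Re (cinner x y) = ((norm (x + y))\<^sup>2 - (norm (x - y))\<^sup>2) / 4"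
      using Re_cinner_polar[of x y] by simp
    moreover have "Im (cinner x y) = ((norm (- \<i> *\<^sub>C x + - y))\<^sup>2 - (norm (- \<i> *\<^sub>C x - - y))\<^sup>2) / 4"
      using Re_cinner_polar[of "- \<i> *\<^sub>C x" "- y"]
      by (simp only: cinner_scaleC_left cinner_minus_right) simp
    ultimately show "cinner x y = Complex (((norm (x + y))\<^sup>2 - (norm (x - y))\<^sup>2) / 4)
      (((norm (- \<i> *\<^sub>C x + - y))\<^sup>2 - (norm (- \<i> *\<^sub>C x - - y))\<^sup>2) / 4)"
      by (simp add: complex_eq_iff)
  qed
  then have "continuous_on UNIV (\<lambda>y. cinner x y)"
    by (simp only: Complex_eq) (intro continuous_intros; simp)
  then show ?thesis
    using continuous_closed_preimage_constant[of UNIV "\<lambda>y. cinner x y" 0] by simp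
qed

lemma closed_corth_comp: "closed (corth_comp X)"
proof -
  have "corth_comp X = (\<Inter>x\<in>X. {y. cinner x y = 0})"
    by (auto simp: corth_comp_def)
  then show ?thesis by (auto intro!: closed_INT closed_cinner_eq_0)
qed

lemma csubspaceI:
  assumes "0 \<in> V" "\<And>x y. x \<in> V \<Longrightarrow> y \<in> V \<Longrightarrow> x + y \<in> V" "\<And>c x. x \<in> V \<Longrightarrow> c *\<^sub>C x \<in> V"
  shows "csubspace V"
  using assms by (simp add: complex_vector.subspace_def)

lemma csubspace_corth_comp: "csubspace (corth_comp X)"
  by (rule csubspaceI) (auto simp: corth_comp_def cinner_simps)

lemma cspan_orth_right:
  assumes "x \<in> cspan B" "\<And>b. b \<in> B \<Longrightarrow> cinner y b = 0"
  shows "cinner y x = 0"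
proof -
  have "cspan B \<subseteq> corth_comp {y}"
    by (rule complex_vector.span_minimal[OF _ csubspace_corth_comp]) (auto simp: corth_comp_def assms(2))
  then show ?thesis using assms by (auto simp: corth_comp_def)
qed

lemma cspan_insert_iff:
  assumes "csubspace V"
  shows "y \<in> cspan (insert x V) \<longleftrightarrow> (\<exists>c. y - c *\<^sub>C x \<in> V)"
  unfolding complex_vector.span_breakdown_eq complex_vector.span_eq_iff[THEN iffD2, OF assms] ..

lemma orth_proj_exists_span:
  assumes "finite B"
  shows "\<exists>v\<in>cspan B. \<forall>y\<in>cspan B. cinner y (x - v) = 0"
  using assms
proof (induction B arbitrary: x rule: finite_induct)
  case empty
  then show ?case by simp
next
  case (insert b B)
  obtain u where u: "u \<in> cspan B" "\<forall>y\<in>cspan B. cinner y (b - u) = 0" using insert.IH by blast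
  obtain v where v: "v \<in> cspan B" "\<forall>y\<in>cspan B. cinner y (x - v) = 0" using insert.IH by blast
  \<comment> \<open>If \<open>b\<close> already lies in the span of \<open>B\<close>, then
    \<open>b - u = 0\<close> and division by zero gives \<open>c = 0\<close>, leaving
    \<open>v' = v\<close>.\<close>
  define c where "c = cinner (b - u) x / cinner (b - u) (b - u)"
  define v' where "v' = v + c *\<^sub>C (b - u)"
  have sub: "cspan B \<subseteq> cspan (insert b B)" by (rule complex_vector.span_mono) auto
  have "b \<in> cspan (insert b B)" by (rule complex_vector.span_base) auto
  then have "v' \<in> cspan (insert b B)"
    using u(1) v(1) sub unfolding v'_def
    by (intro complex_vector.span_add complex_vector.span_scale complex_vector.span_diff) auto
  moreover have "cinner y (x - v') = 0" if "y \<in> cspan (insert b B)" for y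
  proof -
    have "\<exists>k. y - k *\<^sub>C b \<in> cspan B"
      using that complex_vector.span_breakdown_eq[THEN iffD1] by fast
    then obtain k where k: "y - k *\<^sub>C b \<in> cspan B" by blast
    define z where "z = y - k *\<^sub>C b + k *\<^sub>C u"
    have z: "z \<in> cspan B" unfolding z_def
  by (rule complex_vector.span_add[OF k complex_vector.span_scale[OF u(1)]])
    have y: "y = z + k *\<^sub>C (b - u)" by (simp add: z_def scaleC_diff_right)
    have "cinner z (x - v') = 0"
      using u(2) v(2) z by (simp add: v'_def cinner_simps algebra_simps)
    moreover have "cinner (b - u) (x - v') = 0"
    proof (cases "b - u = 0")
      case True then show ?thesis by simp
    next
      case False
      have "cinner (b - u) v = 0" using u(2) v(1) cinner_eq_0_commute by blast
      then show ?thesis using False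
        unfolding v'_def cinner_diff_right[of "b - u" x] cinner_add_right cinner_scaleC_right c_def
        by simp
    qed
    ultimately show ?thesis by (simp add: y cinner_add_left cinner_scaleC_left)
  qed
  ultimately show ?case by blast
qed

text \<open>A relation rather than a function: finiteness and the value come together, and infinite
  dimension is the absence of any \<open>k\<close>.\<close>

definition dimn :: "nat \<Rightarrow> 'a::chilbert_space set \<Rightarrow> bool" where
  "dimn k V \<longleftrightarrow> (\<exists>B. finite B \<and> card B = k \<and> \<not> cdependent B \<and> V = cspan B)"

lemma dimn_csubspace: "dimn k V \<Longrightarrow> csubspace V"
  by (auto simp: dimn_def)

lemma dimn_iff_cdim:
  assumes "csubspace V"
  shows "dimn k V \<longleftrightarrow> cdim V = enat k"
proof
  assume "dimn k V"
  then obtain B where B: "finite B" "card B = k" "\<not> cdependent B" "V = cspan B"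
    by (auto simp: dimn_def)
  have "cdim_nat V = k"
    using B complex_vector.dim_span_eq_card_independent by blast
  then show "cdim V = enat k" using B by (auto simp: cdim_def)
next
  assume k: "cdim V = enat k"
  then obtain C where C: "finite C" "V \<subseteq> cspan C" by (auto simp: cdim_def split: if_splits)
  from k have d: "cdim_nat V = k" by (auto simp: cdim_def split: if_splits)
  obtain B where B: "B \<subseteq> V" "\<not> cdependent B" "V \<subseteq> cspan B" "card B = cdim_nat V"
    using complex_vector.basis_exists by blast
  have "finite B" using complex_vector.independent_span_bound[OF C(1) B(2)] B(1) C(2) by blast
  moreover have "V = cspan B"
    using B assms complex_vector.span_minimal by blast
  ultimately show "dimn k V" using B d by (auto simp: dimn_def)
qed

lemma cdim_infinite_iff:
  assumes "csubspace V"
  shows "cdim V = \<infinity> \<longleftrightarrow> (\<forall>k. \<not> dimn k V)"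
  using assms by (metis dimn_iff_cdim enat.distinct(1) not_enat_eq)

lemma dimn_unique: "dimn k V \<Longrightarrow> dimn l V \<Longrightarrow> k = l"
  using dimn_csubspace dimn_iff_cdim by (metis enat.inject)

lemma dimn_0_iff: "dimn 0 V \<longleftrightarrow> V = {0}"
  by (auto simp: dimn_def complex_vector.independent_empty)

lemma dimn_sub:
  assumes "dimn k V" "csubspace W" "W \<subseteq> V"
  shows "\<exists>l\<le>k. dimn l W"
proof -
  obtain C where C: "finite C" "card C = k" "V = cspan C" using assms by (auto simp: dimn_def)
  obtain B where B: "B \<subseteq> W" "\<not> cdependent B" "W \<subseteq> cspan B"
    using complex_vector.basis_exists[of W] by metis
  have "finite B \<and> card B \<le> card C"
    using complex_vector.independent_span_bound[OF C(1) B(2)] B(1) C(3) assms(3) by blast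
  moreover have "W = cspan B"
    using B assms complex_vector.span_minimal by blast
  ultimately show ?thesis using B C by (auto simp: dimn_def)
qed

lemma dimn_mono: "dimn k V \<Longrightarrow> dimn l W \<Longrightarrow> W \<subseteq> V \<Longrightarrow> l \<le> k"
  using dimn_sub dimn_unique dimn_csubspace by blast

lemma dimn_insert:
  assumes "dimn k V" "x \<notin> V"
  shows "dimn (Suc k) (cspan (insert x V))"
proof -
  obtain B where B: "finite B" "card B = k" "\<not> cdependent B" "V = cspan B"
    using assms by (auto simp: dimn_def)
  have "x \<notin> B" using B(4) assms(2) complex_vector.span_base by blast
  moreover have "\<not> cdependent (insert x B)"
    using B assms complex_vector.independent_insertI by blast
  moreover have "cspan (insert x V) = cspan (insert x B)"
    unfolding B(4) by (auto simp: complex_vector.span_breakdown_eq complex_vector.span_span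
        dest: complex_vector.span_breakdown_eq[THEN iffD1])
  ultimately show ?thesis using B unfolding dimn_def
    by (intro exI[of _ "insert x B"]) auto
qed

lemma dimn_eq:
  assumes "dimn k V" "dimn k W" "W \<subseteq> V"
  shows "W = V"
proof (rule ccontr)
  assume "W \<noteq> V"
  then obtain x where x: "x \<in> V" "x \<notin> W" using assms(3) by blast
  have "cspan (insert x W) \<subseteq> V"
    using assms x dimn_csubspace by (intro complex_vector.span_minimal) auto
  then have "Suc k \<le> k" using dimn_mono[OF assms(1) dimn_insert[OF assms(2) x(2)]] by blast
  then show False by simp
qed

text \<open>The last hypothesis bounds the dimension of \<open>U\<close> below by \<open>m\<close>
  in a form that is vacuous for infinite-dimensional \<open>U\<close>. Vectors of \<open>U\<close>
  are added one at a time.\<close>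

lemma dimn_between:
  assumes "dimn k V" "V \<subseteq> U" "csubspace U" "k \<le> m" "\<And>l. dimn l U \<Longrightarrow> m \<le> l"
  shows "\<exists>W. V \<subseteq> W \<and> W \<subseteq> U \<and> dimn m W"
  using assms(4,5)
proof (induction m rule: dec_induct)
  case base
  then show ?case using assms by blast
next
  case (step m)
  then obtain W where W: "V \<subseteq> W" "W \<subseteq> U" "dimn m W"
    using Suc_leD by blast
  have "W \<noteq> U" using W step.prems[of m] by auto
  then obtain x where x: "x \<in> U" "x \<notin> W" using W by blast
  have "cspan (insert x W) \<subseteq> U" using W x assms by (intro complex_vector.span_minimal) auto
  moreover have "W \<subseteq> cspan (insert x W)" using complex_vector.span_base by blast
  ultimately show ?case using dimn_insert[OF W(3) x(2)] W by blast
qed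

lemma dimn_orth_proj:
  assumes "dimn k V"
  shows "\<exists>v\<in>V. \<forall>y\<in>V. cinner y (x - v) = 0"
  using assms orth_proj_exists_span by (auto simp: dimn_def)

text \<open>Serves inductions on the dimension: the new vector is the residual of a projection to
  \<open>K\<close>, so each stage adds something orthogonal to what is already placed.\<close>

lemma dimn_Suc_split:
  assumes "dimn (Suc k) V"
  shows "\<exists>K y. dimn k K \<and> K \<subseteq> V \<and> y \<noteq> 0 \<and> y \<in> V \<and> V = cspan (insert y K) \<and> (\<forall>x\<in>K. cinner x y = 0)"
proof -
  have "\<exists>K. {0} \<subseteq> K \<and> K \<subseteq> V \<and> dimn k K"
    using assms dimn_csubspace[OF assms] dimn_unique complex_vector.subspace_0
    by (intro dimn_between[of 0]) (auto simp: dimn_0_iff, fastforce)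
  then obtain K where K: "K \<subseteq> V" "dimn k K" by blast
  have "K \<noteq> V" using K assms dimn_unique n_not_Suc_n by blast
  then obtain x where x: "x \<in> V" "x \<notin> K" using K by blast
  obtain v where v: "v \<in> K" "\<forall>y\<in>K. cinner y (x - v) = 0" using dimn_orth_proj[OF K(2)] by blast
  define y where "y = x - v"
  have y: "y \<in> V" using x v K dimn_csubspace[OF assms] complex_vector.subspace_diff
    unfolding y_def by blast
  have "y \<notin> K" using x(2) v(1) dimn_csubspace[OF K(2)] complex_vector.subspace_add[of K y v]
    unfolding y_def by auto
  then have "dimn (Suc k) (cspan (insert y K))" using K dimn_insert by blast
  moreover have "cspan (insert y K) \<subseteq> V"
    using K y dimn_csubspace[OF assms] by (intro complex_vector.span_minimal) auto
  ultimately have "V = cspan (insert y K)" using dimn_eq[OF assms] by blast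
  moreover have "y \<noteq> 0" using \<open>y \<notin> K\<close> dimn_csubspace[OF K(2)] complex_vector.subspace_0 by auto
  ultimately show ?thesis using K y v unfolding y_def by blast
qed

subsection \<open>Orthogonality-preserving bijections of lines\<close>

lemma norm_eq_1_cinner: "norm x = 1 \<longleftrightarrow> cinner x x = 1"
proof -
  have "cinner x x = 1 \<longleftrightarrow> complex_of_real ((norm x)\<^sup>2) = complex_of_real 1"
    by (simp only: cinner_self of_real_1)
  then show ?thesis by (simp only: of_real_eq_iff power2_eq_1_iff) (use norm_ge_zero[of x] in linarith)
qed

text \<open>Only the line of \<open>\<psi> x\<close> has a meaning; \<open>\<psi>\<close> picks a
  representative of it. The last assumption says that the dimension is at least 3, in the form in
  which auxiliary vectors are drawn.\<close>

locale orth_bijection =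
  fixes \<psi> :: "'a::chilbert_space \<Rightarrow> 'a"
  assumes psi_nz: "x \<noteq> 0 \<Longrightarrow> \<psi> x \<noteq> 0"
    and psi_orth: "x \<noteq> 0 \<Longrightarrow> y \<noteq> 0 \<Longrightarrow> cinner (\<psi> x) (\<psi> y) = 0 \<longleftrightarrow> cinner x y = 0"
    and psi_surj: "z \<noteq> 0 \<Longrightarrow> \<exists>x c. x \<noteq> 0 \<and> \<psi> x = c *\<^sub>C z"
    and dim_ge_3: "\<exists>z::'a. z \<noteq> 0 \<and> cinner x z = 0 \<and> cinner y z = 0"
begin

text \<open>If the residual \<open>r\<close> of \<open>\<psi> z\<close> over the two image vectors
  were nonzero, it would be proportional to some \<open>\<psi> u\<close>. Orthogonality pulls back,
  making \<open>u\<close> orthogonal to \<open>x\<close> and \<open>y\<close>, hence to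
  \<open>z\<close>; so \<open>r\<close> would be orthogonal to \<open>\<psi> z\<close> and thus to
  itself.\<close>

lemma psi_span:
  assumes nz: "x \<noteq> 0" "y \<noteq> 0" "z \<noteq> 0" and z: "z = a *\<^sub>C x + b *\<^sub>C y"
  shows "\<exists>c d. \<psi> z = c *\<^sub>C \<psi> x + d *\<^sub>C \<psi> y"
proof -
  obtain v where v: "v \<in> cspan {\<psi> x, \<psi> y}" "\<forall>w\<in>cspan {\<psi> x, \<psi> y}. cinner w (\<psi> z - v) = 0"
    using orth_proj_exists_span[of "{\<psi> x, \<psi> y}" "\<psi> z"] by auto
  define r where "r = \<psi> z - v"
  have r: "cinner (\<psi> x) r = 0" "cinner (\<psi> y) r = 0" "cinner v r = 0"
    using v by (auto simp: r_def complex_vector.span_base)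
  have "r = 0"
  proof (rule ccontr)
    assume "r \<noteq> 0"
    then obtain u c where u: "u \<noteq> 0" "\<psi> u = c *\<^sub>C r" using psi_surj by blast
    have "c \<noteq> 0" using psi_nz[OF u(1)] u(2) by auto
    have "cinner (\<psi> x) (\<psi> u) = 0" "cinner (\<psi> y) (\<psi> u) = 0"
      by (simp_all add: u r cinner_scaleC_right)
    then have "cinner x u = 0" "cinner y u = 0" using psi_orth nz u(1) by blast+
    then have "cinner z u = 0" by (simp add: z cinner_simps)
    then have "cinner (\<psi> z) (\<psi> u) = 0" using psi_orth nz u(1) by blast
    then have "cinner (\<psi> z) r = 0" using \<open>c \<noteq> 0\<close> by (simp add: u cinner_scaleC_right)
    then have "cinner r r = 0" using r(3) unfolding r_def cinner_diff_left by simp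
    then show False using \<open>r \<noteq> 0\<close> by simp
  qed
  then have "\<psi> z \<in> cspan {\<psi> x, \<psi> y}" using v by (simp add: r_def)
  then have "\<exists>c d. \<psi> z - c *\<^sub>C \<psi> x - d *\<^sub>C \<psi> y = 0"
    unfolding complex_vector.span_breakdown_eq by (simp add: complex_vector.span_empty)
  then show ?thesis by (metis add.commute diff_add_cancel diff_eq_eq add_0)
qed

text \<open>The component of \<open>x\<close> orthogonal to \<open>y\<close> is mapped to something
  orthogonal to the common image line, so it is orthogonal to \<open>x\<close> too and
  vanishes.\<close>

lemma psi_parD:
  assumes nz: "x \<noteq> 0" "y \<noteq> 0" and c: "\<psi> x = c *\<^sub>C \<psi> y"
  shows "\<exists>d. x = d *\<^sub>C y"
proof -
  define r where "r = x - (cinner y x / cinner y y) *\<^sub>C y"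
  have ry: "cinner y r = 0" using nz by (simp add: r_def cinner_diff_right cinner_scaleC_right)
  have "r = 0"
  proof (rule ccontr)
    assume r: "r \<noteq> 0"
    then have "cinner (\<psi> y) (\<psi> r) = 0" using ry psi_orth nz by blast
    then have "cinner (\<psi> x) (\<psi> r) = 0" by (simp add: c cinner_scaleC_left)
    then have "cinner x r = 0" using psi_orth r nz by blast
    then have "cinner r r = 0" using ry
      by (subst (1) r_def) (simp add: cinner_diff_left cinner_scaleC_left)
    then show False using r by simp
  qed
  then show ?thesis by (auto simp: r_def)
qed

lemma psi_scale: "x \<noteq> 0 \<Longrightarrow> c \<noteq> 0 \<Longrightarrow> \<exists>d. \<psi> (c *\<^sub>C x) = d *\<^sub>C \<psi> x"
  using psi_span[of x x "c *\<^sub>C x" c 0] by (auto simp flip: scaleC_add_left)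

definition "e0 = (SOME e::'a. norm e = 1)"

lemma e0: "norm e0 = 1"
proof -
  obtain z :: 'a where "z \<noteq> 0" using dim_ge_3 by blast
  then have "norm ((1 / norm z) *\<^sub>R z) = 1" by simp
  then show ?thesis unfolding e0_def by (rule someI)
qed

lemma e0_cinner: "cinner e0 e0 = 1"
  using e0 norm_eq_1_cinner by blast

lemma e0_nz: "e0 \<noteq> 0"
  using e0 by auto

definition "f0 = (1 / norm (\<psi> e0)) *\<^sub>R \<psi> e0"

lemma f0: "norm f0 = 1"
  using psi_nz[OF e0_nz] by (simp add: f0_def)

lemma f0_cinner: "cinner f0 f0 = 1"
  using f0 norm_eq_1_cinner by blast

lemma psi_e0: "\<exists>c. c \<noteq> 0 \<and> \<psi> e0 = c *\<^sub>C f0"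
  using psi_nz[OF e0_nz]
  by (intro exI[of _ "complex_of_real (norm (\<psi> e0))"]) (simp add: f0_def scaleC_of_real)

definition "E = {x. cinner e0 x = 0}"

lemma E_simps: "x \<in> E \<Longrightarrow> y \<in> E \<Longrightarrow> x + y \<in> E" "x \<in> E \<Longrightarrow> c *\<^sub>C x \<in> E"
  "x \<in> E \<Longrightarrow> r *\<^sub>R x \<in> E" "0 \<in> E" "x \<in> E \<Longrightarrow> - x \<in> E" "x \<in> E \<Longrightarrow> y \<in> E \<Longrightarrow> x - y \<in> E"
  by (auto simp: E_def cinner_simps simp flip: scaleC_of_real)

lemma E_orth: "x \<in> E \<Longrightarrow> cinner x e0 = 0"
  using cinner_eq_0_commute by (auto simp: E_def)

lemma E_add_nz: "x \<in> E \<Longrightarrow> e0 + x \<noteq> 0"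
  using e0_cinner by (auto simp: E_def add_eq_0_iff)

text \<open>The image of the line through $e_0 + x$ contains a unique vector of the form $f_0 + Tx$. The map
  $T$ is additive as in the fundamental theorem of projective geometry. Since $e_0 + x \perp e_0 - x$ for
  unit $x$, it preserves unit vectors, so it is bounded and therefore real-linear; no appeal to field
  automorphisms is needed.\<close>

definition "\<kappa> x = cinner f0 (\<psi> (e0 + x))"
definition "T x = (1 / \<kappa> x) *\<^sub>C \<psi> (e0 + x) - f0"

lemma kappa_nz:
  assumes "x \<in> E" shows "\<kappa> x \<noteq> 0"
proof
  assume "\<kappa> x = 0"
  then have "cinner (\<psi> e0) (\<psi> (e0 + x)) = 0"
    using psi_e0 by (auto simp: \<kappa>_def cinner_scaleC_left)
  then have "cinner e0 (e0 + x) = 0" using psi_orth e0_nz E_add_nz[OF assms] by blast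
  then show False using assms e0_cinner by (simp add: E_def cinner_add_right)
qed

lemma psi_T: "x \<in> E \<Longrightarrow> \<psi> (e0 + x) = \<kappa> x *\<^sub>C (f0 + T x)"
  using kappa_nz by (simp add: T_def scaleC_scaleC)

lemma f0_T: "x \<in> E \<Longrightarrow> cinner f0 (T x) = 0"
  using kappa_nz[of x] f0_cinner by (simp add: T_def cinner_simps \<kappa>_def)

lemma T_f0: "x \<in> E \<Longrightarrow> cinner (T x) f0 = 0"
  using f0_T cinner_eq_0_commute by blast

lemma f0_psi: "x \<in> E \<Longrightarrow> x \<noteq> 0 \<Longrightarrow> cinner f0 (\<psi> x) = 0"
  using psi_e0 psi_orth[OF e0_nz, of x] by (auto simp: E_def cinner_scaleC_left)

lemma T_0: "T 0 = 0"
  using psi_e0 f0_cinner by (auto simp: T_def \<kappa>_def cinner_scaleC_right scaleC_scaleC)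

lemma T_nz:
  assumes "x \<in> E" "x \<noteq> 0" shows "T x \<noteq> 0"
proof
  assume "T x = 0"
  then have "\<psi> (e0 + x) = \<kappa> x *\<^sub>C f0" using psi_T assms by simp
  then have "\<exists>c. \<psi> (e0 + x) = c *\<^sub>C \<psi> e0"
    using psi_e0 by (metis scaleC_scaleC scaleC_one nonzero_eq_divide_eq divide_self)
  then obtain d where d: "e0 + x = d *\<^sub>C e0" using psi_parD E_add_nz[OF assms(1)] e0_nz by blast
  then have "cinner e0 (e0 + x) = d" using e0_cinner by (simp add: cinner_scaleC_right)
  then have "d = 1" using assms e0_cinner by (simp add: cinner_add_right E_def)
  then show False using d assms by simp
qed

text \<open>\<open>e0 + x\<close> lies in the span of \<open>e0\<close> and \<open>x\<close>, and
  \<open>\<psi> x\<close> is orthogonal to \<open>f0\<close>; removing the \<open>f0\<close>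
  component leaves a multiple of \<open>\<psi> x\<close>.\<close>

lemma T_par:
  assumes "x \<in> E" "x \<noteq> 0" shows "\<exists>t. t \<noteq> 0 \<and> T x = t *\<^sub>C \<psi> x"
proof -
  obtain c d where cd: "\<psi> (e0 + x) = c *\<^sub>C \<psi> e0 + d *\<^sub>C \<psi> x"
    using psi_span[OF e0_nz assms(2) E_add_nz[OF assms(1)], of 1 1] by auto
  obtain k where k: "\<psi> e0 = k *\<^sub>C f0" using psi_e0 by blast
  have "\<kappa> x = c * k" unfolding \<kappa>_def cd k
    using f0_psi assms f0_cinner by (simp add: cinner_simps)
  then have "T x = (d / \<kappa> x) *\<^sub>C \<psi> x" using kappa_nz[OF assms(1)]
    by (auto simp: T_def cd k scaleC_add_right scaleC_scaleC)
  then show ?thesis using T_nz assms by (intro exI[of _ "d / \<kappa> x"]) auto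
qed

lemma T_scale_par:
  assumes "x \<in> E" "x \<noteq> 0" shows "\<exists>t. T (c *\<^sub>C x) = t *\<^sub>C T x"
proof (cases "c = 0")
  case True
  then show ?thesis by (intro exI[of _ 0]) (simp add: T_0)
next
  case False
  obtain s where s: "T (c *\<^sub>C x) = s *\<^sub>C \<psi> (c *\<^sub>C x)"
    using T_par[of "c *\<^sub>C x"] assms False E_simps by auto
  obtain t where t: "t \<noteq> 0" "T x = t *\<^sub>C \<psi> x" using T_par assms by blast
  obtain d where d: "\<psi> (c *\<^sub>C x) = d *\<^sub>C \<psi> x" using psi_scale assms False by blast
  show ?thesis using t s d
    by (intro exI[of _ "s * d / t"]) (simp add: scaleC_scaleC)
qed

lemma T_parD:
  assumes "x \<in> E" "x \<noteq> 0" "y \<in> E" "y \<noteq> 0" "T x = c *\<^sub>C T y"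
  shows "\<exists>d. x = d *\<^sub>C y"
proof -
  obtain s where s: "s \<noteq> 0" "T x = s *\<^sub>C \<psi> x" using T_par assms by blast
  obtain t where t: "T y = t *\<^sub>C \<psi> y" using T_par assms by blast
  have "s *\<^sub>C \<psi> x = (c * t) *\<^sub>C \<psi> y" using assms s t by (simp add: scaleC_scaleC)
  then have "(1 / s) *\<^sub>C s *\<^sub>C \<psi> x = (1 / s) *\<^sub>C (c * t) *\<^sub>C \<psi> y" by simp
  then have "\<psi> x = (c * t / s) *\<^sub>C \<psi> y" using s by (simp add: scaleC_scaleC)
  then show ?thesis using psi_parD assms by blast
qed

lemma T_add_step:
  assumes "x \<in> E" "x \<noteq> 0" "y \<in> E" "y \<noteq> 0"
  shows "\<exists>b. T (x + y) = T x + b *\<^sub>C T y"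
proof -
  have xy: "x + y \<in> E" using assms E_simps by blast
  have "e0 + (x + y) = 1 *\<^sub>C (e0 + x) + 1 *\<^sub>C y" by simp
  then obtain a b where ab: "\<psi> (e0 + (x + y)) = a *\<^sub>C \<psi> (e0 + x) + b *\<^sub>C \<psi> y"
    using psi_span[OF E_add_nz[OF assms(1)] assms(4) E_add_nz[OF xy]] by blast
  obtain t where t: "t \<noteq> 0" "T y = t *\<^sub>C \<psi> y" using T_par assms by blast
  have ka: "\<kappa> (x + y) = a * \<kappa> x" unfolding \<kappa>_def ab
    using f0_psi assms by (simp add: cinner_simps)
  then have an: "a \<noteq> 0" using kappa_nz[OF xy] by auto
  have "T (x + y) = (1 / \<kappa> (x + y)) *\<^sub>C (a *\<^sub>C \<psi> (e0 + x) + b *\<^sub>C \<psi> y) - f0"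
    unfolding T_def ab ..
  also have "\<dots> = T x + (b / \<kappa> (x + y)) *\<^sub>C \<psi> y"
    using an by (simp add: T_def ka scaleC_add_right scaleC_scaleC)
  also have "(b / \<kappa> (x + y)) *\<^sub>C \<psi> y = (b / \<kappa> (x + y) / t) *\<^sub>C T y"
    using t by (simp add: scaleC_scaleC)
  finally show ?thesis by blast
qed

text \<open>\<open>T_add_step\<close> in both orders gives \<open>T x + b *\<^sub>C T y\<close> and
  \<open>T y + d *\<^sub>C T x\<close>. Their equality with \<open>b \<noteq> 1\<close> would make
  \<open>T y\<close> proportional to \<open>T x\<close>, against \<open>T_parD\<close>.\<close>

lemma T_add_indep:
  assumes "x \<in> E" "x \<noteq> 0" "y \<in> E" "\<And>c. y \<noteq> c *\<^sub>C x"
  shows "T (x + y) = T x + T y"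
proof -
  have y: "y \<noteq> 0" using assms(4)[of 0] by simp
  obtain b where b: "T (x + y) = T x + b *\<^sub>C T y" using T_add_step assms y by blast
  obtain d where d: "T (x + y) = T y + d *\<^sub>C T x"
    using T_add_step[OF assms(3) y assms(1,2)] by (auto simp: add.commute)
  have eq: "(1 - b) *\<^sub>C T y = (1 - d) *\<^sub>C T x"
    using b d by (simp add: scaleC_diff_left algebra_simps)
  have "b = 1"
  proof (rule ccontr)
    assume "b \<noteq> 1"
    then have "T y = (1 / (1 - b)) *\<^sub>C ((1 - b) *\<^sub>C T y)" by (simp add: scaleC_scaleC)
    also have "\<dots> = ((1 - d) / (1 - b)) *\<^sub>C T x" unfolding eq by (simp add: scaleC_scaleC)
    finally show False using T_parD assms y by blast
  qed
  then show ?thesis using b by simp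
qed

lemma E_third: "x \<in> E \<Longrightarrow> \<exists>z. z \<in> E \<and> norm z = 1 \<and> cinner x z = 0"
proof -
  obtain z where z: "z \<noteq> 0" "cinner e0 z = 0" "cinner x z = 0" using dim_ge_3 by blast
  then have "z \<in> E" by (simp add: E_def)
  moreover have "cinner x ((1 / norm z) *\<^sub>R z) = 0"
    using z by (simp add: cinner_scaleC_right flip: scaleC_of_real)
  ultimately show ?thesis
    using z E_simps(3) by (intro exI[of _ "(1 / norm z) *\<^sub>R z"]) simp
qed

lemma T_add:
  assumes "x \<in> E" "y \<in> E"
  shows "T (x + y) = T x + T y"
proof (cases "x = 0 \<or> (\<forall>c. y \<noteq> c *\<^sub>C x)")
  case True
  then show ?thesis using T_add_indep assms T_0 by (cases "x = 0") auto
next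
  case False
  then obtain c where c: "y = c *\<^sub>C x" and x: "x \<noteq> 0" by blast
  \<comment> \<open>Proportional vectors are separated by a third direction: \<open>T\<close> at
    \<open>x + (z + y)\<close> is expanded in two ways, each time along independent vectors.\<close>
  obtain z where z: "z \<in> E" "norm z = 1" "cinner x z = 0" using E_third assms by blast
  have zn: "z \<noteq> 0" using z by auto
  have zx: "z + a *\<^sub>C x \<noteq> k *\<^sub>C x" for k a
  proof
    assume "z + a *\<^sub>C x = k *\<^sub>C x"
    then have "cinner z (z + a *\<^sub>C x) = k * cinner z x" by (simp add: cinner_scaleC_right)
    then show False using z zn cinner_eq_0_commute[of x z] by (simp add: cinner_simps)
  qed
  have zc: "k *\<^sub>C x \<in> E" for k using assms E_simps by blast
  have 1: "T (k *\<^sub>C x + z) = T (k *\<^sub>C x) + T z" for k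
  proof (cases "k = 0")
    case False
    show ?thesis
    proof (rule T_add_indep)
      show "z \<noteq> l *\<^sub>C k *\<^sub>C x" for l using zx[of 0 "l * k"] by (simp add: scaleC_scaleC)
    qed (use False x z zc in auto)
  qed (simp add: T_0)
  have "T (x + (z + c *\<^sub>C x)) = T x + T (z + c *\<^sub>C x)"
    by (rule T_add_indep) (use assms x z zc zx E_simps in auto)
  also have "\<dots> = T x + T y + T z" using 1[of c] by (simp add: c algebra_simps)
  finally have "T ((1 + c) *\<^sub>C x + z) = T x + T y + T z" by (simp add: scaleC_add_left algebra_simps)
  then show ?thesis using 1[of "1 + c"] by (simp add: c scaleC_add_left)
qed

lemma T_minus: "x \<in> E \<Longrightarrow> T (- x) = - T x"
  using T_add[of x "- x"] E_simps T_0 by (simp add: add_eq_0_iff2)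

lemma T_unit:
  assumes "x \<in> E" "norm x = 1" shows "norm (T x) = 1"
proof -
  have m: "- x \<in> E" using assms E_simps by blast
  have "cinner (e0 + x) (e0 + - x) = 0"
    using assms e0_cinner norm_eq_1_cinner[of x] E_orth[of x] by (simp add: cinner_simps E_def)
  then have "cinner (\<psi> (e0 + x)) (\<psi> (e0 + - x)) = 0"
    using psi_orth E_add_nz[OF assms(1)] E_add_nz[OF m] by blast
  then have "cinner (f0 + T x) (f0 + T (- x)) = 0"
    unfolding psi_T[OF assms(1)] psi_T[OF m] using kappa_nz[OF assms(1)] kappa_nz[OF m]
    by (simp add: cinner_scaleC_left cinner_scaleC_right)
  then have "cinner (T x) (T x) = 1"
    using f0_cinner f0_T[OF assms(1)] T_f0[OF assms(1)]
    by (simp add: T_minus assms cinner_simps)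
  then show ?thesis using norm_eq_1_cinner by blast
qed

text \<open>The number \<open>s\<close> makes x/2 + s z and x/2 - s z unit vectors, so
  \<open>x\<close> is a sum of two unit vectors, whose images have norm 1 by
  \<open>T_unit\<close>.\<close>

lemma T_bound:
  assumes x: "x \<in> E" "norm x \<le> 1" shows "norm (T x) \<le> 2"
proof -
  obtain z where z: "z \<in> E" "norm z = 1" "cinner x z = 0" using E_third assms by blast
  define s where "s = sqrt (1 - (norm x)\<^sup>2 / 4)"
  have "(norm x)\<^sup>2 \<le> 1" using x by (simp add: power_le_one)
  then have s: "s\<^sup>2 = 1 - (norm x)\<^sup>2 / 4" by (simp add: s_def)
  have u: "norm ((1/2) *\<^sub>R x + r *\<^sub>R z) = 1" if "r\<^sup>2 = s\<^sup>2" for r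
  proof -
    have "cinner ((1/2) *\<^sub>R x) (r *\<^sub>R z) = 0"
      using z by (simp add: cinner_scaleC_left cinner_scaleC_right flip: scaleC_of_real)
    then have "(norm ((1/2) *\<^sub>R x + r *\<^sub>R z))\<^sup>2 = 1"
      unfolding norm_add_orth[OF \<open>cinner ((1/2) *\<^sub>R x) (r *\<^sub>R z) = 0\<close>] using that s z
      by (simp add: power_mult_distrib power_divide)
    then show ?thesis by (simp add: power2_eq_1_iff) (use norm_ge_zero[of "(1/2) *\<^sub>R x + r *\<^sub>R z"] in linarith)
  qed
  have E: "(1/2) *\<^sub>R x + r *\<^sub>R z \<in> E" for r using x z E_simps by blast
  have "x = ((1/2) *\<^sub>R x + s *\<^sub>R z) + ((1/2) *\<^sub>R x + (- s) *\<^sub>R z)"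
    by (simp flip: scaleR_add_left)
  then have "T x = T ((1/2) *\<^sub>R x + s *\<^sub>R z) + T ((1/2) *\<^sub>R x + (- s) *\<^sub>R z)"
    using T_add E by metis
  moreover have "norm (T ((1/2) *\<^sub>R x + s *\<^sub>R z)) = 1" "norm (T ((1/2) *\<^sub>R x + (- s) *\<^sub>R z)) = 1"
    using T_unit[OF E u[of s]] T_unit[OF E u[of "- s"]] by simp_all
  ultimately show ?thesis using norm_triangle_ineq by (metis one_add_one)
qed

lemma T_of_nat: "x \<in> E \<Longrightarrow> T (real n *\<^sub>R x) = real n *\<^sub>R T x"
proof (induction n)
  case (Suc n)
  then show ?case using T_add[of "real n *\<^sub>R x" x] E_simps by (simp add: algebra_simps)
qed (simp add: T_0)

lemma T_of_int: "x \<in> E \<Longrightarrow> T (real_of_int k *\<^sub>R x) = real_of_int k *\<^sub>R T x"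
  using T_of_nat[of x "nat k"] T_of_nat[of x "nat (- k)"] T_minus[of "real (nat (- k)) *\<^sub>R x"] E_simps
  by (cases "k \<ge> 0") auto

text \<open>Multiplying the defect \<open>D\<close> by \<open>n\<close> replaces \<open>r\<close> by
  the fractional part of \<open>n * r\<close>, so the norm of the multiple stays at most 2 + 1 by
  \<open>T_bound\<close> and \<open>T_unit\<close>, for every \<open>n\<close>.\<close>

lemma T_real_unit:
  assumes x: "x \<in> E" "norm x = 1" shows "T (r *\<^sub>R x) = r *\<^sub>R T x"
proof -
  define D where "D = T (r *\<^sub>R x) - r *\<^sub>R T x"
  have "real n * norm D \<le> 3" for n
  proof -
    define k where "k = \<lfloor>real n * r\<rfloor>"
    define \<theta> where "\<theta> = real n * r - k"
    have \<theta>: "0 \<le> \<theta>" "\<theta> \<le> 1" unfolding \<theta>_def k_def by linarith+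
    have E: "s *\<^sub>R x \<in> E" for s using x E_simps by blast
    have "real n *\<^sub>R T (r *\<^sub>R x) = T (real n *\<^sub>R r *\<^sub>R x)" using T_of_nat[OF E] by simp
    also have "real n *\<^sub>R r *\<^sub>R x = \<theta> *\<^sub>R x + real_of_int k *\<^sub>R x" by (simp add: \<theta>_def flip: scaleR_add_left)
    also have "T \<dots> = T (\<theta> *\<^sub>R x) + real_of_int k *\<^sub>R T x" using T_add[OF E E] T_of_int x by simp
    finally have "real n *\<^sub>R D = T (\<theta> *\<^sub>R x) - \<theta> *\<^sub>R T x"
      by (simp add: D_def \<theta>_def algebra_simps)
    then have "real n * norm D = norm (T (\<theta> *\<^sub>R x) - \<theta> *\<^sub>R T x)"
      by (metis norm_scaleR abs_of_nat)
    also have "\<dots> \<le> norm (T (\<theta> *\<^sub>R x)) + norm (\<theta> *\<^sub>R T x)" by (rule norm_triangle_ineq4)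
    also have "\<dots> \<le> 2 + 1"
      using T_bound[OF E[of \<theta>]] \<theta> x T_unit[OF x] by (intro add_mono) auto
    finally show ?thesis by simp
  qed
  then have "norm D = 0"
    by (metis ex_less_of_nat_mult linorder_not_less norm_ge_zero order_le_less)
  then show ?thesis by (simp add: D_def)
qed

lemma T_real:
  assumes "x \<in> E" shows "T (r *\<^sub>R x) = r *\<^sub>R T x"
proof (cases "x = 0")
  case False
  define u where "u = (1 / norm x) *\<^sub>R x"
  have u: "u \<in> E" "norm u = 1" "x = norm x *\<^sub>R u" using assms False E_simps by (auto simp: u_def)
  show ?thesis using T_real_unit[OF u(1,2), of "r * norm x"] T_real_unit[OF u(1,2), of "norm x"] u(3)
    by (metis scaleR_scaleR)
qed (simp add: T_0)

lemma T_norm: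
  assumes "x \<in> E" shows "norm (T x) = norm x"
proof (cases "x = 0")
  case False
  define u where "u = (1 / norm x) *\<^sub>R x"
  have u: "u \<in> E" "norm u = 1" "x = norm x *\<^sub>R u" using assms False E_simps by (auto simp: u_def)
  then have "T x = norm x *\<^sub>R T u" using T_real by metis
  then show ?thesis using T_unit u by simp
qed (simp add: T_0)

text \<open>Norm preservation at \<open>\<i> *\<^sub>C x\<close> gives |u| = 1, and at
  \<open>x + \<i> *\<^sub>C x\<close> it gives |1 + u| = |1 + i|; together these leave only the two
  square roots of -1.\<close>

lemma T_i:
  assumes "x \<in> E" "x \<noteq> 0" shows "\<exists>u. (u = \<i> \<or> u = - \<i>) \<and> T (\<i> *\<^sub>C x) = u *\<^sub>C T x"
proof -
  obtain u where u: "T (\<i> *\<^sub>C x) = u *\<^sub>C T x" using T_scale_par assms by blast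
  have ix: "\<i> *\<^sub>C x \<in> E" using assms E_simps by blast
  have nT: "norm (T x) = norm x" "norm x \<noteq> 0" using T_norm assms by auto
  have "norm (u *\<^sub>C T x) = norm (\<i> *\<^sub>C x)" using u T_norm[OF ix] by simp
  then have nu: "cmod u = 1" using nT by (simp add: norm_scaleC)
  have "T (x + \<i> *\<^sub>C x) = (1 + u) *\<^sub>C T x" using T_add[OF assms(1) ix] u by (simp add: scaleC_add_left)
  moreover have "x + \<i> *\<^sub>C x = (1 + \<i>) *\<^sub>C x" by (simp add: scaleC_add_left)
  ultimately have "norm ((1 + u) *\<^sub>C T x) = norm ((1 + \<i>) *\<^sub>C x)"
    using T_norm[of "x + \<i> *\<^sub>C x"] E_simps(1)[OF assms(1) ix] by simp
  then have "cmod (1 + u) = cmod (1 + \<i>)" using nT by (simp add: norm_scaleC)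
  then have "(cmod (1 + u))\<^sup>2 = (cmod (1 + \<i>))\<^sup>2" by simp
  then have "(1 + Re u)\<^sup>2 + (Im u)\<^sup>2 = 2" by (simp add: cmod_power2)
  moreover have n2: "(Re u)\<^sup>2 + (Im u)\<^sup>2 = 1" using nu by (metis cmod_power2 one_power2)
  ultimately have "Re u = 0" by (simp add: power2_eq_square algebra_simps)
  then have "Im u = 1 \<or> Im u = -1" using n2 by (simp add: power2_eq_1_iff)
  then have "u = \<i> \<or> u = - \<i>" using \<open>Re u = 0\<close> by (auto simp: complex_eq_iff)
  then show ?thesis using u by blast
qed

text \<open>The factors belonging to \<open>x\<close>, \<open>y\<close> and \<open>x + y\<close>
  must agree, since additivity compares them along the independent vectors \<open>T x\<close> and
  \<open>T y\<close>.\<close>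

lemma T_i_indep:
  assumes "x \<in> E" "x \<noteq> 0" "y \<in> E" "\<And>c. y \<noteq> c *\<^sub>C x"
    and "T (\<i> *\<^sub>C x) = u *\<^sub>C T x"
  shows "T (\<i> *\<^sub>C y) = u *\<^sub>C T y"
proof -
  have y: "y \<noteq> 0" using assms(4)[of 0] by simp
  have xy: "x + y \<in> E" "x + y \<noteq> 0" using assms E_simps assms(4)[of "-1"]
    by (auto simp: scaleC_minus1 add_eq_0_iff)
  obtain v where v: "T (\<i> *\<^sub>C y) = v *\<^sub>C T y" using T_i assms y by blast
  obtain w where w: "T (\<i> *\<^sub>C (x + y)) = w *\<^sub>C T (x + y)" using T_i[OF xy] by blast
  have "u *\<^sub>C T x + v *\<^sub>C T y = w *\<^sub>C T x + w *\<^sub>C T y"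
    using w v assms T_add[OF assms(1,3)] T_add[of "\<i> *\<^sub>C x" "\<i> *\<^sub>C y"] E_simps
    by (simp add: scaleC_add_right)
  then have eq: "(v - w) *\<^sub>C T y = (w - u) *\<^sub>C T x" by (simp add: scaleC_diff_left algebra_simps)
  have vw: "v = w"
  proof (rule ccontr)
    assume "v \<noteq> w"
    then have "T y = (1 / (v - w)) *\<^sub>C ((v - w) *\<^sub>C T y)" by (simp add: scaleC_scaleC)
    also have "\<dots> = ((w - u) / (v - w)) *\<^sub>C T x" unfolding eq by (simp add: scaleC_scaleC)
    finally show False using T_parD assms y by blast
  qed
  then have "w = u" using eq T_nz assms by auto
  then show ?thesis using v vw by simp
qed

lemma T_semilinear:
  "\<exists>\<sigma>. (\<sigma> = id \<or> \<sigma> = cnj) \<and> (\<forall>c. \<forall>x\<in>E. T (c *\<^sub>C x) = \<sigma> c *\<^sub>C T x)"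
proof -
  obtain x0 where x0: "x0 \<in> E" "norm x0 = 1" using E_third[OF E_simps(4)] by blast
  then have x0n: "x0 \<noteq> 0" by auto
  obtain u where u: "u = \<i> \<or> u = - \<i>" "T (\<i> *\<^sub>C x0) = u *\<^sub>C T x0" using T_i x0 x0n by blast
  have all: "T (\<i> *\<^sub>C y) = u *\<^sub>C T y" if y: "y \<in> E" for y
  proof (cases "\<exists>c. y = c *\<^sub>C x0")
    case False
    then show ?thesis using T_i_indep x0 x0n u y by blast
  next
    case True
    then obtain c where c: "y = c *\<^sub>C x0" by blast
    \<comment> \<open>A multiple of \<open>x0\<close> is compared with \<open>x0\<close> through a
      vector \<open>z\<close> independent of both.\<close>
    obtain z where z: "z \<in> E" "norm z = 1" "cinner x0 z = 0" using E_third x0 by blast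
    have zn: "z \<noteq> 0" using z by auto
    have ind: "z \<noteq> k *\<^sub>C x0" for k
    proof
      assume "z = k *\<^sub>C x0"
      then have "cinner z z = k * cinner z x0" by (metis cinner_scaleC_right)
      then show False using z zn cinner_eq_0_commute[of x0 z] by simp
    qed
    have iz: "T (\<i> *\<^sub>C z) = u *\<^sub>C T z" using T_i_indep x0 x0n z ind u by blast
    show ?thesis
    proof (cases "c = 0")
      case True then show ?thesis by (simp add: c T_0)
    next
      case False
      have "y \<noteq> k *\<^sub>C z" for k
      proof
        assume k: "y = k *\<^sub>C z"
        then have "cinner x0 y = 0" using z by (simp add: cinner_scaleC_right)
        then show False using False x0n by (simp add: c cinner_scaleC_right)
      qed
      then show ?thesis using T_i_indep z zn y iz by blast
    qed
  qed
  define \<sigma> where "\<sigma> = (if u = \<i> then id else cnj)"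
  have \<sigma>: "\<sigma> c = of_real (Re c) + of_real (Im c) * u" for c
    using u(1) by (auto simp: \<sigma>_def complex_eq_iff)
  have "T (c *\<^sub>C x) = \<sigma> c *\<^sub>C T x" if x: "x \<in> E" for c x
  proof -
    have "c *\<^sub>C x = Re c *\<^sub>R x + Im c *\<^sub>R (\<i> *\<^sub>C x)"
      unfolding scaleC_of_real[symmetric] scaleC_scaleC scaleC_add_left[symmetric]
      by (rule arg_cong[of _ _ "\<lambda>c. c *\<^sub>C x"]) (simp add: complex_eq_iff)
    then have "T (c *\<^sub>C x) = Re c *\<^sub>R T x + Im c *\<^sub>R (u *\<^sub>C T x)"
      using x all E_simps by (simp add: T_add T_real)
    then show ?thesis
      unfolding \<sigma> scaleC_add_left scaleC_scaleC[symmetric] scaleC_of_real .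
  qed
  then show ?thesis by (intro exI[of _ \<sigma>]) (auto simp: \<sigma>_def)
qed

theorem induced_by_isometry:
  "\<exists>U. (unitary U \<or> antiunitary U) \<and> (\<forall>x. x \<noteq> 0 \<longrightarrow> (\<exists>c. c \<noteq> 0 \<and> U x = c *\<^sub>C \<psi> x))"
proof -
  obtain \<sigma> where \<sigma>: "\<sigma> = id \<or> \<sigma> = cnj" and T\<sigma>: "\<And>c x. x \<in> E \<Longrightarrow> T (c *\<^sub>C x) = \<sigma> c *\<^sub>C T x"
    using T_semilinear by blast
  have \<sigma>s: "\<sigma> (a + b) = \<sigma> a + \<sigma> b" "\<sigma> (a * b) = \<sigma> a * \<sigma> b" "\<sigma> (\<sigma> a) = a" "cmod (\<sigma> a) = cmod a"
    "\<sigma> 1 = 1" "\<sigma> 0 = 0" for a b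
    using \<sigma> by auto
  have \<sigma>n: "\<sigma> a \<noteq> 0 \<longleftrightarrow> a \<noteq> 0" for a using \<sigma> by auto
  define q where "q y = y - cinner e0 y *\<^sub>C e0" for y
  have q: "q y \<in> E" for y by (simp add: q_def E_def cinner_simps e0_cinner)
  have qy: "y = cinner e0 y *\<^sub>C e0 + q y" for y by (simp add: q_def)
  \<comment> \<open>\<open>T\<close> lives on the hyperplane orthogonal to \<open>e0\<close>; the
    remaining coordinate is carried to \<open>f0\<close> with the same
    \<open>\<sigma>\<close>.\<close>
  define U where "U y = \<sigma> (cinner e0 y) *\<^sub>C f0 + T (q y)" for y
  have add: "U (x + y) = U x + U y" for x y
  proof -
    have "q (x + y) = q x + q y" by (simp add: q_def cinner_add_right scaleC_add_left)
    then show ?thesis using T_add[OF q q] by (simp add: U_def cinner_add_right \<sigma>s scaleC_add_left)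
  qed
  have scale: "U (c *\<^sub>C x) = \<sigma> c *\<^sub>C U x" for c x
  proof -
    have "q (c *\<^sub>C x) = c *\<^sub>C q x" by (simp add: q_def cinner_scaleC_right scaleC_diff_right scaleC_scaleC)
    then show ?thesis using T\<sigma>[OF q] by (simp add: U_def cinner_scaleC_right \<sigma>s scaleC_add_right scaleC_scaleC)
  qed
  have norm: "norm (U x) = norm x" for x
  proof -
    have 1: "cinner (\<sigma> (cinner e0 x) *\<^sub>C f0) (T (q x)) = 0"
      using f0_T[OF q] by (simp add: cinner_scaleC_left)
    have 2: "cinner (cinner e0 x *\<^sub>C e0) (q x) = 0"
      using q[of x] by (simp add: cinner_scaleC_left E_def)
    have "(norm (U x))\<^sup>2 = (cmod (cinner e0 x))\<^sup>2 + (norm (q x))\<^sup>2"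
      unfolding U_def norm_add_orth[OF 1] using f0 T_norm[OF q] by (simp add: norm_scaleC \<sigma>s)
    also have "\<dots> = (norm x)\<^sup>2"
      using norm_add_orth[OF 2] e0 qy[of x] by (simp add: norm_scaleC)
    finally show ?thesis by (simp add: power2_eq_iff_nonneg)
  qed
  have neg: "U (- x) = - U x" for x using scale[of "-1" x] \<sigma> by (auto simp: scaleC_minus1)
  have Re: "Re (cinner (U x) (U y)) = Re (cinner x y)" for x y
  proof -
    have "U x - U y = U (x - y)" using add[of x "- y"] neg by simp
    then show ?thesis using Re_cinner_polar[of x y] Re_cinner_polar[of "U x" "U y"] norm add
      by (metis mult_cancel_left zero_neq_numeral)
  qed
  \<comment> \<open>Polarisation determines only real parts from norms; the imaginary part is the
    real part after multiplying \<open>x\<close> by \<open>\<i>\<close>.\<close>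
  have inner: "cinner (U x) (U y) = \<sigma> (cinner x y)" for x y
  proof -
    have "Re (cinner (\<sigma> \<i> *\<^sub>C U x) (U y)) = Re (cinner (\<i> *\<^sub>C x) y)"
      using Re[of "\<i> *\<^sub>C x" y] scale by simp
    then show ?thesis using \<sigma> Re[of x y] by (auto simp: cinner_scaleC_left complex_eq_iff)
  qed
  have par: "\<exists>c. c \<noteq> 0 \<and> U y = c *\<^sub>C \<psi> y" if y: "y \<noteq> 0" for y
  proof (cases "cinner e0 y = 0")
    case True
    then have "U y = T y" "y \<in> E" by (simp_all add: U_def q_def \<sigma>s E_def)
    then show ?thesis using T_par y by simp
  next
    case False
    define c where "c = cinner e0 y"
    define x where "x = (1 / c) *\<^sub>C q y"
    have x: "x \<in> E" unfolding x_def using q E_simps by blast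
    have yc: "y = c *\<^sub>C (e0 + x)" using qy[of y] False
      by (simp add: x_def c_def scaleC_add_right scaleC_scaleC)
    have "U (e0 + x) = f0 + T x"
      using x by (simp add: U_def q_def cinner_add_right e0_cinner E_def \<sigma>s)
    then have Uy: "U y = \<sigma> c *\<^sub>C (f0 + T x)" by (simp add: yc scale)
    have c0: "c \<noteq> 0" using False by (simp add: c_def)
    then have "1 / c \<noteq> 0" by simp
    then obtain d where "\<psi> ((1 / c) *\<^sub>C y) = d *\<^sub>C \<psi> y" using psi_scale y by blast
    moreover have "(1 / c) *\<^sub>C y = e0 + x" unfolding yc using c0 by (simp add: scaleC_scaleC)
    ultimately have d: "\<kappa> x *\<^sub>C (f0 + T x) = d *\<^sub>C \<psi> y" using psi_T[OF x] by simp
    have "U y = (\<sigma> c / \<kappa> x) *\<^sub>C (\<kappa> x *\<^sub>C (f0 + T x))"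
      using kappa_nz[OF x] by (simp add: Uy scaleC_scaleC)
    also have "\<dots> = (\<sigma> c / \<kappa> x * d) *\<^sub>C \<psi> y" unfolding d by (simp add: scaleC_scaleC)
    finally have *: "U y = (\<sigma> c / \<kappa> x * d) *\<^sub>C \<psi> y" .
    moreover have "U y \<noteq> 0" using norm[of y] y by auto
    ultimately show ?thesis by (intro exI[of _ "\<sigma> c / \<kappa> x * d"]) auto
  qed
  have "surj U"
  proof (rule surjI)
    fix z
    let ?P = "\<lambda>x. U x = z"
    have "\<exists>x. ?P x"
    proof (cases "z = 0")
      case True then show ?thesis using norm[of 0] by (intro exI[of _ 0]) simp
    next
      case False
      then obtain x c where x: "x \<noteq> 0" "\<psi> x = c *\<^sub>C z" using psi_surj by blast
      have c: "c \<noteq> 0" using psi_nz[OF x(1)] x by auto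
      obtain d where d: "d \<noteq> 0" "U x = d *\<^sub>C \<psi> x" using par x by blast
      have "U (\<sigma> (1 / (d * c)) *\<^sub>C x) = z"
        using c d x by (simp add: scale \<sigma>s scaleC_scaleC)
      then show ?thesis by blast
    qed
    then show "U (SOME x. ?P x) = z" by (rule someI_ex)
  qed
  then have "unitary U \<or> antiunitary U"
    unfolding unitary_def antiunitary_def using \<sigma> add scale inner by auto
  then show ?thesis using par by blast
qed

end

section \<open>Images of subspaces under linear and conjugate-linear maps\<close>

lemma dimn_semilinear_image:
  assumes add: "\<And>x y. U (x + y) = U x + U y" and scale: "\<And>c x. U (c *\<^sub>C x) = \<sigma> c *\<^sub>C U x"
    and \<sigma>: "\<sigma> = id \<or> \<sigma> = cnj" and inj: "inj U"
    and V: "dimn k V"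
  shows "dimn k (U ` V)"
  using V
proof (induction k arbitrary: V)
  case 0
  have "U 0 = 0" using add[of 0 0] by simp
  then show ?case using 0 by (simp add: dimn_0_iff)
next
  case (Suc k)
  then obtain K y where K: "dimn k K" "y \<noteq> 0" "V = cspan (insert y K)" "\<forall>x\<in>K. cinner x y = 0"
    using dimn_Suc_split[OF Suc.prems] by metis
  have diff: "U (x - y) = U x - U y" for x y using add[of "x - y" y] by simp
  have s: "csubspace K" "csubspace (U ` K)" using dimn_csubspace Suc.IH K by blast+
  have "cspan (insert (U y) (U ` K)) = U ` V"
  proof (intro set_eqI iffI)
    fix z assume "z \<in> cspan (insert (U y) (U ` K))"
    then obtain c x where "z - c *\<^sub>C U y = U x" "x \<in> K"
      using cspan_insert_iff[OF s(2)] by blast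
    moreover have "\<sigma> (\<sigma> c) = c" using \<sigma> by auto
    ultimately have "z = U (\<sigma> c *\<^sub>C y + x)" by (simp add: add scale algebra_simps)
    moreover have "\<sigma> c *\<^sub>C y + x \<in> V" unfolding K(3) using \<open>x \<in> K\<close>
      by (intro complex_vector.span_add complex_vector.span_scale complex_vector.span_base) auto
    ultimately show "z \<in> U ` V" by blast
  next
    fix z assume "z \<in> U ` V"
    then obtain v c where v: "z = U v" "v - c *\<^sub>C y \<in> K"
      using cspan_insert_iff[OF s(1)] unfolding K(3) by blast
    then have "z - \<sigma> c *\<^sub>C U y \<in> U ` K" by (auto simp: diff scale intro!: image_eqI[of _ _ "v - c *\<^sub>C y"])
    then show "z \<in> cspan (insert (U y) (U ` K))" using cspan_insert_iff[OF s(2)] by blast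
  qed
  moreover have "y \<notin> K" using K by auto
  then have "U y \<notin> U ` K" using inj by (auto dest: injD)
  ultimately show ?case using dimn_insert[OF Suc.IH[OF K(1)]] by metis
qed

lemma csubspace_semilinear_image:
  assumes add: "\<And>x y. U (x + y) = U x + U y" and scale: "\<And>c x. U (c *\<^sub>C x) = \<sigma> c *\<^sub>C U x"
    and \<sigma>: "\<sigma> = id \<or> \<sigma> = cnj" and V: "csubspace V"
  shows "csubspace (U ` V)"
proof (rule csubspaceI)
  show "0 \<in> U ` V" using add[of 0 0] complex_vector.subspace_0[OF V] by force
  show "x + y \<in> U ` V" if "x \<in> U ` V" "y \<in> U ` V" for x y
    using that complex_vector.subspace_add[OF V] by (auto simp flip: add)
  show "c *\<^sub>C x \<in> U ` V" if x: "x \<in> U ` V" for c x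
  proof -
    obtain v where v: "x = U v" "v \<in> V" using x by blast
    have "\<sigma> (\<sigma> c) = c" using \<sigma> by auto
    then have "c *\<^sub>C x = U (\<sigma> c *\<^sub>C v)" by (simp add: scale v)
    then show ?thesis using v complex_vector.subspace_scale[OF V] by blast
  qed
qed

text \<open>If \<open>V\<close> is infinite-dimensional, an image of dimension \<open>k\<close>
  would contain the image of a (k+1)-dimensional subspace of \<open>V\<close>.\<close>

lemma cdim_semilinear_image:
  assumes add: "\<And>x y. U (x + y) = U x + U y" and scale: "\<And>c x. U (c *\<^sub>C x) = \<sigma> c *\<^sub>C U x"
    and \<sigma>: "\<sigma> = id \<or> \<sigma> = cnj" and inj: "inj U" and V: "csubspace V"
  shows "cdim (U ` V) = cdim V"
proof (cases "\<exists>k. dimn k V")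
  case True
  then obtain k where k: "dimn k V" by blast
  then have "dimn k (U ` V)" using dimn_semilinear_image[of U, OF add scale \<sigma> inj] by blast
  then show ?thesis using k dimn_iff_cdim[of V k] dimn_iff_cdim[of "U ` V" k] dimn_csubspace by metis
next
  case False
  have UV: "csubspace (U ` V)" using csubspace_semilinear_image[of U, OF add scale \<sigma> V] .
  have "\<not> dimn k (U ` V)" for k
  proof
    assume k: "dimn k (U ` V)"
    have "\<exists>W. {0} \<subseteq> W \<and> W \<subseteq> V \<and> dimn (Suc k) W"
      using False complex_vector.subspace_0[OF V] by (intro dimn_between[of 0] V) (auto simp: dimn_0_iff)
    then obtain W where W: "W \<subseteq> V" "dimn (Suc k) W" by blast
    then have "Suc k \<le> k"
      using dimn_mono[OF k dimn_semilinear_image[of U, OF add scale \<sigma> inj W(2)]] by blast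
    then show False by simp
  qed
  then show ?thesis using False cdim_infinite_iff[OF V] cdim_infinite_iff[OF UV] by metis
qed

lemma cproj_eqI:
  assumes V: "csubspace V" and y: "y \<in> V" "\<And>v. v \<in> V \<Longrightarrow> cinner v (x - y) = 0"
  shows "cproj V x = y"
  unfolding cproj_def
proof (rule the_equality)
  show "y \<in> V \<and> x - y \<in> corth_comp V" using y by (simp add: corth_comp_def)
  fix z assume z: "z \<in> V \<and> x - z \<in> corth_comp V"
  have "y - z \<in> V" using y z V complex_vector.subspace_diff by blast
  then have "cinner (y - z) (x - z) = 0" "cinner (y - z) (x - y) = 0"
    using z y by (auto simp: corth_comp_def)
  then have "cinner (y - z) ((x - z) - (x - y)) = 0" by (simp only: cinner_diff_right diff_self)
  then show "z = y" by simp
qed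

subsection \<open>Reflections\<close>

text \<open>For \<open>w = 0\<close> the division by zero makes this the identity, so isometry,
  involution and conjugation rules hold for every \<open>w\<close>.\<close>

definition refl_at :: "'a::chilbert_space \<Rightarrow> 'a \<Rightarrow> 'a" where
  "refl_at w x = x - (2 * cinner w x / cinner w w) *\<^sub>C w"

lemma refl_at_add: "refl_at w (x + y) = refl_at w x + refl_at w y"
  by (simp add: refl_at_def cinner_add_right add_divide_distrib distrib_left scaleC_add_left)

lemma refl_at_scale: "refl_at w (c *\<^sub>C x) = c *\<^sub>C refl_at w x"
  by (simp add: refl_at_def cinner_scaleC_right scaleC_diff_right scaleC_scaleC mult.left_commute)

lemma refl_at_minus: "refl_at w (- x) = - refl_at w x"
  using refl_at_scale[of w "-1" x] by (simp add: scaleC_minus1)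

lemma refl_at_diff: "refl_at w (x - y) = refl_at w x - refl_at w y"
  using refl_at_add[of w "x" "- y"] refl_at_minus by simp

lemma refl_at_0 [simp]: "refl_at w 0 = 0"
  using refl_at_scale[of w 0 0] by simp

lemma refl_at_orth: "cinner w x = 0 \<Longrightarrow> refl_at w x = x"
  by (simp add: refl_at_def)

lemma refl_at_self: "refl_at w w = - w"
proof (cases "w = 0")
  case False
  have "2 *\<^sub>C w = w + w" using scaleC_add_left[of 1 1 w] by simp
  then show ?thesis using False by (simp add: refl_at_def)
qed simp

lemma refl_at_invol [simp]: "refl_at w (refl_at w x) = x"
  by (subst (2) refl_at_def)
    (simp add: refl_at_diff refl_at_scale refl_at_self, simp add: refl_at_def)

lemma cinner_refl_at: "cinner (refl_at w x) (refl_at w y) = cinner x y"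
proof (cases "w = 0")
  case False
  define N a b where "N = cinner w w" and "a = cinner w x" and "b = cinner w y"
  have N: "cnj N = N" "N \<noteq> 0" using False by (simp_all add: N_def)
  have "cinner x w = cnj a" using cinner_commute a_def by blast
  then have "cinner (refl_at w x) (refl_at w y) =
      cinner x y - 2 * b / N * cnj a - cnj (2 * a / N) * b + cnj (2 * a / N) * (2 * b / N) * N"
    by (simp only: refl_at_def cinner_diff_left cinner_diff_right cinner_scaleC_left
        cinner_scaleC_right flip: N_def a_def b_def) (simp add: algebra_simps)
  also have "\<dots> = cinner x y" using N by simp
  finally show ?thesis .
qed (simp add: refl_at_def)

lemma cinner_refl_at_right: "cinner x (refl_at w y) = cinner (refl_at w x) y"
  using cinner_refl_at[of w "refl_at w x" y] by simp

lemma inj_refl_at: "inj (refl_at w)"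
  by (metis injI refl_at_invol)

text \<open>The source of the squares of edges below: conjugating a reflection by an isometry moves
  its vector.\<close>

lemma refl_at_conj: "refl_at w (refl_at v x) = refl_at (refl_at w v) (refl_at w x)"
  unfolding refl_at_def[of v] refl_at_def[of "refl_at w v"] cinner_refl_at
  by (simp add: refl_at_diff refl_at_scale)

lemma refl_at_uminus: "refl_at (- w) = refl_at w"
  by (rule ext) (simp add: refl_at_def)

lemma refl_at_image_invol [simp]: "refl_at w ` refl_at w ` V = V"
  by (simp add: image_image)

lemma refl_at_image_iff: "x \<in> refl_at w ` V \<longleftrightarrow> refl_at w x \<in> V"
  by (metis image_iff refl_at_invol)

lemma refl_at_image_orth: "(\<And>v. v \<in> V \<Longrightarrow> cinner w v = 0) \<Longrightarrow> refl_at w ` V = V"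
  by (simp add: refl_at_orth)

lemma cdim_refl_at: "csubspace V \<Longrightarrow> cdim (refl_at w ` V) = cdim V"
  by (rule cdim_semilinear_image[where \<sigma> = id]) (auto simp: refl_at_add refl_at_scale inj_refl_at)

lemma csubspace_refl_at: "csubspace V \<Longrightarrow> csubspace (refl_at w ` V)"
  by (rule csubspace_semilinear_image[where \<sigma> = id]) (auto simp: refl_at_add refl_at_scale)

lemma corth_comp_refl_at: "corth_comp (refl_at w ` V) = refl_at w ` corth_comp V"
  by (auto simp: corth_comp_def refl_at_image_iff cinner_refl_at_right)

text \<open>The normal is the normalised residual of \<open>v\<close> over \<open>Z\<close>. It
  replaces the hyperplane by a single unit vector, from which a reflection can be built.\<close>

lemma hyperplane_normal:
  assumes h: "hyperplane_in Z V" and V: "dimn k V"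
  shows "\<exists>p\<in>V. norm p = 1 \<and> (\<forall>z. z \<in> V \<and> cinner p z = 0 \<longleftrightarrow> z \<in> Z)"
proof -
  obtain v where v: "closed_csubspace Z" "v \<notin> Z" "V = cspan (insert v Z)"
    using h by (auto simp: hyperplane_in_def)
  have Zs: "csubspace Z" using v by (auto simp: closed_csubspace_def)
  have ZV: "Z \<subseteq> V" and vV: "v \<in> V"
    using v(3) complex_vector.span_superset[of "insert v Z"] by auto
  obtain l where "dimn l Z" using dimn_sub[OF V Zs ZV] by blast
  then obtain u where u: "u \<in> Z" "\<forall>y\<in>Z. cinner y (v - u) = 0" using dimn_orth_proj by blast
  define q where "q = v - u"
  have qn: "q \<noteq> 0" using u v by (auto simp: q_def)
  define p where "p = of_real (1 / norm q) *\<^sub>C q"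
  have "q \<in> V" using u(1) ZV vV complex_vector.subspace_diff[OF dimn_csubspace[OF V]] by (auto simp: q_def)
  then have p: "p \<in> V" "norm p = 1"
    using qn complex_vector.subspace_scale[OF dimn_csubspace[OF V]]
    by (auto simp: p_def norm_scaleC norm_divide)
  have pz: "cinner p z = 0 \<longleftrightarrow> cinner q z = 0" for z using qn by (simp add: p_def cinner_scaleC_left)
  have qZ: "cinner q z = 0" if "z \<in> Z" for z using u that cinner_eq_0_commute by (auto simp: q_def)
  have "z \<in> Z" if z: "z \<in> V" "cinner q z = 0" for z
  proof -
    obtain c where "z - c *\<^sub>C v \<in> Z" using z(1) cspan_insert_iff[OF Zs] unfolding v(3) by blast
    moreover have "c *\<^sub>C u \<in> Z" using u(1) complex_vector.subspace_scale[OF Zs] by blast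
    ultimately have *: "z - c *\<^sub>C q \<in> Z"
      using complex_vector.subspace_add[OF Zs, of "z - c *\<^sub>C v" "c *\<^sub>C u"]
      by (simp add: q_def scaleC_diff_right algebra_simps)
    then have "cinner q (z - c *\<^sub>C q) = 0" using qZ by blast
    then have "c = 0" using z(2) qn by (simp add: cinner_diff_right cinner_scaleC_right)
    then show ?thesis using * by simp
  qed
  then show ?thesis using p pz qZ ZV by (intro bexI[of _ p]) auto
qed

subsection \<open>Frames\<close>

text \<open>On an edge this two-element set is the type (\<open>step_diffs\<close>).\<close>

definition diffs :: "('i \<Rightarrow> 'b) \<Rightarrow> ('i \<Rightarrow> 'b) \<Rightarrow> 'i set" where
  "diffs X Y = {t. X t \<noteq> Y t}"

lemma diffs_commute: "diffs X Y = diffs Y X"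
  by (auto simp: diffs_def)

definition act :: "'a \<Rightarrow> ('i \<Rightarrow> 'a::chilbert_space set) \<Rightarrow> 'i \<Rightarrow> 'a set" where
  "act w X = (\<lambda>t. refl_at w ` X t)"

lemma act_act [simp]: "act w (act w X) = X"
  by (simp add: act_def)

lemma act_conj: "act w (act v X) = act (refl_at w v) (act w X)"
  by (simp add: act_def image_image refl_at_conj[of w v])

locale frames =
  fixes I :: "'i set" and n :: "'i \<Rightarrow> enat"
  assumes finite_I: "finite I" and n_pos: "i \<in> I \<Longrightarrow> n i > 0"
    and one_inf: "i \<in> I \<Longrightarrow> j \<in> I \<Longrightarrow> n i = \<infinity> \<Longrightarrow> n j = \<infinity> \<Longrightarrow> i = j"
begin

text \<open>Off \<open>I\<close> the value is fixed to \<open>{0}\<close>, so that equality of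
  frames as functions is equality of decompositions.\<close>

definition D :: "('i \<Rightarrow> 'a::chilbert_space set) set" where
  "D = {X. orth_decomp I X \<and> (\<forall>i\<in>I. cdim (X i) = n i) \<and> (\<forall>i. i \<notin> I \<longrightarrow> X i = {0})}"

lemma D_sub: "X \<in> D \<Longrightarrow> csubspace (X i)"
  by (cases "i \<in> I") (auto simp: D_def orth_decomp_def closed_csubspace_def complex_vector.subspace_single_0)

lemmas D_scale = complex_vector.subspace_scale[OF D_sub]
  and D_add = complex_vector.subspace_add[OF D_sub]
  and D_diff = complex_vector.subspace_diff[OF D_sub]
  and D_neg = complex_vector.subspace_neg[OF D_sub]
  and D_0 = complex_vector.subspace_0[OF D_sub]

lemma D_closed: "X \<in> D \<Longrightarrow> closed (X i)"
  by (cases "i \<in> I") (auto simp: D_def orth_decomp_def closed_csubspace_def)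

lemma D_orth: "X \<in> D \<Longrightarrow> i \<noteq> j \<Longrightarrow> x \<in> X i \<Longrightarrow> y \<in> X j \<Longrightarrow> cinner x y = 0"
  by (cases "i \<in> I"; cases "j \<in> I") (auto simp: D_def orth_decomp_def corthogonal_def)

lemma D_cdim: "X \<in> D \<Longrightarrow> i \<in> I \<Longrightarrow> cdim (X i) = n i"
  by (simp add: D_def)

lemma D_dimn: "X \<in> D \<Longrightarrow> i \<in> I \<Longrightarrow> n i = enat k \<Longrightarrow> dimn k (X i)"
  using D_cdim D_sub dimn_iff_cdim by metis

lemma D_off: "X \<in> D \<Longrightarrow> i \<notin> I \<Longrightarrow> X i = {0}"
  by (simp add: D_def)

lemma D_ex: "X \<in> D \<Longrightarrow> i \<in> I \<Longrightarrow> \<exists>x\<in>X i. x \<noteq> 0"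
proof (rule ccontr)
  assume X: "X \<in> D" and i: "i \<in> I" and "\<not> (\<exists>x\<in>X i. x \<noteq> 0)"
  then have "X i = {0}" using D_sub[OF X] complex_vector.subspace_0 by blast
  then have "cdim (X i) = 0"
    using dimn_iff_cdim[OF D_sub[OF X], of 0 i] dimn_0_iff[of "X i"] zero_enat_def by metis
  then show False using D_cdim[OF X i] n_pos[OF i] by simp
qed

lemma D_ex_unit: "X \<in> D \<Longrightarrow> i \<in> I \<Longrightarrow> \<exists>x\<in>X i. norm x = 1"
proof -
  assume X: "X \<in> D" and i: "i \<in> I"
  obtain x where x: "x \<in> X i" "x \<noteq> 0" using D_ex[OF X i] by blast
  have "(1 / norm x) *\<^sub>R x \<in> X i"
    using x D_scale[OF X] by (metis scaleC_of_real)
  then show ?thesis using x by (intro bexI[of _ "(1 / norm x) *\<^sub>R x"]) simp_all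
qed

lemma D_comps:
  assumes "X \<in> D"
  obtains y where "\<And>i. y i \<in> X i" "x = (\<Sum>i\<in>I. y i)"
proof -
  have "\<exists>y. (\<forall>i\<in>I. y i \<in> X i) \<and> x = (\<Sum>i\<in>I. y i)"
    using assms by (simp add: D_def orth_decomp_def)
  then obtain y where y: "\<forall>i\<in>I. y i \<in> X i" "x = (\<Sum>i\<in>I. y i)" by blast
  have "(if i \<in> I then y i else 0) \<in> X i" for i
    using y D_sub[OF assms] complex_vector.subspace_0 by auto
  moreover have "x = (\<Sum>i\<in>I. if i \<in> I then y i else 0)" using y by simp
  ultimately show thesis by (rule that)
qed

lemma cproj_sum:
  assumes X: "X \<in> D" and y: "\<And>i. i \<in> I \<Longrightarrow> y i \<in> X i" and x: "x = (\<Sum>i\<in>I. y i)" and k: "k \<in> I"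
  shows "cproj (X k) x = y k"
proof (rule cproj_eqI[OF D_sub[OF X]])
  show "y k \<in> X k" using y k by blast
  fix v assume v: "v \<in> X k"
  have "x - y k = (\<Sum>i\<in>I - {k}. y i)"
    using x k finite_I by (simp add: sum_diff1)
  then show "cinner v (x - y k) = 0"
    by (auto simp: cinner_sum_right intro!: sum.neutral D_orth[OF X _ v y])
qed

lemma cproj_mem: "X \<in> D \<Longrightarrow> k \<in> I \<Longrightarrow> cproj (X k) x \<in> X k"
  by (metis D_comps cproj_sum)

lemma sum_cproj: "X \<in> D \<Longrightarrow> x = (\<Sum>i\<in>I. cproj (X i) x)"
  by (metis (mono_tags, lifting) D_comps cproj_sum sum.cong)

lemma cproj_orth:
  assumes "X \<in> D" "k \<in> I" "\<And>z. z \<in> X k \<Longrightarrow> cinner z x = 0" shows "cproj (X k) x = 0"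
  using assms D_sub complex_vector.subspace_0 by (intro cproj_eqI) auto

lemma cproj_cinner:
  assumes "X \<in> D" "k \<in> I" "z \<in> X k" shows "cinner z x = cinner z (cproj (X k) x)"
proof -
  have "cinner z x = (\<Sum>i\<in>I. cinner z (cproj (X i) x))"
    using sum_cproj[OF assms(1), of x] cinner_sum_right by metis
  also have "\<dots> = cinner z (cproj (X k) x)"
    using assms(2) finite_I
    by (subst sum.remove[of _ k])
      (auto intro!: sum.neutral D_orth[OF assms(1) _ assms(3) cproj_mem[OF assms(1)]])
  finally show ?thesis .
qed

text \<open>Lets a slot of any dimension be handled through the other slots; it gives closedness of
  reflected slots in \<open>act_D\<close> and uniqueness in \<open>D_eqI\<close>.\<close>

lemma D_mem:
  assumes X: "X \<in> D" and k: "k \<in> I"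
  shows "x \<in> X k \<longleftrightarrow> (\<forall>j\<in>I - {k}. \<forall>y\<in>X j. cinner y x = 0)"
proof
  assume "x \<in> X k"
  then show "\<forall>j\<in>I - {k}. \<forall>y\<in>X j. cinner y x = 0" using D_orth[OF X] by blast
next
  assume *: "\<forall>j\<in>I - {k}. \<forall>y\<in>X j. cinner y x = 0"
  have "x = (\<Sum>i\<in>I. cproj (X i) x)" by (rule sum_cproj[OF X])
  also have "\<dots> = cproj (X k) x"
    using * cproj_orth[OF X] k finite_I by (subst sum.remove[of _ k]) (auto intro!: sum.neutral)
  finally show "x \<in> X k" using cproj_mem[OF X k] by metis
qed

lemma D_two:
  assumes X: "X \<in> D" and ij: "i \<in> I" "j \<in> I" "i \<noteq> j"
    and y: "\<And>t z. t \<in> I - {i, j} \<Longrightarrow> z \<in> X t \<Longrightarrow> cinner z x = 0"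
  shows "\<exists>a\<in>X i. \<exists>b\<in>X j. x = a + b"
proof -
  have "x = (\<Sum>i\<in>I. cproj (X i) x)" by (rule sum_cproj[OF X])
  also have "\<dots> = cproj (X i) x + (cproj (X j) x + (\<Sum>t\<in>I - {i} - {j}. cproj (X t) x))"
    using ij finite_I by (subst sum.remove[of _ i], simp, simp, subst sum.remove[of _ j]) auto
  also have "(\<Sum>t\<in>I - {i} - {j}. cproj (X t) x) = 0"
    using y cproj_orth[OF X] by (auto intro!: sum.neutral)
  finally show ?thesis using cproj_mem[OF X] ij by (metis add.right_neutral)
qed

lemma D_eqI:
  assumes X: "X \<in> D" and Y: "Y \<in> D" and eq: "\<And>j. j \<in> I \<Longrightarrow> j \<noteq> k \<Longrightarrow> X j = Y j"
  shows "X = Y"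
proof
  fix t
  show "X t = Y t"
  proof (cases "t \<in> I")
    case True
    show ?thesis
    proof (cases "t = k")
      case True
      then show ?thesis using D_mem[OF X \<open>t \<in> I\<close>] D_mem[OF Y \<open>t \<in> I\<close>] eq by (intro set_eqI) auto
    qed (use eq \<open>t \<in> I\<close> in blast)
  qed (use D_off X Y in metis)
qed

lemma act_D:
  assumes X: "X \<in> D" shows "act w X \<in> D"
proof -
  have sub: "csubspace (act w X i)" for i using csubspace_refl_at[OF D_sub[OF X]] by (simp add: act_def)
  have orth: "cinner x y = 0" if "i \<noteq> j" "x \<in> act w X i" "y \<in> act w X j" for i j x y
    using that D_orth[OF X] by (auto simp: act_def cinner_refl_at)
  have sum: "\<exists>y. (\<forall>i\<in>I. y i \<in> act w X i) \<and> x = (\<Sum>i\<in>I. y i)" for x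
  proof -
    obtain y where y: "\<And>i. y i \<in> X i" "refl_at w x = (\<Sum>i\<in>I. y i)" using D_comps[OF X] by blast
    have "refl_at w (sum y J) = (\<Sum>i\<in>J. refl_at w (y i))" for J
      by (induction J rule: infinite_finite_induct) (simp_all add: refl_at_add)
    then have "x = (\<Sum>i\<in>I. refl_at w (y i))" using y(2) by (metis refl_at_invol)
    then show ?thesis using y(1) by (intro exI[of _ "\<lambda>i. refl_at w (y i)"]) (auto simp: act_def)
  qed
  have closed: "closed (act w X k)" if k: "k \<in> I" for k
  proof -
    have "act w X k = corth_comp (\<Union>j\<in>I - {k}. act w X j)"
      using D_mem[OF X k] by (auto simp: act_def corth_comp_def refl_at_image_iff cinner_refl_at_right)
    then show ?thesis using closed_corth_comp by metis
  qed
  show ?thesis unfolding D_def orth_decomp_def closed_csubspace_def corthogonal_def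
    using sub orth sum closed D_cdim[OF X] cdim_refl_at[OF D_sub[OF X]] D_off[OF X]
    by (auto simp: act_def)
qed

definition step :: "'i \<Rightarrow> 'i \<Rightarrow> ('i \<Rightarrow> 'a::chilbert_space set) \<Rightarrow> ('i \<Rightarrow> 'a set) \<Rightarrow> bool" where
  "step i j X Y \<longleftrightarrow> X \<in> D \<and> i \<in> I \<and> j \<in> I \<and> i \<noteq> j \<and>
    (\<exists>x\<in>X i. \<exists>y\<in>X j. x \<noteq> 0 \<and> y \<noteq> 0 \<and> Y = act (x + y) X)"

lemma stepI: "X \<in> D \<Longrightarrow> i \<in> I \<Longrightarrow> j \<in> I \<Longrightarrow> i \<noteq> j \<Longrightarrow> x \<in> X i \<Longrightarrow> y \<in> X j \<Longrightarrow> x \<noteq> 0 \<Longrightarrow> y \<noteq> 0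
    \<Longrightarrow> step i j X (act (x + y) X)"
  unfolding step_def by blast

lemma step_D: "step i j X Y \<Longrightarrow> Y \<in> D"
  by (auto simp: step_def act_D)

lemma step_swap: "step i j X Y \<Longrightarrow> step j i X Y"
  by (auto simp: step_def) (metis add.commute)

lemma step_sym:
  assumes "step i j X Y" shows "step i j Y X"
proof -
  obtain x y where *: "X \<in> D" "i \<in> I" "j \<in> I" "i \<noteq> j" "x \<in> X i" "y \<in> X j" "x \<noteq> 0" "y \<noteq> 0"
      "Y = act (x + y) X"
    using assms by (auto simp: step_def)
  define w where "w = x + y"
  have nz: "refl_at w x \<noteq> 0" "refl_at w y \<noteq> 0" using * by (metis refl_at_0 refl_at_invol)+
  \<comment> \<open>The reflection negates \<open>w\<close>, so in the new frame \<open>w\<close>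
    splits into the negatives of the reflected components, and the same reflection leads
    back.\<close>
  have sum: "- refl_at w x + - refl_at w y = w"
    using refl_at_add[of w x y] refl_at_self[of w] unfolding w_def[symmetric]
    by (metis add.inverse_inverse minus_add_distrib)
  have "- refl_at w x \<in> Y i" "- refl_at w y \<in> Y j"
    using * complex_vector.subspace_neg[OF D_sub[OF step_D[OF assms]]]
    by (auto simp: act_def w_def)
  then have "step i j Y (act (- refl_at w x + - refl_at w y) Y)"
    using * nz step_D[OF assms] by (intro stepI) auto
  then show ?thesis unfolding sum using * by (simp add: w_def)
qed

lemma act_other:
  assumes X: "X \<in> D" and "x \<in> X i" "y \<in> X j" "t \<noteq> i" "t \<noteq> j"
  shows "act (x + y) X t = X t"
  unfolding act_def using D_orth[OF X not_sym[OF assms(4)] assms(2)] D_orth[OF X not_sym[OF assms(5)] assms(3)]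
  by (intro refl_at_image_orth) (simp add: cinner_add_left)

text \<open>The reflection subtracts a nonzero multiple of \<open>x + y\<close> from
  \<open>v\<close>, which leaves a nonzero component along \<open>y\<close> in
  \<open>X j\<close>.\<close>

lemma refl_at_notin:
  assumes X: "X \<in> D" and ij: "i \<noteq> j" and xy: "x \<in> X i" "y \<in> X j" "y \<noteq> 0" and v: "v \<in> X i" "cinner x v \<noteq> 0"
  shows "refl_at (x + y) v \<notin> X i"
proof
  assume *: "refl_at (x + y) v \<in> X i"
  have yv: "cinner y v = 0" by (rule D_orth[OF X not_sym[OF ij] xy(2) v(1)])
  have yx: "cinner y x = 0" by (rule D_orth[OF X not_sym[OF ij] xy(2) xy(1)])
  have "x + y \<noteq> 0" using xy v yv cinner_add_left[of x y v] by auto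
  have "cinner y (refl_at (x + y) v) = 0" using D_orth[OF X _ xy(2) *] ij by blast
  then have "cinner x v / cinner (x + y) (x + y) * cinner y y = 0"
    using yv yx by (simp add: refl_at_def cinner_diff_right cinner_scaleC_right
        cinner_add_left[of x y v] cinner_add_right[of y])
  then show False using v \<open>x + y \<noteq> 0\<close> xy by simp
qed

lemma step_diffs:
  assumes "step i j X Y" shows "diffs X Y = {i, j}"
proof -
  obtain x y where *: "X \<in> D" "i \<in> I" "j \<in> I" "i \<noteq> j" "x \<in> X i" "y \<in> X j" "x \<noteq> 0" "y \<noteq> 0"
      "Y = act (x + y) X"
    using assms by (auto simp: step_def)
  have "X i \<noteq> Y i"
    using refl_at_notin[OF *(1,4-6,8), of x] * by (auto simp: act_def)
  moreover have "X j \<noteq> Y j"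
    using refl_at_notin[OF *(1) not_sym[OF *(4)] *(6,5,7), of y] * by (auto simp: act_def add.commute)
  ultimately show ?thesis using act_other[OF *(1,5,6)] *(9) by (auto simp: diffs_def)
qed

text \<open>Reflecting in the difference of two unit vectors exchanges them when their inner product
  is real. Applied to normals of the same hyperplane in \<open>X i\<close> and \<open>Y i\<close>,
  adjusted in phase, this carries \<open>X i\<close> to \<open>Y i\<close>; slot \<open>j\<close>
  follows by \<open>D_eqI\<close>.\<close>

lemma step_share:
  assumes X: "X \<in> D" and Y: "Y \<in> D" and ij: "i \<in> I" "j \<in> I" "i \<noteq> j"
    and eq: "\<And>t. t \<noteq> i \<Longrightarrow> t \<noteq> j \<Longrightarrow> X t = Y t" and ne: "X \<noteq> Y"
    and p: "p \<in> X i" "norm p = 1" and p': "p' \<in> Y i" "norm p' = 1"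
    and Z: "\<And>z. z \<in> X i \<and> cinner p z = 0 \<longleftrightarrow> z \<in> Y i \<and> cinner p' z = 0"
  shows "step i j X Y"
proof -
  \<comment> \<open>The phase \<open>c\<close> makes the inner product of \<open>p\<close> with
    \<open>c *\<^sub>C p'\<close> real and nonnegative.\<close>
  obtain c where c: "cmod c = 1" "c * cinner p p' = of_real (cmod (cinner p p'))"
  proof (cases "cinner p p' = 0")
    case True then show ?thesis using that[of 1] by simp
  next
    case False
    have "cnj (sgn (cinner p p')) * cinner p p' = of_real (cmod (cinner p p'))"
    proof -
      have "cnj (sgn (cinner p p')) * cinner p p' = (cinner p p' * cnj (cinner p p')) / of_real (cmod (cinner p p'))"
        by (simp add: sgn_eq mult.commute)
      also have "\<dots> = of_real (cmod (cinner p p'))"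
        unfolding complex_norm_square[symmetric] using False by (simp add: power2_eq_square)
      finally show ?thesis .
    qed
    then show ?thesis using that[of "cnj (sgn (cinner p p'))"] False by (simp add: norm_sgn)
  qed
  define q where "q = c *\<^sub>C p'"
  define \<alpha> where "\<alpha> = cmod (cinner p p')"
  have q: "q \<in> Y i" "norm q = 1" "cinner p q = of_real \<alpha>"
    using p' c D_scale[OF Y]
    by (auto simp: q_def norm_scaleC cinner_scaleC_right \<alpha>_def)
  have cn: "c \<noteq> 0" using c by auto
  have Zq: "z \<in> X i \<and> cinner p z = 0 \<longleftrightarrow> z \<in> Y i \<and> cinner q z = 0" for z
    using Z[of z] cn by (simp add: q_def cinner_scaleC_left)
  have qp: "cinner q p = of_real \<alpha>" using q(3) cinner_commute[of q p] by simp
  have pp: "cinner p p = 1" "cinner q q = 1" using p q norm_eq_1_cinner by blast+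
  have "\<exists>a\<in>X i. \<exists>b\<in>X j. q = a + b"
    using D_orth[OF Y _ _ q(1)] eq by (intro D_two X ij) auto
  then obtain a b where ab: "a \<in> X i" "b \<in> X j" "q = a + b" by blast
  have pb: "cinner p b = 0" "cinner b p = 0" using D_orth[OF X _ p(1) ab(2)] D_orth[OF X _ ab(2) p(1)] ij by auto
  have pa: "cinner p a = of_real \<alpha>" using q(3) pb ab(3) by (simp add: cinner_add_right)
  \<comment> \<open>The \<open>X i\<close> component of \<open>q\<close> is orthogonal to the common
    hyperplane, as \<open>q\<close> and \<open>b\<close> are. So \<open>p - q\<close> is a multiple
    of \<open>p\<close> in \<open>X i\<close> plus the vector \<open>- b\<close> in
    \<open>X j\<close>.\<close>
  have a: "a = of_real \<alpha> *\<^sub>C p"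
  proof -
    define z where "z = a - of_real \<alpha> *\<^sub>C p"
    have z: "z \<in> X i" "cinner p z = 0"
      using ab p pa pp D_diff[OF X] D_scale[OF X]
      by (auto simp: z_def cinner_diff_right cinner_scaleC_right)
    then have "cinner q z = 0" using Zq by blast
    moreover have "cinner b z = 0" using D_orth[OF X _ ab(2) z(1)] ij by auto
    ultimately have "cinner a z = 0" using ab(3) by (simp add: cinner_add_left)
    then have "cinner z z = 0" using z(2) by (subst (1) z_def) (simp add: cinner_diff_left cinner_scaleC_left)
    then show ?thesis by (simp add: z_def)
  qed
  have Xi: "\<exists>k z. x = k *\<^sub>C p + z \<and> z \<in> X i \<and> cinner p z = 0" if "x \<in> X i" for x
    using that p pp D_diff[OF X] D_scale[OF X]
    by (intro exI[of _ "cinner p x"] exI[of _ "x - cinner p x *\<^sub>C p"])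
      (auto simp: cinner_diff_right cinner_scaleC_right)
  have Yi: "\<exists>k z. x = k *\<^sub>C q + z \<and> z \<in> Y i \<and> cinner q z = 0" if "x \<in> Y i" for x
    using that q pp D_diff[OF Y] D_scale[OF Y]
    by (intro exI[of _ "cinner q x"] exI[of _ "x - cinner q x *\<^sub>C q"])
      (auto simp: cinner_diff_right cinner_scaleC_right)
  have n1: "\<alpha>\<^sup>2 + (norm b)\<^sup>2 = 1"
    using norm_add_orth[of a b] pb(1) q(2) p(2) unfolding ab(3) a
    by (simp add: cinner_scaleC_left norm_scaleC)
  have b: "b \<noteq> 0"
  proof
    assume b0: "b = 0"
    then have "\<alpha> = 1" using n1 \<alpha>_def by (simp add: power2_eq_1_iff) (use norm_ge_zero in \<open>metis abs_norm_cancel abs_neg_one one_neq_neg_one abs_1\<close>)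
    then have qq: "q = p" using ab(3) a b0 by simp
    have "X i = Y i"
      using Xi Yi Zq[unfolded qq] p(1) q(1) unfolding qq
      by (metis D_sub X Y complex_vector.subspace_add complex_vector.subspace_scale subsetI subset_antisym)
    then have "X = Y" using eq by (intro D_eqI[OF X Y, of j]) metis
    then show False using ne by simp
  qed
  have "\<alpha>\<^sup>2 < 1" using n1 b by (smt (verit) zero_less_power2 norm_eq_zero)
  then have \<alpha>1: "\<alpha> \<noteq> 1" by auto
  define w where "w = (of_real (1 - \<alpha>)) *\<^sub>C p + - b"
  have wpq: "w = p - q" by (simp add: w_def ab(3) a scaleC_diff_left)
  have ww: "cinner w w = of_real (2 * (1 - \<alpha>))" "cinner w p = of_real (1 - \<alpha>)"
    unfolding wpq by (simp_all add: cinner_simps pp q(3) qp)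
  have "2 * cinner w p / cinner w w = 1" unfolding ww using \<alpha>1 by simp
  then have wp: "refl_at w p = q" unfolding refl_at_def by (simp add: wpq)
  have wz: "refl_at w z = z" if "z \<in> X i" "cinner p z = 0" for z
    using that Zq[of z] by (intro refl_at_orth) (simp add: wpq cinner_diff_left)
  have "act w X = Y"
  proof (rule D_eqI[OF act_D[OF X] Y, where k = j])
    fix t assume "t \<in> I" "t \<noteq> j"
    show "act w X t = Y t"
    proof (cases "t = i")
      case False
      then show ?thesis unfolding w_def
        using act_other[OF X, where x = "of_real (1 - \<alpha>) *\<^sub>C p" and i = i and y = "- b" and j = j and t = t] \<open>t \<noteq> j\<close> eq p ab
          D_neg[OF X] D_scale[OF X] by auto
    next
      case True
      have "refl_at w x \<in> Y i" if x: "x \<in> X i" for x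
      proof -
        obtain k z where kz: "x = k *\<^sub>C p + z" "z \<in> X i" "cinner p z = 0" using Xi x by blast
        then have "refl_at w x = k *\<^sub>C q + z" by (simp add: refl_at_add refl_at_scale wp wz)
        then show ?thesis using kz Zq[of z] q(1)
          D_add[OF Y] D_scale[OF Y] by auto
      qed
      moreover have "\<exists>x\<in>X i. y = refl_at w x" if y: "y \<in> Y i" for y
      proof -
        obtain k z where kz: "y = k *\<^sub>C q + z" "z \<in> Y i" "cinner q z = 0" using Yi y by blast
        then have z: "z \<in> X i" "cinner p z = 0" using Zq by auto
        then have "y = refl_at w (k *\<^sub>C p + z)" by (simp add: refl_at_add refl_at_scale wp wz kz)
        then show ?thesis using z p
          D_add[OF X] D_scale[OF X] by blast
      qed
      ultimately show ?thesis unfolding True act_def by blast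
    qed
  qed
  moreover have "step i j X (act w X)" unfolding w_def
    using p ab b \<alpha>1 X ij D_neg[OF X] D_scale[OF X]
    by (intro stepI) auto
  ultimately show ?thesis by simp
qed

lemma hyperplane_step:
  assumes X: "X \<in> D" and Y: "Y \<in> D" and ij: "i \<in> I" "j \<in> I" "i \<noteq> j"
    and eq: "\<And>t. t \<noteq> i \<Longrightarrow> t \<noteq> j \<Longrightarrow> X t = Y t" and fin: "n i \<noteq> \<infinity>"
    and h: "hyperplane_in (X i \<inter> Y i) (X i)" "hyperplane_in (X i \<inter> Y i) (Y i)"
  shows "step i j X Y"
proof -
  obtain k where k: "n i = enat k" using fin by auto
  obtain p where p: "p \<in> X i" "norm p = 1" "\<forall>z. z \<in> X i \<and> cinner p z = 0 \<longleftrightarrow> z \<in> X i \<inter> Y i"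
    using hyperplane_normal[OF h(1) D_dimn[OF X ij(1) k]] by blast
  obtain p' where p': "p' \<in> Y i" "norm p' = 1" "\<forall>z. z \<in> Y i \<and> cinner p' z = 0 \<longleftrightarrow> z \<in> X i \<inter> Y i"
    using hyperplane_normal[OF h(2) D_dimn[OF Y ij(1) k]] by blast
  have "X \<noteq> Y"
  proof
    assume XY: "X = Y"
    obtain v where v: "v \<notin> X i" "X i = cspan (insert v (X i))"
      using h(1) unfolding XY hyperplane_in_def by auto
    have "v \<in> cspan (insert v (X i))" by (rule complex_vector.span_base) simp
    then show False using v by simp
  qed
  then show ?thesis
    using eq p(3) p'(3) by (intro step_share[OF X Y ij _ _ p(1,2) p'(1,2)]) auto
qed

text \<open>All other slots are finite-dimensional, and together they span a space containing the
  complement.\<close>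

lemma cofinite_corth_comp:
  assumes X: "X \<in> D" and i: "i \<in> I" "n i = \<infinity>"
  shows "ccodim (X i) \<noteq> \<infinity>"
proof -
  have "\<exists>B. finite B \<and> X t = cspan B" if t: "t \<in> I - {i}" for t
  proof -
    obtain k where "n t = enat k" using one_inf[of i t] i t by (cases "n t") auto
    then show ?thesis using D_dimn[OF X, of t k] t by (auto simp: dimn_def)
  qed
  then obtain B where B: "\<And>t. t \<in> I - {i} \<Longrightarrow> finite (B t) \<and> X t = cspan (B t)" by metis
  have "corth_comp (X i) \<subseteq> cspan (\<Union>t\<in>I - {i}. B t)"
  proof
    fix x assume "x \<in> corth_comp (X i)"
    then have "cproj (X i) x = 0" using cproj_orth[OF X i(1)] by (auto simp: corth_comp_def)
    then have "x = (\<Sum>t\<in>I - {i}. cproj (X t) x)"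
      using sum_cproj[OF X, of x] i finite_I by (simp add: sum.remove[of _ i])
    moreover have "cproj (X t) x \<in> cspan (\<Union>t\<in>I - {i}. B t)" if t: "t \<in> I - {i}" for t
      using cproj_mem[OF X, of t x] B[OF t] t complex_vector.span_mono[of "B t" "\<Union>t\<in>I - {i}. B t"] by auto
    then have "(\<Sum>t\<in>I - {i}. cproj (X t) x) \<in> cspan (\<Union>t\<in>I - {i}. B t)"
      by (rule complex_vector.span_sum)
    ultimately show "x \<in> cspan (\<Union>t\<in>I - {i}. B t)" by simp
  qed
  moreover have "finite (\<Union>t\<in>I - {i}. B t)" using B finite_I by auto
  ultimately show ?thesis by (auto simp: ccodim_def cdim_def)
qed

lemma step_adjacent:
  assumes "step i j X Y" shows "adjacent_subspaces (X i) (Y i)"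
proof -
  obtain x y where *: "X \<in> D" "i \<in> I" "j \<in> I" "i \<noteq> j" "x \<in> X i" "y \<in> X j" "x \<noteq> 0" "y \<noteq> 0"
      "Y = act (x + y) X"
    using assms by (auto simp: step_def)
  note X = *(1)
  have Y: "Y \<in> D" using step_D[OF assms] .
  define w where "w = x + y"
  have Yi: "Y i = refl_at w ` X i" by (simp add: * act_def w_def)
  have wx: "cinner w v = cinner x v" if "v \<in> X i" for v
    using D_orth[OF X _ *(6) that] *(4) by (simp add: w_def cinner_add_left)
  have Z1: "v \<in> X i \<and> cinner x v = 0 \<Longrightarrow> v \<in> X i \<inter> Y i" for v
    unfolding Yi using wx[of v] refl_at_orth[of w v] by (auto simp: refl_at_image_iff)
  have Z2: "cinner x v = 0" if v: "v \<in> X i" "refl_at w v \<in> X i" for v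
    using refl_at_notin[OF X *(4-6,8) v(1)] v(2) by (auto simp: w_def)
  \<comment> \<open>The reflection fixes the vectors of \<open>X i\<close> orthogonal to
    \<open>x\<close> and moves all others out of \<open>X i\<close>.\<close>
  have Z: "v \<in> X i \<inter> Y i \<longleftrightarrow> v \<in> X i \<and> cinner x v = 0" for v
    using Z1 Z2[of v] Yi by (auto simp: refl_at_image_iff)
  have subZ: "csubspace (X i \<inter> Y i)" using D_sub X Y complex_vector.subspace_inter by blast
  have cZ: "closed_csubspace (X i \<inter> Y i)"
    using subZ D_closed X Y by (auto simp: closed_csubspace_def)
  define r where "r v = v - (cinner x v / cinner x x) *\<^sub>C x" for v
  have r: "r v \<in> X i \<inter> Y i" if "v \<in> X i" for v
    using that * D_diff[OF X] D_scale[OF X]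
    by (subst Z) (auto simp: r_def cinner_diff_right cinner_scaleC_right)
  have 1: "hyperplane_in (X i \<inter> Y i) (X i)"
    unfolding hyperplane_in_def
  proof (intro conjI cZ exI[of _ x] set_eqI iffI)
    show "x \<notin> X i \<inter> Y i" using Z[of x] *(7) by simp
    show "v \<in> cspan (insert x (X i \<inter> Y i))" if "v \<in> X i" for v
      using r[OF that] cspan_insert_iff[OF subZ] unfolding r_def by blast
    show "v \<in> X i" if "v \<in> cspan (insert x (X i \<inter> Y i))" for v
      using that complex_vector.span_minimal[OF _ D_sub[OF X], of "insert x (X i \<inter> Y i)" i] * by blast
  qed
  have wv: "refl_at w v = v" if "v \<in> X i \<inter> Y i" for v
    using that Z wx by (intro refl_at_orth) auto
  have rx: "refl_at w x \<in> Y i" using Yi * by blast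
  have 2: "hyperplane_in (X i \<inter> Y i) (Y i)"
    unfolding hyperplane_in_def
  proof (intro conjI cZ exI[of _ "refl_at w x"] set_eqI iffI)
    show "refl_at w x \<notin> X i \<inter> Y i" using refl_at_notin[OF X *(4-6,8) *(5)] * by (auto simp: w_def)
    show "v \<in> cspan (insert (refl_at w x) (X i \<inter> Y i))" if v: "v \<in> Y i" for v
    proof -
      obtain u where u: "u \<in> X i" "v = refl_at w u" using v Yi by blast
      have "refl_at w (r u) = v - (cinner x u / cinner x x) *\<^sub>C refl_at w x"
        by (simp add: r_def refl_at_diff refl_at_scale u)
      then have "v - (cinner x u / cinner x x) *\<^sub>C refl_at w x \<in> X i \<inter> Y i"
        using r[OF u(1)] wv by metis
      then show ?thesis using cspan_insert_iff[OF subZ] by blast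
    qed
    show "v \<in> Y i" if "v \<in> cspan (insert (refl_at w x) (X i \<inter> Y i))" for v
      using that complex_vector.span_minimal[OF _ D_sub[OF Y], of "insert (refl_at w x) (X i \<inter> Y i)" i] rx by blast
  qed
  have "cdim (X i) = cdim (Y i) \<and> cdim (X i) \<noteq> \<infinity> \<or> ccodim (X i) = ccodim (Y i) \<and> ccodim (X i) \<noteq> \<infinity>"
  proof (cases "n i = \<infinity>")
    case True
    have "ccodim (Y i) = ccodim (X i)"
      unfolding ccodim_def Yi corth_comp_refl_at by (rule cdim_refl_at[OF csubspace_corth_comp])
    then show ?thesis using cofinite_corth_comp[OF X *(2) True] by simp
  qed (use D_cdim[OF X *(2)] D_cdim[OF Y *(2)] in simp)
  then show ?thesis using 1 2 D_sub D_closed X Y by (auto simp: adjacent_subspaces_def closed_csubspace_def)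
qed

text \<open>Links the adjacency of the theorem to reflections. Normals are available in a
  finite-dimensional slot, and at least one of \<open>i\<close>, \<open>j\<close> is finite; it
  suffices to work from that one.\<close>

lemma adjacent_subspaces_step_iff:
  assumes X: "X \<in> D" and Y: "Y \<in> D" and ij: "i \<in> I" "j \<in> I" "i \<noteq> j"
  shows "step i j X Y \<longleftrightarrow> adjacent_subspaces (X i) (Y i) \<and> adjacent_subspaces (X j) (Y j)
    \<and> (\<forall>t\<in>I - {i, j}. X t = Y t)"
proof
  assume s: "step i j X Y"
  then show "adjacent_subspaces (X i) (Y i) \<and> adjacent_subspaces (X j) (Y j) \<and> (\<forall>t\<in>I - {i, j}. X t = Y t)"
    using step_adjacent step_swap[OF s] step_diffs[OF s] by (auto simp: diffs_def)
next
  assume a: "adjacent_subspaces (X i) (Y i) \<and> adjacent_subspaces (X j) (Y j) \<and> (\<forall>t\<in>I - {i, j}. X t = Y t)"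
  have eq: "X t = Y t" if "t \<noteq> i" "t \<noteq> j" for t
    using a that D_off[OF X] D_off[OF Y] by (cases "t \<in> I") auto
  have "n i \<noteq> \<infinity> \<or> n j \<noteq> \<infinity>" using one_inf ij by blast
  then show "step i j X Y"
  proof
    assume "n i \<noteq> \<infinity>"
    then show ?thesis using hyperplane_step[OF X Y ij eq] a by (auto simp: adjacent_subspaces_def)
  next
    assume "n j \<noteq> \<infinity>"
    then have "step j i X Y" using hyperplane_step[OF X Y ij(2,1) not_sym[OF ij(3)] eq] a
      by (auto simp: adjacent_subspaces_def)
    then show ?thesis by (rule step_swap)
  qed
qed

text \<open>Inverse to \<open>spectral_op I a\<close> on frames when the eigenvalues are
  distinct.\<close>

definition spaces :: "('i \<Rightarrow> real) \<Rightarrow> ('a::chilbert_space \<Rightarrow> 'a) \<Rightarrow> 'i \<Rightarrow> 'a set" where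
  "spaces a A = (\<lambda>i. if i \<in> I then eigenspace A (a i) else {0})"

lemma spaces_spectral_op:
  assumes X: "X \<in> D" and a: "inj_on a I"
  shows "spaces a (spectral_op I a X) = X"
proof
  fix k
  show "spaces a (spectral_op I a X) k = X k"
  proof (cases "k \<in> I")
    case True
    have "spectral_op I a X x = of_real (a k) *\<^sub>C x \<longleftrightarrow> x \<in> X k" for x
    proof -
      have "spectral_op I a X x = of_real (a k) *\<^sub>C x \<longleftrightarrow> (\<Sum>i\<in>I. of_real (a i - a k) *\<^sub>C cproj (X i) x) = 0"
        by (subst sum_cproj[OF X, of x, THEN arg_cong, of "\<lambda>z. spectral_op I a X x = of_real (a k) *\<^sub>C z"])
          (simp add: spectral_op_def complex_vector.scale_sum_right scaleC_diff_left sum_subtractf)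
      also have "\<dots> \<longleftrightarrow> (\<forall>i\<in>I. of_real (a i - a k) *\<^sub>C cproj (X i) x = 0)"
      proof
        assume 0: "(\<Sum>i\<in>I. of_real (a i - a k) *\<^sub>C cproj (X i) x) = 0"
        show "\<forall>i\<in>I. of_real (a i - a k) *\<^sub>C cproj (X i) x = 0"
        proof
          fix i assume i: "i \<in> I"
          have "cproj (X i) 0 = of_real (a i - a k) *\<^sub>C cproj (X i) x"
            using 0 cproj_mem[OF X] D_scale[OF X]
            by (intro cproj_sum[OF X _ _ i]) auto
          moreover have "cproj (X i) 0 = 0" using cproj_orth[OF X i] by simp
          ultimately show "of_real (a i - a k) *\<^sub>C cproj (X i) x = 0" by simp
        qed
      qed (erule sum.neutral)
      also have "\<dots> \<longleftrightarrow> (\<forall>i\<in>I - {k}. cproj (X i) x = 0)"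
        using a True by (auto simp: inj_on_def)
      also have "\<dots> \<longleftrightarrow> x \<in> X k"
        unfolding D_mem[OF X True] using cproj_orth[OF X] cproj_cinner[OF X] by (metis DiffD1 cinner_zero_right)
      finally show ?thesis .
    qed
    then show ?thesis using True by (auto simp: spaces_def eigenspace_def)
  qed (simp add: spaces_def D_off[OF X])
qed

lemma op_class_eq: "op_class I a n = spectral_op I a ` D"
proof (intro set_eqI iffI)
  fix A :: "'a \<Rightarrow> 'a" assume "A \<in> op_class I a n"
  then obtain X where X: "A = spectral_op I a X" "orth_decomp I X" "\<forall>i\<in>I. cdim (X i) = n i"
    by (auto simp: op_class_def)
  define X' where "X' i = (if i \<in> I then X i else {0})" for i
  have "A = spectral_op I a X'" unfolding X spectral_op_def by (intro ext sum.cong) (simp_all add: X'_def)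
  moreover have "orth_decomp I X'" using X(2) unfolding orth_decomp_def X'_def by simp
  ultimately show "A \<in> spectral_op I a ` D" using X by (auto simp: D_def X'_def)
qed (auto simp: op_class_def D_def)

lemma spaces_D: "inj_on a I \<Longrightarrow> A \<in> op_class I a n \<Longrightarrow> spaces a A \<in> D"
  by (auto simp: op_class_eq spaces_spectral_op)

lemma spectral_op_spaces: "inj_on a I \<Longrightarrow> A \<in> op_class I a n \<Longrightarrow> spectral_op I a (spaces a A) = A"
  by (auto simp: op_class_eq spaces_spectral_op)

definition adj :: "('i \<Rightarrow> 'a::chilbert_space set) \<Rightarrow> ('i \<Rightarrow> 'a set) \<Rightarrow> bool" where
  "adj X Y \<longleftrightarrow> (\<exists>i j. step i j X Y)"

lemma adj_sym: "adj X Y \<Longrightarrow> adj Y X"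
  by (auto simp: adj_def dest: step_sym)

lemma adj_D: "adj X Y \<Longrightarrow> X \<in> D \<and> Y \<in> D"
  by (auto simp: adj_def step_def act_D)

lemma adjacent_ops_iff:
  assumes a: "inj_on a I" and A: "A \<in> op_class I a n" and B: "B \<in> op_class I a n"
  shows "adjacent_ops I a A B \<longleftrightarrow> adj (spaces a A) (spaces a B)"
proof -
  have "adjacent_ops I a A B \<longleftrightarrow> (\<exists>i\<in>I. \<exists>j\<in>I. i \<noteq> j \<and> step i j (spaces a A) (spaces a B))"
    unfolding adjacent_ops_def ij_adjacent_def
    using adjacent_subspaces_step_iff[OF spaces_D[OF a A] spaces_D[OF a B]]
    by (intro bex_cong refl conj_cong) (auto simp: spaces_def)
  then show ?thesis by (auto simp: adj_def step_def)
qed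

end

text \<open>The second hypothesis says that the inner product is real; for equal norms this is what
  makes <a - b, a - b> equal to 2 <a - b, a>.\<close>

lemma refl_at_exchange:
  assumes "norm a = norm b" and ab: "cinner a b = cinner b a" and ne: "a \<noteq> b"
  shows "refl_at (a - b) a = b"
proof -
  have aa: "cinner a a = cinner b b" using assms(1) by (simp add: cinner_self)
  have "cinner (a - b) (a - b) = 2 * cinner (a - b) a"
    using ab by (simp add: cinner_diff_left cinner_diff_right aa)
  moreover have "cinner (a - b) (a - b) \<noteq> 0" using ne by simp
  ultimately show ?thesis by (simp add: refl_at_def)
qed

lemma refl_at_exchange_orth:
  assumes "norm a = norm b" and "cinner a b = 0" and "a \<noteq> 0"
  shows "refl_at (a - b) a = b"
proof -
  have "cinner b a = 0" using assms cinner_eq_0_commute by blast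
  moreover have "a \<noteq> b" using assms by auto
  ultimately show ?thesis using assms by (intro refl_at_exchange) auto
qed

lemma refl_at_sum_exchange:
  assumes "norm a = norm b" and "cinner a b = 0" and "a \<noteq> 0"
  shows "refl_at (a + b) a = - b"
  using refl_at_exchange_orth[of a "- b"] assms by simp

lemma two_set_swap: "{i, j} = {a, b} \<Longrightarrow> (i = a \<and> j = b) \<or> (i = b \<and> j = a)"
  by (auto simp: doubleton_eq_iff)

lemma two_set_other:
  assumes "card S = 2" "a \<in> S" obtains b where "b \<noteq> a" "S = {a, b}"
proof -
  obtain x y where xy: "S = {x, y}" "x \<noteq> y" using assms(1) by (auto simp: card_2_iff)
  show thesis
  proof (cases "a = x")
    case True then show ?thesis using that[of y] xy by auto
  next
    case False
    then have "a = y" using assms(2) xy by auto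
    then show ?thesis using that[of x] xy by auto
  qed
qed

lemma two_set_two: "card S = 2 \<Longrightarrow> a \<in> S \<Longrightarrow> b \<in> S \<Longrightarrow> a \<noteq> b \<Longrightarrow> S = {a, b}"
  by (auto simp: card_2_iff)

lemma two_set_subset: "card S = 2 \<Longrightarrow> card T = 2 \<Longrightarrow> S \<subseteq> T \<Longrightarrow> S = T"
  by (metis card.infinite card_subset_eq zero_neq_numeral)

section \<open>Types of edges in triangles and squares\<close>

context frames
begin

lemma adj_step:
  assumes "adj X Y" and d: "diffs X Y = {i, j}"
  shows "step i j X Y"
proof -
  obtain a b where s: "step a b X Y" using assms(1) by (auto simp: adj_def)
  then have "{i, j} = {a, b}" using d step_diffs by metis
  then show ?thesis using s step_swap[OF s] two_set_swap[of i j a b] by auto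
qed

lemma adj_diffs: "adj X Y \<Longrightarrow> \<exists>i j. i \<in> I \<and> j \<in> I \<and> i \<noteq> j \<and> diffs X Y = {i, j}"
  by (auto simp: adj_def) (metis step_def step_diffs)

lemma adj_card: "adj X Y \<Longrightarrow> card (diffs X Y) = 2"
  using adj_diffs[of X Y] by auto

lemma adj_subset_I: "adj X Y \<Longrightarrow> diffs X Y \<subseteq> I"
  using adj_diffs[of X Y] by auto

lemma step_adj: "step i j X Y \<Longrightarrow> adj X Y"
  by (auto simp: adj_def)

lemma step_not_orth:
  assumes "step i j X Y" shows "\<exists>u\<in>X i. \<exists>v\<in>Y j. cinner u v \<noteq> 0"
proof -
  obtain x y where *: "X \<in> D" "i \<in> I" "j \<in> I" "i \<noteq> j" "x \<in> X i" "y \<in> X j" "x \<noteq> 0" "y \<noteq> 0"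
      "Y = act (x + y) X"
    using assms by (auto simp: step_def)
  have xy: "cinner x y = 0" by (rule D_orth[OF *(1,4,5,6)])
  have "x + y \<noteq> 0" using xy * by (metis add_eq_0_iff cinner_minus_right cinner_self_eq_0 neg_equal_0_iff_equal)
  moreover have "cinner x (refl_at (x + y) y) = - (2 * cinner y y / cinner (x + y) (x + y) * cinner x x)"
    using xy by (simp add: refl_at_def cinner_diff_right cinner_scaleC_right cinner_add_left[of x y y] cinner_add_right[of x])
  ultimately have "cinner x (refl_at (x + y) y) \<noteq> 0" using * by simp
  then show ?thesis using * by (auto simp: act_def)
qed

text \<open>The contradiction behind all type arguments: along an edge the old slot \<open>i\<close>
  and the new slot \<open>j\<close> are never orthogonal, so no frame can mix them.\<close>

lemma adj_not_both:
  assumes a: "adj X Y" and d: "diffs X Y = {i, j}" and W: "W \<in> D" and ne: "i \<noteq> j"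
    and "W i = X i" "W j = Y j"
  shows False
proof -
  obtain u v where "u \<in> X i" "v \<in> Y j" "cinner u v \<noteq> 0" using step_not_orth[OF adj_step[OF a d]] by blast
  then show False using D_orth[OF W ne, of u v] assms by simp
qed

lemma diffs_iff: "t \<in> diffs X Y \<longleftrightarrow> X t \<noteq> Y t"
  by (simp add: diffs_def)

text \<open>If the types differ, let \<open>j\<close> be changed only on XY and \<open>k\<close>
  only on XZ. Then YZ has type jk, so \<open>Z\<close> takes slot \<open>j\<close> from
  \<open>X\<close> and the other changed slot of XY from \<open>Y\<close>.\<close>

lemma triangle_type:
  assumes XY: "adj X Y" and XZ: "adj X Z" and YZ: "adj Y Z"
  shows "diffs X Y = diffs X Z"
proof (rule ccontr)
  assume ne: "diffs X Y \<noteq> diffs X Z"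
  note c = adj_card[OF XY] adj_card[OF XZ] adj_card[OF YZ]
  obtain j where j: "j \<in> diffs X Y" "j \<notin> diffs X Z" using two_set_subset[OF c(1,2)] ne by blast
  obtain k where k: "k \<in> diffs X Z" "k \<notin> diffs X Y" using two_set_subset[OF c(2,1)] ne by blast
  obtain i where i: "i \<noteq> j" "diffs X Y = {j, i}" using two_set_other[OF c(1) j(1)] by blast
  have "j \<in> diffs Y Z" "k \<in> diffs Y Z" using j k by (auto simp: diffs_def)
  then have "diffs Y Z = {j, k}" using two_set_two[OF c(3)] j k by blast
  then have "i \<notin> diffs Y Z" using i k by auto
  then have "Z i = Y i" by (simp add: diffs_def)
  moreover have "Z j = X j" using j by (simp add: diffs_def)
  ultimately show False using adj_not_both[OF XY i(2)] adj_D[OF XZ] i by blast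
qed

text \<open>Both frames keep in slot \<open>i\<close> the hyperplane of \<open>X i\<close>
  orthogonal to \<open>x\<close>, so \<open>step_share\<close> applies between them.\<close>

lemma share_component:
  assumes X: "X \<in> D" and ij: "i \<in> I" "j \<in> I" "i \<noteq> j"
    and x: "x \<in> X i" "x \<noteq> 0" and y: "y \<in> X j" and y': "y' \<in> X j"
  shows "act (x + y) X = act (x + y') X \<or> step i j (act (x + y) X) (act (x + y') X)"
proof (cases "act (x + y) X = act (x + y') X")
  case False
  define u where "u = of_real (1 / norm x) *\<^sub>C x"
  have u: "u \<in> X i" "norm u = 1"
    using x D_scale[OF X] by (auto simp: u_def norm_scaleC norm_divide)
  have ux: "cinner u z = 0 \<longleftrightarrow> cinner x z = 0" for z using x by (simp add: u_def cinner_scaleC_left)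
  have *: "z \<in> act (x + q) X i \<and> cinner (refl_at (x + q) u) z = 0 \<longleftrightarrow> z \<in> X i \<and> cinner x z = 0"
    if q: "q \<in> X j" for q z
  proof -
    have fx: "refl_at (x + q) v = v" if "v \<in> X i" "cinner x v = 0" for v
      using that D_orth[OF X not_sym[OF ij(3)] q] by (intro refl_at_orth) (simp add: cinner_add_left)
    have "z \<in> act (x + q) X i \<and> cinner (refl_at (x + q) u) z = 0 \<longleftrightarrow>
        refl_at (x + q) z \<in> X i \<and> cinner x (refl_at (x + q) z) = 0"
      by (simp add: act_def refl_at_image_iff ux flip: cinner_refl_at_right)
    also have "\<dots> \<longleftrightarrow> z \<in> X i \<and> cinner x z = 0"
      using fx[of z] fx[of "refl_at (x + q) z"] by auto
    finally show ?thesis .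
  qed
  have nr: "norm (refl_at w u) = 1" for w
    using u(2) unfolding norm_eq_1_cinner cinner_refl_at .
  have "step i j (act (x + y) X) (act (x + y') X)"
  proof (rule step_share[OF act_D[OF X] act_D[OF X] ij _ False])
    show "act (x + y) X t = act (x + y') X t" if "t \<noteq> i" "t \<noteq> j" for t
      using act_other[OF X x(1) y that] act_other[OF X x(1) y' that] by simp
    show "refl_at (x + y) u \<in> act (x + y) X i" "refl_at (x + y') u \<in> act (x + y') X i"
      using u by (auto simp: act_def)
  qed (use nr * y y' in auto)
  then show ?thesis by blast
qed simp

definition linked :: "('i \<Rightarrow> 'a::chilbert_space set) \<Rightarrow> ('i \<Rightarrow> 'a set) \<Rightarrow> ('i \<Rightarrow> 'a set) \<Rightarrow> bool" where
  "linked X Y Z \<longleftrightarrow> Y = Z \<or> adj Y Z \<or> (\<exists>B. adj X B \<and> adj Y B \<and> adj B Z)"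

text \<open>The intermediate neighbour takes its component in \<open>X i\<close> from
  \<open>Y\<close> and the one in \<open>X j\<close> from \<open>Z\<close>. Since
  \<open>linked\<close> speaks of adjacency only, equality of types at a vertex becomes visible to
  automorphisms.\<close>

lemma linked_iff:
  assumes XY: "adj X Y" and XZ: "adj X Z"
  shows "linked X Y Z \<longleftrightarrow> diffs X Y = diffs X Z"
proof
  show "linked X Y Z \<Longrightarrow> diffs X Y = diffs X Z"
    unfolding linked_def using triangle_type XY XZ by metis
  assume eq: "diffs X Y = diffs X Z"
  obtain i j where "step i j X Y" using XY by (auto simp: adj_def)
  then obtain x y where *: "X \<in> D" "i \<in> I" "j \<in> I" "i \<noteq> j" "x \<in> X i" "y \<in> X j" "x \<noteq> 0" "y \<noteq> 0"
      "Y = act (x + y) X" and dXY: "diffs X Y = {i, j}"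
    using step_diffs unfolding step_def by metis
  have "step i j X Z" using adj_step[OF XZ] eq dXY by simp
  then obtain x' y' where **: "x' \<in> X i" "y' \<in> X j" "x' \<noteq> 0" "y' \<noteq> 0" "Z = act (x' + y') X"
    by (auto simp: step_def)
  define B where "B = act (x + y') X"
  have XB: "adj X B" unfolding B_def by (rule step_adj, rule stepI[OF *(1-5) **(2) *(7) **(4)])
  have "Y = B \<or> adj Y B"
    using share_component[OF *(1-5,7,6) **(2)] step_adj unfolding B_def *(9) by blast
  moreover have "B = Z \<or> adj B Z"
    using share_component[OF *(1,3,2) not_sym[OF *(4)] **(2,4) *(5) **(1)] step_adj
    unfolding B_def **(5) by (simp only: add.commute[of y']) blast
  ultimately show "linked X Y Z" unfolding linked_def using XB by blast
qed

text \<open>Otherwise \<open>W\<close> keeps slot \<open>k\<close> of \<open>X\<close>, and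
  \<open>adj_not_both\<close> forces XZ and ZW to have the same type km, so \<open>W\<close> differs
  from \<open>X\<close> at most in slot \<open>m\<close>. As YW and XY have different types,
  \<open>m\<close> is changed by XY and kept by YW; then \<open>W\<close> mixes slot
  \<open>m\<close> of \<open>Y\<close> with the other changed slot of \<open>X\<close>.\<close>

lemma square_type_sub:
  assumes XY: "adj X Y" and XZ: "adj X Z" and YW: "adj Y W" and ZW: "adj Z W"
    and ne: "diffs Y W \<noteq> diffs X Y" and k: "k \<in> diffs X Z" "k \<notin> diffs X Y"
  shows "k \<in> diffs Y W"
proof (rule ccontr)
  assume nk: "k \<notin> diffs Y W"
  note c = adj_card[OF XY] adj_card[OF XZ] adj_card[OF YW] adj_card[OF ZW]
  have W: "W \<in> D" using adj_D[OF YW] by blast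
  have Wk: "W k = X k" using nk k by (simp add: diffs_def)
  obtain m where m: "m \<noteq> k" "diffs X Z = {k, m}" using two_set_other[OF c(2) k(1)] by blast
  have "W m \<noteq> Z m" using adj_not_both[OF XZ m(2) W] m Wk by blast
  then have "diffs Z W = {k, m}" using two_set_two[OF c(4), of k m] Wk k m by (auto simp: diffs_def)
  then have Wt: "W t = X t" if "t \<noteq> k" "t \<noteq> m" for t using that m(2) by (metis diffs_iff empty_iff insertE)
  obtain t where t: "t \<in> diffs X Y" "t \<notin> diffs Y W" using two_set_subset[OF c(1,3)] ne by blast
  then have "t = m" using Wt[of t] k by (auto simp: diffs_def)
  obtain m' where m': "m' \<noteq> m" "diffs X Y = {m, m'}" using two_set_other[OF c(1)] t \<open>t = m\<close> by blast
  have "W m' = X m'" using Wt[of m'] m' k by auto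
  moreover have "W m = Y m" using t \<open>t = m\<close> by (simp add: diffs_def)
  moreover have "diffs X Y = {m', m}" using m' by auto
  ultimately show False using adj_not_both[OF XY _ W] m' by blast
qed

text \<open>An edge is generic if it rotates a pair of orthogonal lines to a different pair; otherwise it
  exchanges the two lines.\<close>

definition generic :: "('i \<Rightarrow> 'a::chilbert_space set) \<Rightarrow> ('i \<Rightarrow> 'a set) \<Rightarrow> bool" where
  "generic X Y \<longleftrightarrow> X \<in> D \<and> (\<exists>i\<in>I. \<exists>j\<in>I. i \<noteq> j \<and> (\<exists>x\<in>X i. \<exists>y\<in>X j. x \<noteq> 0 \<and> y \<noteq> 0
    \<and> norm x \<noteq> norm y \<and> Y = act (x + y) X))"

lemma generic_adj: "generic X Y \<Longrightarrow> adj X Y"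
  unfolding generic_def adj_def step_def by blast

lemma generic_witness:
  assumes g: "generic X Y" and d: "diffs X Y = {a, b}"
  obtains x y where "x \<in> X a" "y \<in> X b" "x \<noteq> 0" "y \<noteq> 0" "norm x \<noteq> norm y" "Y = act (x + y) X"
proof -
  obtain i j x y where *: "X \<in> D" "i \<in> I" "j \<in> I" "i \<noteq> j" "x \<in> X i" "y \<in> X j" "x \<noteq> 0" "y \<noteq> 0"
      "norm x \<noteq> norm y" "Y = act (x + y) X"
    using g unfolding generic_def by blast
  have "diffs X Y = {i, j}" using stepI[OF *(1-8)] step_diffs *(10) by blast
  then consider "i = a" "j = b" | "i = b" "j = a" using d two_set_swap by metis
  then show thesis
  proof cases
    case 1
    then show ?thesis using that[of x y] * by blast
  next
    case 2
    then show ?thesis using that[of y x] * by (simp add: add.commute)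
  qed
qed

text \<open>Orthogonality of the two reflected slots forces \<open>refl_at w x'\<close> to be
  orthogonal to \<open>X i\<close>. Its component \<open>e\<close> in \<open>X i\<close> therefore
  vanishes, which makes \<open>x'\<close> a multiple of \<open>x\<close> and gives
  \<open>cinner w w = 2 * cinner x x\<close>, that is, equal norms.\<close>

lemma orth_edges_exchange:
  assumes X: "X \<in> D" and ijk: "i \<noteq> j" "i \<noteq> k" "j \<noteq> k"
    and x: "x \<in> X i" "x \<noteq> 0" and y: "y \<in> X j" and x': "x' \<in> X i" "x' \<noteq> 0" and z: "z \<in> X k" "z \<noteq> 0"
    and orth: "\<And>u v. u \<in> act (x + y) X i \<Longrightarrow> v \<in> act (x' + z) X k \<Longrightarrow> cinner u v = 0"
  shows "norm x = norm y"
proof -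
  define w where "w = x + y"
  define v where "v = x' + z"
  have xz: "cinner x' z = 0" by (rule D_orth[OF X ijk(2) x'(1) z(1)])
  have zx: "cinner z x' = 0" using xz cinner_eq_0_commute by blast
  have xy: "cinner x y = 0" by (rule D_orth[OF X ijk(1) x(1) y])
  have "v \<noteq> 0" using zx z by (metis v_def add_eq_0_iff cinner_minus_right cinner_self_eq_0 neg_equal_0_iff_equal)
  define \<mu> where "\<mu> = 2 * cinner z z / cinner v v"
  have \<mu>: "\<mu> \<noteq> 0" using z \<open>v \<noteq> 0\<close> by (simp add: \<mu>_def)
  have rz: "refl_at v z = z - \<mu> *\<^sub>C v" using xz by (simp add: refl_at_def \<mu>_def v_def cinner_add_left)
  have 1: "cinner u (refl_at w x') = 0" if u: "u \<in> X i" for u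
  proof -
    have "cinner (refl_at w u) z = 0"
      using D_orth[OF X ijk(2) u z(1)] D_orth[OF X ijk(2) x(1) z(1)] D_orth[OF X ijk(3) y z(1)]
      by (simp add: refl_at_def w_def cinner_diff_left cinner_scaleC_left cinner_add_left)
    moreover have "cinner (refl_at w u) (refl_at v z) = 0"
      using orth[of "refl_at w u" "refl_at v z"] u z by (simp add: act_def w_def v_def)
    ultimately have "\<mu> * cinner (refl_at w u) x' = 0"
      unfolding rz by (simp add: cinner_diff_right cinner_scaleC_right) (simp add: v_def cinner_add_right)
    then show ?thesis using \<mu> by (simp add: cinner_refl_at_right)
  qed
  define c where "c = 2 * cinner x x' / cinner w w"
  define e where "e = x' - c *\<^sub>C x"
  have "cinner w x' = cinner x x'" using D_orth[OF X not_sym[OF ijk(1)] y x'(1)] by (simp add: w_def cinner_add_left)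
  then have ew: "refl_at w x' = e - c *\<^sub>C y" by (simp add: refl_at_def e_def c_def w_def scaleC_add_right)
  have eX: "e \<in> X i" unfolding e_def
    using x x' D_diff[OF X] D_scale[OF X] by blast
  have "cinner e e = 0" using 1[OF eX] D_orth[OF X ijk(1) eX y]
    by (simp add: ew cinner_diff_right cinner_scaleC_right)
  then have x'c: "x' = c *\<^sub>C x" by (simp add: e_def)
  then have c: "c \<noteq> 0" using x' by auto
  have "c = 2 * (c * cinner x x) / cinner w w" unfolding c_def[symmetric]
    by (subst (1) c_def) (simp only: x'c cinner_scaleC_right)
  then have "c * cinner w w = c * (2 * cinner x x)"
    using c by (cases "cinner w w = 0") (auto simp: field_simps)
  then have "cinner w w = 2 * cinner x x" using c by simp
  then have "complex_of_real ((norm w)\<^sup>2) = complex_of_real (2 * (norm x)\<^sup>2)"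
    by (simp only: cinner_self of_real_mult of_real_numeral)
  then have "(norm w)\<^sup>2 = 2 * (norm x)\<^sup>2" by (simp only: of_real_eq_iff)
  then have "(norm y)\<^sup>2 = (norm x)\<^sup>2" using norm_add_orth[OF xy] by (simp add: w_def)
  then show ?thesis by (simp add: power2_eq_iff_nonneg)
qed

text \<open>With XY of type ab, unequal opposite types must be ak and bk. Then \<open>W\<close>
  contains slot \<open>a\<close> of \<open>Y\<close> and slot \<open>k\<close> of \<open>Z\<close>;
  their orthogonality makes XY an exchange by \<open>orth_edges_exchange\<close>.\<close>

lemma square_types:
  assumes g: "generic X Y" and XZ: "adj X Z" and YW: "adj Y W" and ZW: "adj Z W"
    and ne: "diffs X Z \<noteq> diffs X Y" "diffs Y W \<noteq> diffs X Y"
  shows "diffs X Z = diffs Y W"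
proof (rule ccontr)
  assume nt: "diffs X Z \<noteq> diffs Y W"
  note XY = generic_adj[OF g]
  note c = adj_card[OF XY] adj_card[OF XZ] adj_card[OF YW] adj_card[OF ZW]
  have D: "X \<in> D" "Y \<in> D" "Z \<in> D" "W \<in> D" using adj_D[OF XY] adj_D[OF ZW] by blast+
  have 1: "k \<in> diffs Y W" if "k \<in> diffs X Z" "k \<notin> diffs X Y" for k
    using square_type_sub[OF XY XZ YW ZW ne(2) that] .
  have 2: "k \<in> diffs X Z" if "k \<in> diffs Y W" "k \<notin> diffs X Y" for k
    using square_type_sub[OF adj_sym[OF XY] YW XZ adj_sym[OF ZW]] that ne diffs_commute[of X Y] by metis
  obtain a where a: "a \<in> diffs X Z" "a \<in> diffs X Y"
    using 1 two_set_subset[OF c(2,3)] nt by blast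
  obtain b where b: "b \<in> diffs Y W" "b \<in> diffs X Y"
    using 2 two_set_subset[OF c(3,2)] nt by blast
  obtain k where k: "k \<in> diffs X Z" "k \<notin> diffs X Y" using two_set_subset[OF c(2,1)] ne by blast
  have dXZ: "diffs X Z = {a, k}" using two_set_two[OF c(2) a(1) k(1)] a k by blast
  have dYW: "diffs Y W = {b, k}" using two_set_two[OF c(3) b(1) 1[OF k]] b k by blast
  have ab: "a \<noteq> b" using nt dXZ dYW by auto
  have dXY: "diffs X Y = {a, b}" using two_set_two[OF c(1) a(2) b(2) ab] .
  have abk: "a \<noteq> k" "b \<noteq> k" using a b k by auto
  have Wa: "W a = Y a" using dYW ab abk by (metis diffs_iff empty_iff insertE)
  have Zb: "Z b = X b" using dXZ ab abk by (metis diffs_iff empty_iff insertE)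
  have dYX: "diffs X Y = {b, a}" using dXY by auto
  have "W k = Z k"
  proof (rule ccontr)
    assume "W k \<noteq> Z k"
    then have kr: "k \<in> diffs Z W" by (auto simp: diffs_def)
    have "W b \<noteq> X b" using adj_not_both[OF XY dYX D(4)] Wa ab by blast
    then have "b \<in> diffs Z W" using Zb by (auto simp: diffs_def)
    then have "diffs Z W = {k, b}" using two_set_two[OF c(4) kr] abk by blast
    then have "a \<notin> diffs Z W" using ab abk by auto
    then have "Z a = Y a" using Wa by (simp add: diffs_def)
    then show False using adj_not_both[OF XY dYX D(3)] Zb ab by blast
  qed
  obtain x y where xy: "x \<in> X a" "y \<in> X b" "x \<noteq> 0" "norm x \<noteq> norm y" "Y = act (x + y) X"
    using generic_witness[OF g dXY] by metis
  obtain x' z where z: "x' \<in> X a" "z \<in> X k" "x' \<noteq> 0" "z \<noteq> 0" "Z = act (x' + z) X"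
    using adj_step[OF XZ dXZ] unfolding step_def by blast
  have "norm x = norm y"
  proof (rule orth_edges_exchange[OF D(1) ab abk xy(1,3,2) z(1,3,2,4)])
    fix u v assume "u \<in> act (x + y) X a" "v \<in> act (x' + z) X k"
    then have "u \<in> W a" "v \<in> W k" using Wa \<open>W k = Z k\<close> xy z by auto
    then show "cinner u v = 0" using D_orth[OF D(4) abk(1)] by blast
  qed
  then show False using xy by blast
qed

lemma act_step:
  assumes X: "X \<in> D" and ij: "i \<in> I" "j \<in> I" "i \<noteq> j" and a: "a \<in> X i" "a \<noteq> 0" and b: "b \<in> X j" "b \<noteq> 0"
  shows "step i j (act v X) (act (refl_at v (a + b)) (act v X))"
  unfolding refl_at_add
proof (rule stepI[OF act_D[OF X] ij])
  show "refl_at v a \<in> act v X i" "refl_at v b \<in> act v X j" using a b by (auto simp: act_def)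
  show "refl_at v a \<noteq> 0" "refl_at v b \<noteq> 0" using a b by (metis refl_at_0 refl_at_invol)+
qed

lemma D_ex_norm:
  assumes X: "X \<in> D" and i: "i \<in> I" shows "\<exists>r\<in>X i. norm r = norm x"
proof -
  obtain u where u: "u \<in> X i" "norm u = 1" using D_ex_unit[OF X i] by blast
  then show ?thesis using D_scale[OF X u(1)]
    by (intro bexI[of _ "of_real (norm x) *\<^sub>C u"]) (auto simp: norm_scaleC)
qed

text \<open>An exchange vector \<open>v\<close> of type kl at \<open>X\<close> is conjugated by
  \<open>w\<close> to an edge at \<open>Y\<close>. The ends \<open>Z\<close> and \<open>W\<close>
  are adjacent because \<open>refl_at v\<close> sends each of the two components of \<open>w\<close>
  into a single slot.\<close>

lemma square_exists:
  assumes s: "step i j X Y" and kl: "k \<in> I" "l \<in> I" "k \<noteq> l" "{k, l} \<noteq> {i, j}"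
  shows "\<exists>Z W. step k l X Z \<and> step k l Y W \<and> adj Z W"
proof -
  have main: "\<exists>Z W. step k l X Z \<and> step k l Y W \<and> adj Z W"
    if s: "step i j X Y" and kl: "k \<in> I" "l \<in> I" "k \<noteq> l" and l: "l \<noteq> i" "l \<noteq> j" and k: "k \<noteq> j" for i j k l
  proof -
    obtain x y where *: "X \<in> D" "i \<in> I" "j \<in> I" "i \<noteq> j" "x \<in> X i" "y \<in> X j" "x \<noteq> 0" "y \<noteq> 0"
        "Y = act (x + y) X"
      using s by (auto simp: step_def)
    note X = *(1)
    \<comment> \<open>For \<open>k = i\<close> the exchanged line must be that of \<open>x\<close>
      itself, so that \<open>refl_at v\<close> carries \<open>x\<close> to \<open>r\<close> in
      \<open>X l\<close>.\<close>
    define p where "p = (if k = i then x else SOME p. p \<in> X k \<and> p \<noteq> 0)"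
    have "\<exists>p. p \<in> X k \<and> p \<noteq> 0" using D_ex[OF X kl(1)] by blast
    then have p: "p \<in> X k" "p \<noteq> 0" using *(5,7) someI_ex[of "\<lambda>p. p \<in> X k \<and> p \<noteq> 0"]
      by (auto simp: p_def)
    obtain r where r: "r \<in> X l" "norm r = norm p" using D_ex_norm[OF X kl(2)] by blast
    have rn: "r \<noteq> 0" "- r \<in> X l" using r p D_neg[OF X] by auto
    define w where "w = x + y"
    define v where "v = p + - r"
    define Z where "Z = act v X"
    have XZ: "step k l X Z" unfolding Z_def v_def using X kl p rn by (intro stepI) auto
    have YW: "step k l Y (act (refl_at w v) Y)" unfolding *(9) w_def[symmetric] v_def
      using X kl p rn by (intro act_step) auto
    have W: "act (refl_at w v) Y = act w Z" unfolding Z_def *(9) w_def[symmetric]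
      by (rule act_conj[symmetric])
    have vy: "refl_at v y = y"
      using D_orth[OF X k p(1) *(6)] D_orth[OF X l(2) r(1) *(6)]
      by (intro refl_at_orth) (simp add: v_def cinner_diff_left)
    have "\<exists>m x'. m \<in> I \<and> m \<noteq> j \<and> x' \<in> X m \<and> x' \<noteq> 0 \<and> refl_at v x = x'"
    proof (cases "k = i")
      case True
      have "refl_at v p = r" unfolding v_def using refl_at_exchange_orth[of p r]
        D_orth[OF X kl(3) p(1) r(1)] p r by simp
      then show ?thesis using True kl l r rn by (intro exI[of _ l] exI[of _ r]) (auto simp: p_def)
    next
      case False
      have "refl_at v x = x"
        using D_orth[OF X False p(1) *(5)] D_orth[OF X l(1) r(1) *(5)]
        by (intro refl_at_orth) (simp add: v_def cinner_diff_left)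
      then show ?thesis using * by blast
    qed
    then obtain m x' where m: "m \<in> I" "m \<noteq> j" "x' \<in> X m" "x' \<noteq> 0" "refl_at v x = x'" by blast
    have "refl_at v (x' + y) = w" using m vy refl_at_add refl_at_invol by (metis w_def)
    then have "step m j Z (act w Z)" unfolding Z_def
      using act_step[OF X m(1) *(3) m(2,3,4) *(6,8), of v] by simp
    then show ?thesis using XZ YW W step_adj by metis
  qed
  \<comment> \<open>Distinct pairs leave some index of kl outside ij; swapping the names within each
    pair reduces all cases to \<open>main\<close>.\<close>
  consider "l \<noteq> i \<and> l \<noteq> j \<and> k \<noteq> j" | "l \<noteq> i \<and> l \<noteq> j \<and> k = j" | "k \<noteq> i \<and> k \<noteq> j \<and> l \<noteq> j" | "k \<noteq> i \<and> k \<noteq> j \<and> l = j"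
    using kl s by (auto simp: step_def)
  then show ?thesis
  proof cases
    case 1 then show ?thesis using main[OF s] kl by blast
  next
    case 2
    then show ?thesis using main[OF step_swap[OF s] kl(1-3)] s by (auto simp: step_def[of i j X Y])
  next
    case 3
    then obtain Z W where "step l k X Z" "step l k Y W" "adj Z W"
      using main[OF s kl(2,1)] kl by blast
    then show ?thesis using step_swap by blast
  next
    case 4
    then obtain Z W where "step l k X Z" "step l k Y W" "adj Z W"
      using main[OF step_swap[OF s] kl(2,1)] kl s by (auto simp: step_def[of i j X Y])
    then show ?thesis using step_swap by blast
  qed
qed

text \<open>This graph-theoretic property characterises the exchange edges: there a type at $X$ corresponds
  through squares to two different types at $Y$.\<close>

definition irregular :: "('i \<Rightarrow> 'a::chilbert_space set) \<Rightarrow> ('i \<Rightarrow> 'a set) \<Rightarrow> bool" where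
  "irregular X Y \<longleftrightarrow> (\<exists>C E E'. adj X C \<and> diffs X C \<noteq> diffs X Y \<and> adj Y E \<and> adj Y E'
    \<and> diffs Y E \<noteq> diffs Y X \<and> diffs Y E' \<noteq> diffs Y X \<and> diffs Y E \<noteq> diffs Y E' \<and> adj C E \<and> adj C E')"

lemma generic_not_irregular: "generic X Y \<Longrightarrow> \<not> irregular X Y"
  unfolding irregular_def using square_types[of X Y] diffs_commute[of X Y] by metis

text \<open>Since \<open>w\<close> exchanges the lines of \<open>x\<close> and \<open>y\<close>, the
  vector \<open>v = x - r\<close> has type ik at \<open>X\<close> but jk at \<open>Y\<close>.
  Reflecting \<open>Y\<close> by \<open>v\<close> and by its conjugate \<open>refl_at w v\<close>
  gives two neighbours of different types, both adjacent to \<open>C = act v X\<close>.\<close>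

lemma not_generic_irregularular:
  assumes a: "adj X Y" and ng: "\<not> generic X Y" and c: "card I \<ge> 3"
  shows "irregular X Y"
proof -
  obtain i j x y where *: "X \<in> D" "i \<in> I" "j \<in> I" "i \<noteq> j" "x \<in> X i" "y \<in> X j" "x \<noteq> 0" "y \<noteq> 0"
      "Y = act (x + y) X"
    using a by (auto simp: step_def adj_def)
  note X = *(1)
  have nxy: "norm x = norm y" using ng * unfolding generic_def by blast
  have "card {i, j} < card I" using c *(4) by simp
  then obtain k where k: "k \<in> I" "k \<noteq> i" "k \<noteq> j"
    using finite_I by (metis card_mono finite.emptyI finite_insert insertCI linorder_not_less subsetI)
  obtain r where r: "r \<in> X k" "norm r = norm x" using D_ex_norm[OF X k(1)] by blast
  have rn: "r \<noteq> 0" "- r \<in> X k" using r * D_neg[OF X] by auto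
  define w where "w = x + y"
  define v where "v = x + - r"
  define C where "C = act v X"
  have Y: "Y = act w X" using * by (simp add: w_def)
  have yk: "cinner y r = 0" by (rule D_orth[OF X not_sym[OF k(3)] *(6) r(1)])
  have xk: "cinner x r = 0" by (rule D_orth[OF X not_sym[OF k(2)] *(5) r(1)])
  have wx: "refl_at w x = - y" unfolding w_def
    using nxy *(7) D_orth[OF X *(4-6)] by (intro refl_at_sum_exchange) auto
  have wr: "refl_at w r = r" using xk yk cinner_add_left[of x y r]
    by (intro refl_at_orth) (simp add: w_def)
  have vx: "refl_at v x = r" unfolding v_def using refl_at_exchange_orth[of x r] xk r *(7) by simp
  have vy: "refl_at v y = y"
    using D_orth[OF X *(4-6)] yk cinner_eq_0_commute[of y r]
    by (intro refl_at_orth) (simp add: v_def cinner_diff_left)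
  have XC: "step i k X C" unfolding C_def v_def
    using X * k rn by (intro stepI) auto
  have YE: "step i k Y (act (refl_at w v) Y)" unfolding Y v_def
    using X * k rn by (intro act_step) auto
  have E: "act (refl_at w v) Y = act w C" unfolding C_def Y by (rule act_conj[symmetric])
  have "w = refl_at v (r + y)" using vx vy by (metis refl_at_add refl_at_invol w_def)
  then have CE: "step k j C (act w C)" unfolding C_def
    using act_step[OF X k(1) *(3) k(3) r(1) rn(1) *(6,8), of v] by simp
  have "refl_at w v = - y + - r" by (simp add: v_def refl_at_diff wx wr)
  then have v2: "v = refl_at w (- y + - r)" by (metis refl_at_invol)
  have ny: "- y \<in> X j" using * D_neg[OF X] by blast
  have "step j k Y (act (refl_at w (- y + - r)) Y)" unfolding Y
    by (rule act_step[OF X *(3) k(1) not_sym[OF k(3)]]) (use * rn ny in auto)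
  then have YE': "step j k Y (act v Y)" unfolding v2[symmetric] .
  have "act v Y = act (refl_at v w) C" unfolding C_def Y by (rule act_conj)
  then have CE': "step i j C (act v Y)" unfolding C_def
    using act_step[OF X *(2-5,7,6,8), of v] by (simp add: w_def)
  have d: "diffs X Y = {i, j}" using step_diffs[OF stepI[OF *(1-8)]] *(9) by simp
  then have d': "diffs Y X = {i, j}" using diffs_commute[of X Y] by simp
  show ?thesis unfolding irregular_def
  proof (rule exI[of _ C], rule exI[of _ "act w C"], rule exI[of _ "act v Y"], intro conjI)
    show "adj X C" "adj Y (act w C)" "adj Y (act v Y)" "adj C (act w C)" "adj C (act v Y)"
      using XC YE YE' E CE CE' step_adj by metis+
    show "diffs X C \<noteq> diffs X Y" "diffs Y (act w C) \<noteq> diffs Y X" "diffs Y (act v Y) \<noteq> diffs Y X"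
      "diffs Y (act w C) \<noteq> diffs Y (act v Y)"
      using step_diffs[OF XC] step_diffs[OF YE] step_diffs[OF YE'] d d' E *(4) k
      by (auto simp: doubleton_eq_iff)
  qed
qed

text \<open>The intermediate frame keeps the component \<open>x\<close>, so it is adjacent to
  \<open>Y\<close>, and rescales \<open>y\<close>. If its edge to \<open>Y\<close> were an exchange,
  a nonzero \<open>x1\<close> in slot \<open>i\<close> of \<open>B\<close> would lie in slot
  \<open>j\<close> of \<open>Y\<close>. Orthogonality to \<open>y\<close>, which lies in slot
  \<open>i\<close> of \<open>Y\<close>, puts \<open>x1\<close> in \<open>X i\<close> and makes it
  orthogonal to \<open>x\<close>. So \<open>refl_at w\<close> fixes \<open>x1\<close>, although it
  maps \<open>Y j\<close> to \<open>X j\<close>.\<close>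

lemma generic_or_via:
  assumes a: "adj X Y"
  shows "generic X Y \<or> (\<exists>B. generic X B \<and> generic B Y)"
proof (rule disjCI)
  assume ng: "\<not> (\<exists>B. generic X B \<and> generic B Y)"
  show "generic X Y"
  proof (rule ccontr)
    assume ng': "\<not> generic X Y"
  obtain i j x y where *: "X \<in> D" "i \<in> I" "j \<in> I" "i \<noteq> j" "x \<in> X i" "y \<in> X j" "x \<noteq> 0" "y \<noteq> 0"
      "Y = act (x + y) X"
    using a by (auto simp: step_def adj_def)
  note X = *(1)
  have nxy: "norm x = norm y" using ng' * unfolding generic_def by blast
  have xy: "cinner x y = 0" by (rule D_orth[OF X *(4-6)])
  have yx: "cinner y x = 0" using xy cinner_eq_0_commute by blast
  \<comment> \<open>Any nonzero scalar of modulus other than 1 makes the norms differ; with 2, the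
    proof of \<open>B \<noteq> Y\<close> compares 5 with 8.\<close>
  have 2: "2 *\<^sub>C y \<in> X j" "2 *\<^sub>C y \<noteq> 0" using *(6,8) D_scale[OF X] by auto
  define w where "w = x + y"
  define u where "u = x + 2 *\<^sub>C y"
  define B where "B = act u X"
  have un: "u \<noteq> 0"
  proof
    assume "u = 0"
    then have "cinner x u = 0" by simp
    then show False using xy *(7) by (simp add: u_def cinner_add_right cinner_scaleC_right)
  qed
  have uy: "cinner u y = 2 * cinner y y" using xy by (simp add: u_def cinner_add_left cinner_scaleC_left)
  have B: "B \<in> D" unfolding B_def by (rule act_D[OF X])
  have Y: "Y \<in> D" unfolding *(9) by (rule act_D[OF X])
  have XB: "generic X B" unfolding generic_def B_def u_def
    using * 2 nxy
    by (intro conjI bexI[of _ i] bexI[of _ j] bexI[of _ x] bexI[of _ "2 *\<^sub>C y"]) (auto simp: norm_scaleC)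
  have "refl_at w x = - y" unfolding w_def using nxy *(7) xy by (intro refl_at_sum_exchange) auto
  then have "- y \<in> Y i" using *(5,9) by (auto simp: act_def w_def intro!: image_eqI[of _ _ x])
  then have yY: "y \<in> Y i" using D_neg[OF Y] by force
  have "B \<noteq> Y"
  proof
    assume "B = Y"
    then have "y \<in> B i" using yY by simp
    then have "refl_at u y \<in> X i" by (simp add: B_def act_def refl_at_image_iff)
    then have "cinner y (refl_at u y) = 0" using D_orth[OF X not_sym[OF *(4)] *(6)] by blast
    moreover have yu: "cinner y u = 2 * cinner y y" using yx by (simp add: u_def cinner_add_right cinner_scaleC_right)
    ultimately have e: "cinner y y = 2 * (2 * cinner y y) / cinner u u * (2 * cinner y y)"
      by (simp add: refl_at_def uy cinner_diff_right cinner_scaleC_right)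
    have "cinner x x = cinner y y" using nxy by (simp add: cinner_self)
    then have "cinner u u = 5 * cinner y y"
      using xy yx by (simp add: u_def cinner_add_left cinner_add_right cinner_scaleC_left cinner_scaleC_right)
    then show False using e *(8) by simp
  qed
  have "B = Y \<or> step i j B Y"
    using share_component[OF *(1-5,7) 2(1) *(6)] unfolding B_def u_def *(9) .
  then have "step i j B Y" using \<open>B \<noteq> Y\<close> by blast
  then obtain x1 y1 where b: "x1 \<in> B i" "y1 \<in> B j" "x1 \<noteq> 0" "y1 \<noteq> 0" "Y = act (x1 + y1) B"
    by (auto simp: step_def)
  have "norm y1 = norm x1" using ng XB B * b unfolding generic_def by metis
  then have "refl_at (y1 + x1) y1 = - x1"
    using b D_orth[OF B not_sym[OF *(4)] b(2,1)] by (intro refl_at_sum_exchange) auto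
  then have "- x1 \<in> Y j" using b by (auto simp: act_def add.commute intro!: image_eqI[of _ _ y1])
  then have x1Y: "x1 \<in> Y j" using D_neg[OF Y] by force
  define e where "e = refl_at u x1"
  have eX: "e \<in> X i" using b(1) by (simp add: B_def act_def refl_at_image_iff e_def)
  have x1e: "x1 = refl_at u e" by (simp add: e_def)
  have ye: "cinner y e = 0" by (rule D_orth[OF X not_sym[OF *(4)] *(6) eX])
  have "cinner y x1 = 0" by (rule D_orth[OF Y *(4) yY x1Y])
  then have "cinner u e / cinner u u * cinner y y = 0"
    using ye yx by (simp add: x1e refl_at_def cinner_diff_right cinner_scaleC_right cinner_add_right[of y x]
        u_def[THEN arg_cong, of "cinner y"])
  then have ue: "cinner u e = 0" using *(8) un by simp
  then have x1X: "x1 = e" using x1e refl_at_orth by metis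
  have "cinner x e = 0" using ue ye by (simp add: u_def cinner_add_left cinner_scaleC_left)
  then have "refl_at w x1 = x1" using x1X ye by (intro refl_at_orth) (simp add: w_def cinner_add_left)
  moreover have "refl_at w x1 \<in> X j" using x1Y *(9) by (simp add: act_def refl_at_image_iff w_def)
  ultimately have "cinner x1 x1 = 0" using D_orth[OF X *(4) eX] x1X by simp
  then show False using b by simp
  qed
qed

subsection \<open>Connectedness\<close>

definition reach :: "'i set \<Rightarrow> ('i \<Rightarrow> 'a::chilbert_space set) \<Rightarrow> ('i \<Rightarrow> 'a set) \<Rightarrow> bool" where
  "reach J = (\<lambda>X Y. adj X Y \<and> (\<forall>t\<in>J. X t = Y t))\<^sup>*\<^sup>*"

lemma reach_refl: "reach J X X"
  by (simp add: reach_def)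

lemma reach_trans: "reach J X Y \<Longrightarrow> reach J Y Z \<Longrightarrow> reach J X Z"
  unfolding reach_def by (rule rtranclp_trans)

lemma reach_step: "adj X Y \<Longrightarrow> (\<And>t. t \<in> J \<Longrightarrow> X t = Y t) \<Longrightarrow> reach J X Y"
  unfolding reach_def by (rule r_into_rtranclp) blast

lemma reach_mono: "reach J X Y \<Longrightarrow> J' \<subseteq> J \<Longrightarrow> reach J' X Y"
  unfolding reach_def by (erule rtranclp_mono[THEN predicate2D, rotated]) auto

lemma reach_agree: "reach J X Y \<Longrightarrow> t \<in> J \<Longrightarrow> X t = Y t"
  unfolding reach_def by (induction rule: rtranclp_induct) auto

lemma reach_D: "reach J X Y \<Longrightarrow> X \<in> D \<Longrightarrow> Y \<in> D"
  unfolding reach_def by (induction rule: rtranclp_induct) (auto dest: adj_D)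

text \<open>The step is a reflection exchanging a vector of \<open>X i\<close> with one proportional
  to \<open>c + q\<close>. If \<open>c = 0\<close>, the vector given up is a multiple of
  \<open>p\<close>, orthogonal to the set \<open>K\<close> of vectors already placed. Whatever is
  orthogonal to the reflection vector stays in its slot.\<close>

lemma turn_component:
  assumes X: "X \<in> D" and it: "i \<in> I" "t \<in> I" "i \<noteq> t"
    and c: "c \<in> X i" and q: "q \<in> X t" "q \<noteq> 0"
    and K: "\<And>k. k \<in> K \<Longrightarrow> k \<in> X i \<and> cinner k c = 0"
    and p: "c = 0 \<Longrightarrow> \<exists>p\<in>X i. p \<noteq> 0 \<and> (\<forall>k\<in>K. cinner k p = 0)"
  shows "\<exists>Y. step i t X Y \<and> c + q \<in> Y i \<and> K \<subseteq> Y i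
    \<and> (\<forall>m v. m \<noteq> i \<longrightarrow> v \<in> X m \<longrightarrow> cinner v q = 0 \<longrightarrow> v \<in> Y m)"
proof -
  have "\<exists>a b x z. a \<in> X i \<and> b = a - (x + z) \<and> norm a = norm b \<and> cinner a b = cinner b a \<and> a \<noteq> b
    \<and> x \<in> X i \<and> z \<in> X t \<and> x \<noteq> 0 \<and> z \<noteq> 0 \<and> (\<forall>k\<in>K. cinner k x = 0) \<and> (\<exists>r. c + q = r *\<^sub>C b)
    \<and> (\<exists>r. z = r *\<^sub>C q)"
  proof (cases "c = 0")
    case True
    then obtain p where p: "p \<in> X i" "p \<noteq> 0" "\<forall>k\<in>K. cinner k p = 0" using p by blast
    define s where "s = complex_of_real (norm q / norm p)"
    have s: "s \<noteq> 0" "norm (s *\<^sub>C p) = norm q" using p q by (auto simp: s_def norm_scaleC norm_divide)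
    have "cinner (s *\<^sub>C p) q = 0" "cinner q (s *\<^sub>C p) = 0"
      using D_orth[OF X it(3) p(1) q(1)] D_orth[OF X not_sym[OF it(3)] q(1) p(1)]
      by (simp_all add: cinner_scaleC_left cinner_scaleC_right)
    moreover have "s *\<^sub>C p \<noteq> q" using calculation q by force
    moreover have "\<exists>r. c + q = r *\<^sub>C q" using True by (intro exI[of _ 1]) simp
    moreover have "\<exists>r. - q = r *\<^sub>C q" by (intro exI[of _ "-1"]) (simp add: scaleC_minus1)
    ultimately show ?thesis
      using True p q s D_scale[OF X p(1)] D_neg[OF X q(1)]
      by (rule_tac exI[of _ "s *\<^sub>C p"], rule_tac exI[of _ q], rule_tac exI[of _ "s *\<^sub>C p"], rule_tac exI[of _ "- q"])
        (simp add: cinner_scaleC_right)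
  next
    case False
    have cq: "cinner c q = 0" "cinner q c = 0"
      using D_orth[OF X it(3) c q(1)] D_orth[OF X not_sym[OF it(3)] q(1) c] by auto
    \<comment> \<open>The factor \<open>s\<close> gives c and s (c + q) the same norm. It lies
      strictly between 0 and 1, so both components of their difference are nonzero.\<close>
    define s where "s = norm c / norm (c + q)"
    have "(norm c)\<^sup>2 < (norm (c + q))\<^sup>2" using norm_add_orth[OF cq(1)] q by simp
    then have lt: "norm c < norm (c + q)" using power2_less_imp_less norm_ge_zero by blast
    moreover have "0 < norm c" using False by simp
    ultimately have s: "0 < s" "s < 1" unfolding s_def
      by (metis divide_pos_pos order_less_trans, metis divide_less_eq_1_pos order_less_trans)
    have "norm (c + q) \<noteq> 0" using lt norm_ge_zero[of c] by linarith
    then have nb: "norm (of_real s *\<^sub>C (c + q)) = norm c" using s by (simp add: norm_scaleC) (simp add: s_def)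
    have x: "of_real (1 - s) *\<^sub>C c \<in> X i" "of_real (- s) *\<^sub>C q \<in> X t"
      using D_scale[OF X] c q by blast+
    have xn: "of_real (1 - s) *\<^sub>C c \<noteq> 0" "of_real (- s) *\<^sub>C q \<noteq> 0" using s False q by auto
    have cb: "cinner c (of_real s *\<^sub>C (c + q)) = cinner (of_real s *\<^sub>C (c + q)) c"
      using cq by (simp add: cinner_scaleC_left cinner_scaleC_right cinner_add_left cinner_add_right)
    have bb: "of_real s *\<^sub>C (c + q) = c - (of_real (1 - s) *\<^sub>C c + of_real (- s) *\<^sub>C q)"
      by (simp add: scaleC_add_right scaleC_diff_left complex_vector.scale_minus_left)
    have ne: "c \<noteq> of_real s *\<^sub>C (c + q)"
    proof
      assume e: "c = of_real s *\<^sub>C (c + q)"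
      have "cinner q (of_real s *\<^sub>C (c + q)) = of_real s * cinner q q"
        using cq by (simp add: cinner_scaleC_right cinner_add_right)
      then show False using e cq q s by auto
    qed
    have r: "c + q = of_real (1 / s) *\<^sub>C (of_real s *\<^sub>C (c + q))" using s by (simp add: scaleC_scaleC)
    have "\<forall>k\<in>K. cinner k (of_real (1 - s) *\<^sub>C c) = 0" using K by (simp add: cinner_scaleC_right)
    then show ?thesis using c bb nb cb ne x xn r by (metis (no_types, lifting))
  qed
  then obtain a b x z r r' where *: "a \<in> X i" "b = a - (x + z)" "norm a = norm b" "cinner a b = cinner b a" "a \<noteq> b"
    "x \<in> X i" "z \<in> X t" "x \<noteq> 0" "z \<noteq> 0" "\<forall>k\<in>K. cinner k x = 0" "c + q = r *\<^sub>C b" and z: "z = r' *\<^sub>C q"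
    by blast
  define Y where "Y = act (x + z) X"
  have s: "step i t X Y" unfolding Y_def by (rule stepI[OF X it *(6-9)])
  have "a - b = x + z" unfolding *(2) by simp
  then have "refl_at (x + z) a = b" using refl_at_exchange[OF *(3-5)] by metis
  then have "b \<in> Y i" using *(1) by (auto simp: Y_def act_def)
  then have "c + q \<in> Y i" using *(11) complex_vector.subspace_scale[OF D_sub[OF step_D[OF s]]] by metis
  moreover have "k \<in> Y i" if k: "k \<in> K" for k
  proof -
    have "cinner x k = 0" "cinner z k = 0"
      using *(10) k cinner_eq_0_commute[of k x] D_orth[OF X not_sym[OF it(3)] *(7), of k] K by auto
    then have "refl_at (x + z) k = k" by (intro refl_at_orth) (simp add: cinner_add_left)
    then show ?thesis using K[OF k] by (auto simp: Y_def act_def refl_at_image_iff)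
  qed
  moreover have "v \<in> Y m" if v: "m \<noteq> i" "v \<in> X m" "cinner v q = 0" for m v
  proof -
    have "cinner x v = 0" "cinner z v = 0"
      using D_orth[OF X not_sym[OF v(1)] *(6) v(2)] v(3) cinner_eq_0_commute[of v q]
      by (auto simp: z cinner_scaleC_left)
    then have "refl_at (x + z) v = v" by (intro refl_at_orth) (simp add: cinner_add_left)
    then show ?thesis using v(2) by (auto simp: Y_def act_def refl_at_image_iff)
  qed
  ultimately show ?thesis using s by blast
qed

text \<open>Each turn merges one component of \<open>y\<close> into slot \<open>i\<close>, which
  lowers the number of other slots with a nonzero component. Slots in \<open>J\<close> have zero
  component and are never touched. The alternative in the last hypothesis is for the first turn;
  afterwards the component in slot \<open>i\<close> is nonzero.\<close>

lemma reach_vector: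
  assumes "X \<in> D" and i: "i \<in> I" "i \<notin> J"
    and "\<And>t z. t \<in> J \<Longrightarrow> z \<in> X t \<Longrightarrow> cinner z y = 0"
    and "\<And>k. k \<in> K \<Longrightarrow> k \<in> X i \<and> cinner k y = 0"
    and "cproj (X i) y \<noteq> 0 \<or> (\<exists>p\<in>X i. p \<noteq> 0 \<and> (\<forall>k\<in>K. cinner k p = 0))"
  shows "\<exists>Y. reach J X Y \<and> K \<subseteq> Y i \<and> y \<in> Y i
    \<and> (\<forall>m v. m \<noteq> i \<longrightarrow> v \<in> X m \<longrightarrow> cinner v y = 0 \<longrightarrow> v \<in> Y m)"
  using assms(1,4,5,6)
proof (induction "card {t \<in> I - {i}. cproj (X t) y \<noteq> 0}" arbitrary: X rule: less_induct)
  case less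
  note X = less.prems(1)
  show ?case
  proof (cases "{t \<in> I - {i}. cproj (X t) y \<noteq> 0} = {}")
    case True
    have "y = (\<Sum>t\<in>I. cproj (X t) y)" by (rule sum_cproj[OF X])
    also have "\<dots> = cproj (X i) y" using True i finite_I
      by (subst sum.remove[of _ i]) (auto intro!: sum.neutral)
    finally have "y \<in> X i" using cproj_mem[OF X i(1)] by metis
    then show ?thesis using reach_refl less.prems(3) by blast
  next
    case False
    then obtain t where t: "t \<in> I" "t \<noteq> i" "cproj (X t) y \<noteq> 0" by blast
    have tJ: "t \<notin> J" using cproj_orth[OF X t(1)] less.prems(2) t(3) by blast
    define c where "c = cproj (X i) y"
    define q where "q = cproj (X t) y"
    have c: "c \<in> X i" and q: "q \<in> X t" "q \<noteq> 0" using cproj_mem[OF X] i t by (auto simp: c_def q_def)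
    have K: "k \<in> X i \<and> cinner k c = 0" if "k \<in> K" for k
      using less.prems(3)[OF that] cproj_cinner[OF X i(1), of k y] by (simp add: c_def)
    obtain Y where Y: "step i t X Y" "c + q \<in> Y i" "K \<subseteq> Y i"
      and keep: "\<And>m v. m \<noteq> i \<Longrightarrow> v \<in> X m \<Longrightarrow> cinner v q = 0 \<Longrightarrow> v \<in> Y m"
      using turn_component[OF X i(1) t(1) not_sym[OF t(2)] c q K] less.prems(4) unfolding c_def[symmetric] by blast
    note YD = step_D[OF Y(1)]
    have other: "Y s = X s" if "s \<noteq> i" "s \<noteq> t" for s
      using step_diffs[OF Y(1)] that by (auto simp: diffs_def)
    define y' where "y' s = (if s = i then c + q else if s = t then 0 else cproj (X s) y)" for s
    have ysum: "y = (\<Sum>s\<in>I. y' s)"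
    proof -
      have "y = c + (q + (\<Sum>s\<in>I - {i} - {t}. cproj (X s) y))"
        unfolding c_def q_def
        by (subst (1) sum_cproj[OF X, of y], subst sum.remove[of _ i], use finite_I i in simp, use i in simp,
            subst sum.remove[of _ t]) (use finite_I i t in auto)
      also have "\<dots> = y' i + (y' t + (\<Sum>s\<in>I - {i} - {t}. y' s))"
        using t by (simp add: y'_def)
      also have "\<dots> = (\<Sum>s\<in>I. y' s)"
        by (subst (2) sum.remove[of _ i], use finite_I i in simp, use i in simp,
            subst (2) sum.remove[of _ t]) (use finite_I i t in auto)
      finally show ?thesis .
    qed
    have y'Y: "y' s \<in> Y s" if "s \<in> I" for s
      using Y(2) other[of s] cproj_mem[OF X that] D_0[OF YD] t
      by (auto simp: y'_def)
    have cpY: "cproj (Y s) y = y' s" if "s \<in> I" for s by (rule cproj_sum[OF YD y'Y ysum that])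
    have "{s \<in> I - {i}. cproj (Y s) y \<noteq> 0} \<subset> {s \<in> I - {i}. cproj (X s) y \<noteq> 0}"
    proof
      show "{s \<in> I - {i}. cproj (Y s) y \<noteq> 0} \<subseteq> {s \<in> I - {i}. cproj (X s) y \<noteq> 0}"
      proof
        fix s assume "s \<in> {s \<in> I - {i}. cproj (Y s) y \<noteq> 0}"
        then have s: "s \<in> I" "s \<noteq> i" "y' s \<noteq> 0" using cpY[of s] by auto
        then have "y' s = cproj (X s) y" unfolding y'_def by (cases "s = t") simp_all
        then show "s \<in> {s \<in> I - {i}. cproj (X s) y \<noteq> 0}" using s by simp
      qed
      have "y' t = 0" using t(2) by (simp add: y'_def)
      then show "{s \<in> I - {i}. cproj (Y s) y \<noteq> 0} \<noteq> {s \<in> I - {i}. cproj (X s) y \<noteq> 0}"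
        using t cpY[OF t(1)] by (metis (mono_tags, lifting) Diff_iff mem_Collect_eq singletonD)
    qed
    then have lt: "card {s \<in> I - {i}. cproj (Y s) y \<noteq> 0} < card {s \<in> I - {i}. cproj (X s) y \<noteq> 0}"
      using finite_I by (intro psubset_card_mono) auto
    have "c + q \<noteq> 0"
    proof
      assume "c + q = 0"
      then have "cinner q (c + q) = 0" by simp
      then show False using D_orth[OF X t(2) q(1) c] q by (simp add: cinner_add_right)
    qed
    then have "cproj (Y i) y \<noteq> 0" using cpY[OF i(1)] by (simp add: y'_def)
    have oJ: "cinner z y = 0" if "s \<in> J" "z \<in> Y s" for s z
      using less.prems(2)[OF that(1), of z] that other[of s] tJ i by metis
    have "\<exists>Z. reach J Y Z \<and> K \<subseteq> Z i \<and> y \<in> Z i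
      \<and> (\<forall>m v. m \<noteq> i \<longrightarrow> v \<in> Y m \<longrightarrow> cinner v y = 0 \<longrightarrow> v \<in> Z m)"
    proof (rule less.hyps[OF lt YD oJ])
      show "k \<in> Y i \<and> cinner k y = 0" if "k \<in> K" for k using less.prems(3) Y(3) that by blast
    qed (use \<open>cproj (Y i) y \<noteq> 0\<close> in auto)
    then obtain Z where Z: "reach J Y Z" "K \<subseteq> Z i" "y \<in> Z i"
      and keepZ: "\<And>m v. m \<noteq> i \<Longrightarrow> v \<in> Y m \<Longrightarrow> cinner v y = 0 \<Longrightarrow> v \<in> Z m"
      by blast
    have "v \<in> Z m" if v: "m \<noteq> i" "v \<in> X m" "cinner v y = 0" for m v
    proof -
      have "cinner v q = 0"
        using D_orth[OF X _ v(2) q(1)] cproj_cinner[OF X t(1), of v y] v by (cases "m = t") (auto simp: q_def)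
      then show ?thesis using keep keepZ v by blast
    qed
    moreover have "reach J X Y"
      using step_adj[OF Y(1)] other tJ i by (intro reach_step) metis+
    ultimately show ?thesis using Z reach_trans by blast
  qed
qed

text \<open>An orthogonal basis of \<open>K\<close> is inserted vector by vector; as long as slot
  \<open>i\<close> is larger than the part already placed, it has a vector orthogonal to that
  part.\<close>

lemma reach_subspace:
  assumes X: "X \<in> D" and i: "i \<in> I" "i \<notin> J" and K: "dimn k K" "enat k \<le> n i"
    and orth: "\<And>t z v. t \<in> J \<Longrightarrow> z \<in> X t \<Longrightarrow> v \<in> K \<Longrightarrow> cinner z v = 0"
  shows "\<exists>Y. reach J X Y \<and> K \<subseteq> Y i"
  using K orth
proof (induction k arbitrary: K)
  case 0
  then have "K = {0}" by (simp add: dimn_0_iff)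
  then show ?case using reach_refl D_0[OF X] by blast
next
  case (Suc k)
  obtain K' y where K': "dimn k K'" "K' \<subseteq> K" "y \<noteq> 0" "y \<in> K" "K = cspan (insert y K')"
      "\<forall>x\<in>K'. cinner x y = 0"
    using dimn_Suc_split[OF Suc.prems(1)] by metis
  have "enat k \<le> n i" using Suc.prems(2) by (cases "n i") auto
  then obtain Y where Y: "reach J X Y" "K' \<subseteq> Y i"
    using Suc.IH[OF K'(1)] Suc.prems(3) K'(2) by blast
  note YD = reach_D[OF Y(1) X]
  have "\<not> Y i \<subseteq> K'"
  proof
    assume "Y i \<subseteq> K'"
    then obtain l where l: "l \<le> k" "dimn l (Y i)" using dimn_sub[OF K'(1) D_sub[OF YD]] by blast
    then have "n i = enat l" using D_cdim[OF YD i(1)] dimn_iff_cdim[OF D_sub[OF YD]] by metis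
    then show False using Suc.prems(2) l by simp
  qed
  then obtain x where x: "x \<in> Y i" "x \<notin> K'" by blast
  obtain v where v: "v \<in> K'" "\<forall>u\<in>K'. cinner u (x - v) = 0" using dimn_orth_proj[OF K'(1)] by blast
  have "x - v \<in> Y i" using x v Y D_diff[OF YD] by blast
  moreover have "x - v \<noteq> 0" using x v by auto
  ultimately have p: "\<exists>p\<in>Y i. p \<noteq> 0 \<and> (\<forall>k\<in>K'. cinner k p = 0)" using v by blast
  have oy: "cinner z y = 0" if "t \<in> J" "z \<in> Y t" for t z
    using Suc.prems(3)[of t z y] that K'(4) reach_agree[OF Y(1)] by simp
  have "\<exists>Z. reach J Y Z \<and> K' \<subseteq> Z i \<and> y \<in> Z i
      \<and> (\<forall>m v. m \<noteq> i \<longrightarrow> v \<in> Y m \<longrightarrow> cinner v y = 0 \<longrightarrow> v \<in> Z m)"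
    by (rule reach_vector[OF YD i]) (use oy Y(2) K'(6) p in auto)
  then obtain Z where Z: "reach J Y Z" "K' \<subseteq> Z i" "y \<in> Z i" by blast
  have "K \<subseteq> Z i" unfolding K'(5)
    using Z D_sub[OF reach_D[OF Z(1) YD]] by (intro complex_vector.span_minimal) auto
  then show ?case using reach_trans[OF Y(1) Z(1)] by blast
qed

lemma reach_equal:
  assumes X: "X \<in> D" and i: "i \<in> I" "i \<notin> J" and K: "dimn k K" "n i = enat k"
    and orth: "\<And>t z v. t \<in> J \<Longrightarrow> z \<in> X t \<Longrightarrow> v \<in> K \<Longrightarrow> cinner z v = 0"
  shows "\<exists>Y. reach J X Y \<and> Y i = K"
proof -
  have "\<exists>Y. reach J X Y \<and> K \<subseteq> Y i"
    by (rule reach_subspace[OF X i K(1)]) (use K(2) orth in auto)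
  then obtain Y where Y: "reach J X Y" "K \<subseteq> Y i" by blast
  then have "Y i = K" using dimn_eq[OF D_dimn[OF reach_D[OF Y(1) X] i(1) K(2)] K(1)] by simp
  then show ?thesis using Y by blast
qed

text \<open>Finite slots are matched one at a time. At most one slot is left, the infinite one, and
  the others determine it.\<close>

lemma agree_reach:
  assumes "X \<in> D" and Y: "Y \<in> D" and "\<And>t. t \<in> J \<Longrightarrow> X t = Y t"
  shows "reach J X Y"
  using assms(1,3)
proof (induction "card (I - J)" arbitrary: J X rule: less_induct)
  case less
  note X = less.prems(1)
  show ?case
  proof (cases "\<exists>i\<in>I - J. n i \<noteq> \<infinity>")
    case True
    then obtain i k where i: "i \<in> I" "i \<notin> J" and k: "n i = enat k" by auto
    have "cinner z v = 0" if "t \<in> J" "z \<in> X t" "v \<in> Y i" for t z v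
      using that less.prems(2) D_orth[OF Y, of t i z v] i by auto
    then obtain X' where X': "reach J X X'" "X' i = Y i"
      using reach_equal[OF X i D_dimn[OF Y i(1) k] k] by blast
    have "I - insert i J \<subset> I - J" using i by blast
    then have "card (I - insert i J) < card (I - J)" using finite_I by (intro psubset_card_mono) auto
    then have "reach (insert i J) X' Y"
      using less.hyps reach_D[OF X'(1) X] X'(2) reach_agree[OF X'(1)] less.prems(2) by (metis insert_iff)
    then show ?thesis using reach_trans[OF X'(1)] reach_mono by blast
  next
    case False
    have "X = Y"
    proof (cases "I - J = {}")
      case True
      then show ?thesis using less.prems(2) by (intro D_eqI[OF X Y]) auto
    next
      case False': False
      then obtain i where i: "i \<in> I - J" by blast
      have "t \<in> J" if "t \<in> I" "t \<noteq> i" for t using False one_inf[of t i] that i by blast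
      then show ?thesis using less.prems(2) by (intro D_eqI[OF X Y, where k = i]) auto
    qed
    then show ?thesis using reach_refl by blast
  qed
qed

end

subsection \<open>Permutations of pairs\<close>

lemma pairs_union_3:
  assumes "card S = 2" "card S' = 2" "card (S \<union> S' \<union> T) = 3"
  shows "S \<inter> S' \<noteq> {}"
proof
  assume "S \<inter> S' = {}"
  moreover have fin: "finite S" "finite S'" using assms by (auto intro: card_ge_0_finite)
  ultimately have "card (S \<union> S') = 4" using assms by (simp add: card_Un_disjoint)
  moreover have "finite (S \<union> S' \<union> T)" using assms(3) by (intro card_ge_0_finite) simp
  ultimately show False using card_mono[of "S \<union> S' \<union> T" "S \<union> S'"] assms(3) by auto
qed

text \<open>Three distinct pairs have a union of size 3 exactly when they form a triangle. Pairs
  through \<open>i\<close> have pairwise meeting images. Pairwise meeting pairs without a common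
  point form a triangle, which a star does not; so the images share a point, the value of \<delta>
  at \<open>i\<close>.\<close>

lemma pairs_permutation:
  fixes I :: "'i set" and \<phi> :: "'i set \<Rightarrow> 'i set"
  defines "P \<equiv> {S. S \<subseteq> I \<and> card S = 2}"
  assumes fin: "finite I" and c3: "card I \<ge> 3"
    and map: "\<And>S. S \<in> P \<Longrightarrow> \<phi> S \<in> P" and inj: "inj_on \<phi> P"
    and tri: "\<And>S S' T. S \<in> P \<Longrightarrow> S' \<in> P \<Longrightarrow> T \<in> P \<Longrightarrow> S \<noteq> S' \<Longrightarrow> S \<noteq> T \<Longrightarrow> S' \<noteq> T \<Longrightarrow>
      card (S \<union> S' \<union> T) = 3 \<longleftrightarrow> card (\<phi> S \<union> \<phi> S' \<union> \<phi> T) = 3"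
  shows "\<exists>\<delta>. \<delta> permutes I \<and> (\<forall>S\<in>P. \<phi> S = \<delta> ` S)"
proof -
  have third: "\<exists>k. k \<in> I \<and> k \<noteq> i \<and> k \<noteq> j" for i j
  proof -
    have "card {i, j} < card I" using c3 card_insert_le_m1[of 2 "{j}" i] by simp
    then show ?thesis
      by (metis card_mono finite.emptyI finite_insert insertCI linorder_not_less subsetI)
  qed
  have PI: "{i, j} \<in> P" if "i \<in> I" "j \<in> I" "i \<noteq> j" for i j using that by (auto simp: P_def)
  have c2: "card (\<phi> S) = 2" if "S \<in> P" for S using map[OF that] by (simp add: P_def)
  have ne: "\<phi> S \<noteq> \<phi> T" if "S \<in> P" "T \<in> P" "S \<noteq> T" for S T using inj that by (auto dest: inj_onD)
  have tri3: "card (\<phi> {i, j} \<union> \<phi> {i, k} \<union> \<phi> {j, k}) = 3"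
    if "i \<in> I" "j \<in> I" "k \<in> I" "i \<noteq> j" "i \<noteq> k" "j \<noteq> k" for i j k
  proof -
    have "{i, j} \<union> {i, k} \<union> {j, k} = {i, j, k}" by auto
    then have "card ({i, j} \<union> {i, k} \<union> {j, k}) = 3" using that by simp
    then show ?thesis
      using tri[of "{i, j}" "{i, k}" "{j, k}"] PI that by (simp add: doubleton_eq_iff)
  qed
  have meet: "\<phi> {i, j} \<inter> \<phi> {i, k} \<noteq> {}" if "i \<in> I" "j \<in> I" "k \<in> I" "i \<noteq> j" "i \<noteq> k" "j \<noteq> k" for i j k
    using pairs_union_3[OF c2 c2 tri3[OF that]] PI that by blast
  have "\<exists>x. \<forall>j\<in>I - {i}. x \<in> \<phi> {i, j}" if i: "i \<in> I" for i
  proof -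
    obtain j where j: "j \<in> I" "j \<noteq> i" using third by blast
    obtain k where k: "k \<in> I" "k \<noteq> i" "k \<noteq> j" using third by blast
    obtain x where x: "x \<in> \<phi> {i, j}" "x \<in> \<phi> {i, k}" using meet[of i j k] i j k by blast
    obtain y where y: "\<phi> {i, j} = {x, y}" "x \<noteq> y"
      using two_set_other[OF c2[OF PI[OF i j(1) not_sym[OF j(2)]]] x(1)] by metis
    obtain z where z: "\<phi> {i, k} = {x, z}" "x \<noteq> z"
      using two_set_other[OF c2[OF PI[OF i k(1) not_sym[OF k(2)]]] x(2)] by metis
    have "{i, j} \<noteq> {i, k}" using k by (auto simp: doubleton_eq_iff)
    then have "\<phi> {i, j} \<noteq> \<phi> {i, k}" using ne PI i j k by metis
    then have yz: "y \<noteq> z" using y z by auto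
    have "x \<in> \<phi> {i, l}" if l: "l \<in> I - {i}" for l
    proof (cases "l = j \<or> l = k")
      case False
      show ?thesis
      proof (rule ccontr)
        assume nx: "x \<notin> \<phi> {i, l}"
        have "\<phi> {i, l} \<inter> \<phi> {i, j} \<noteq> {}" "\<phi> {i, l} \<inter> \<phi> {i, k} \<noteq> {}"
          using meet[of i l j] meet[of i l k] i j k l False by auto
        then have "y \<in> \<phi> {i, l}" "z \<in> \<phi> {i, l}" using nx y z by auto
        moreover have "card (\<phi> {i, l}) = 2" using c2[of "{i, l}"] PI[of i l] i l by auto
        ultimately have "\<phi> {i, l} = {y, z}" using yz by (auto simp: card_2_iff)
        then have "\<phi> {i, j} \<union> \<phi> {i, k} \<union> \<phi> {i, l} = {x, y, z}" using y z by auto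
        then have "card (\<phi> {i, j} \<union> \<phi> {i, k} \<union> \<phi> {i, l}) = 3" using y z yz by simp
        then have "card ({i, j} \<union> {i, k} \<union> {i, l}) = 3"
          using tri[of "{i, j}" "{i, k}" "{i, l}"] PI i j k l False by (auto simp: doubleton_eq_iff)
        moreover have "{i, j} \<union> {i, k} \<union> {i, l} = {i, j, k, l}" by auto
        ultimately show False using i j k l False by (simp add: card_insert_if)
      qed
    qed (use x in auto)
    then show ?thesis by blast
  qed
  then obtain \<delta>0 where \<delta>0: "\<And>i j. i \<in> I \<Longrightarrow> j \<in> I \<Longrightarrow> j \<noteq> i \<Longrightarrow> \<delta>0 i \<in> \<phi> {i, j}"
    by (metis DiffI singletonD)
  define \<delta> where "\<delta> i = (if i \<in> I then \<delta>0 i else i)" for i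
  have \<delta>: "\<delta> i \<in> \<phi> {i, j}" if "i \<in> I" "j \<in> I" "j \<noteq> i" for i j
    using \<delta>0 that by (simp add: \<delta>_def)
  have \<delta>I: "\<delta> i \<in> I" if i: "i \<in> I" for i
  proof -
    obtain j where j: "j \<in> I" "j \<noteq> i" using third by blast
    then show ?thesis using \<delta>[OF i j] map[OF PI[OF i j(1)]] by (auto simp: P_def)
  qed
  \<comment> \<open>Were two values equal, the images of a triangle would form a star on four
    points.\<close>
  have \<delta>inj: "inj_on \<delta> I"
  proof (rule inj_onI, rule ccontr)
    fix i i' assume i: "i \<in> I" "i' \<in> I" "\<delta> i = \<delta> i'" "i \<noteq> i'"
    obtain k where k: "k \<in> I" "k \<noteq> i" "k \<noteq> i'" using third by blast
    define x where "x = \<delta> i"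
    have x: "x \<in> \<phi> {i, i'}" "x \<in> \<phi> {i, k}" "x \<in> \<phi> {i', k}"
      using \<delta>[of i i'] \<delta>[of i k] \<delta>[of i' k] i k by (auto simp: x_def)
    have P3: "{i, i'} \<in> P" "{i, k} \<in> P" "{i', k} \<in> P" using PI i k by auto
    obtain a where a: "\<phi> {i, i'} = {x, a}" "x \<noteq> a"
      using two_set_other[OF c2[OF P3(1)] x(1)] by metis
    obtain b where b: "\<phi> {i, k} = {x, b}" "x \<noteq> b"
      using two_set_other[OF c2[OF P3(2)] x(2)] by metis
    obtain c where c: "\<phi> {i', k} = {x, c}" "x \<noteq> c"
      using two_set_other[OF c2[OF P3(3)] x(3)] by metis
    have "a \<noteq> b" "a \<noteq> c" "b \<noteq> c"
      using ne[OF P3(1,2)] ne[OF P3(1,3)] ne[OF P3(2,3)] a b c i k by (auto simp: doubleton_eq_iff)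
    moreover have "\<phi> {i, i'} \<union> \<phi> {i, k} \<union> \<phi> {i', k} = {x, a, b, c}" using a b c by auto
    ultimately have "card (\<phi> {i, i'} \<union> \<phi> {i, k} \<union> \<phi> {i', k}) = 4" using a b c by (simp add: card_insert_if)
    then show False using tri3[of i i' k] i k by simp
  qed
  have "bij_betw \<delta> I I"
    using endo_inj_surj[OF fin _ \<delta>inj] \<delta>inj \<delta>I by (auto simp: bij_betw_def)
  then have "\<delta> permutes I" by (rule bij_imp_permutes) (simp add: \<delta>_def)
  moreover have "\<phi> S = \<delta> ` S" if S: "S \<in> P" for S
  proof -
    obtain i j where ij: "S = {i, j}" "i \<noteq> j" "i \<in> I" "j \<in> I" using S by (auto simp: P_def card_2_iff)
    have "\<delta> i \<in> \<phi> S" "\<delta> j \<in> \<phi> S" using \<delta>[of i j] \<delta>[of j i] ij by (auto simp: insert_commute)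
    moreover have "\<delta> i \<noteq> \<delta> j" using \<delta>inj ij by (auto dest: inj_onD)
    ultimately show ?thesis using c2[OF S] ij(1) by (auto simp: card_2_iff)
  qed
  ultimately show ?thesis by blast
qed

section \<open>Triangles of types and frames with prescribed slots\<close>

context frames
begin

lemma edge_exists:
  assumes X: "X \<in> D" and S: "S \<subseteq> I" "card S = 2"
  shows "\<exists>Y. adj X Y \<and> diffs X Y = S"
proof -
  obtain i j where ij: "S = {i, j}" "i \<noteq> j" using S by (auto simp: card_2_iff)
  have I: "i \<in> I" "j \<in> I" using S ij by auto
  obtain x where x: "x \<in> X i" "x \<noteq> 0" using D_ex[OF X I(1)] by blast
  obtain y where y: "y \<in> X j" "y \<noteq> 0" using D_ex[OF X I(2)] by blast
  have "step i j X (act (x + y) X)" by (rule stepI[OF X I ij(2) x(1) y(1) x(2) y(2)])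
  then show ?thesis using step_adj step_diffs ij by blast
qed

text \<open>A 4-cycle with types S, S', S, T, modelled on the relation (ij)(ik)(ij) = (jk) of
  transpositions. The type argument records the Hilbert space, whose frames occur only under
  quantifiers.\<close>

definition tri :: "'a::chilbert_space itself \<Rightarrow> 'i set \<Rightarrow> 'i set \<Rightarrow> 'i set \<Rightarrow> bool" where
  "tri _ S S' T \<longleftrightarrow> (\<exists>X B C (Y :: 'i \<Rightarrow> 'a set). adj X B \<and> adj B C \<and> adj C Y \<and> adj X Y
    \<and> diffs X B = S \<and> diffs B C = S' \<and> diffs C Y = S \<and> diffs X Y = T)"

text \<open>Outside \<open>S\<close> only the edges of types \<open>S'\<close> and \<open>T\<close>
  make changes, so these types agree there: each consists of a common \<open>k\<close> and one
  element of \<open>S\<close>.\<close>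

lemma tri_card:
  assumes "tri TYPE('a::chilbert_space) S S' T" and ne: "S \<noteq> S'" "S \<noteq> T" "S' \<noteq> T"
  shows "card (S \<union> S' \<union> T) = 3"
proof -
  obtain X B C and Y :: "'i \<Rightarrow> 'a set" where a: "adj X B" "adj B C" "adj C Y" "adj X Y"
    and d: "diffs X B = S" "diffs B C = S'" "diffs C Y = S" "diffs X Y = T"
    using assms(1) unfolding tri_def by blast
  have c: "card S = 2" "card S' = 2" "card T = 2" using adj_card a d by metis+
  have 1: "t \<in> S'" if "t \<in> T" "t \<notin> S" for t using that d by (auto simp: diffs_def)
  have 2: "t \<in> T" if "t \<in> S'" "t \<notin> S" for t using that d by (auto simp: diffs_def)
  obtain k where k: "k \<in> T" "k \<notin> S" using two_set_subset[OF c(3,1)] ne by blast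
  obtain a where a: "a \<in> T" "a \<in> S" using 1 two_set_subset[OF c(3,2)] ne by blast
  obtain b where b: "b \<in> S'" "b \<in> S" using 2 two_set_subset[OF c(2,3)] ne by blast
  have T: "T = {a, k}" using two_set_two[OF c(3) a(1) k(1)] a k by blast
  have S': "S' = {b, k}" using two_set_two[OF c(2) b(1) 1[OF k]] b k by blast
  have "a \<noteq> b" using T S' ne by blast
  then have "S = {a, b}" using two_set_two[OF c(1) a(2) b(2)] by blast
  then have "S \<union> S' \<union> T = {a, b, k}" using T S' by auto
  moreover have "k \<noteq> a" "k \<noteq> b" using a b k by auto
  ultimately show ?thesis using \<open>a \<noteq> b\<close> by simp
qed

text \<open>Exchanging unit vectors \<open>p\<close>, \<open>q\<close>, \<open>r\<close> taken from
  three slots realises the relation of transpositions behind \<open>tri\<close>.\<close>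

lemma card_tri:
  assumes ne: "(D :: ('i \<Rightarrow> 'a::chilbert_space set) set) \<noteq> {}"
    and P: "S \<subseteq> I" "S' \<subseteq> I" "T \<subseteq> I" and c: "card S = 2" "card S' = 2" "card T = 2"
    and d: "S \<noteq> S'" "S \<noteq> T" "S' \<noteq> T" and c3: "card (S \<union> S' \<union> T) = 3"
  shows "tri TYPE('a) S S' T"
proof -
  obtain X :: "'i \<Rightarrow> 'a set" where X: "X \<in> D" using ne by blast
  obtain i where i: "i \<in> S" "i \<in> S'" using pairs_union_3[OF c(1,2) c3] by blast
  obtain j where j: "j \<noteq> i" "S = {i, j}" using two_set_other[OF c(1) i(1)] by blast
  obtain k where k: "k \<noteq> i" "S' = {i, k}" using two_set_other[OF c(2) i(2)] by blast
  have jk: "j \<noteq> k" using j k d by blast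
  have SS: "S \<union> S' = {i, j, k}" using j k by auto
  have "card (S \<union> S') = 3" using SS j k jk by simp
  then have "S \<union> S' \<union> T = S \<union> S'"
    using c3 by (metis card_ge_0_finite card_subset_eq sup_ge1 zero_less_numeral)
  then have "T \<subseteq> {i, j, k}" using SS by blast
  moreover have "i \<notin> T"
  proof
    assume "i \<in> T"
    then obtain l where "l \<noteq> i" "T = {i, l}" using two_set_other[OF c(3)] by blast
    then show False using \<open>T \<subseteq> {i, j, k}\<close> d j k by auto
  qed
  ultimately have T: "T = {j, k}" using two_set_subset[OF c(3), of "{j, k}"] jk by auto
  have I: "i \<in> I" "j \<in> I" "k \<in> I" using P j k by auto
  obtain p where p: "p \<in> X i" "norm p = 1" using D_ex_unit[OF X I(1)] by blast
  obtain q where q: "q \<in> X j" "norm q = 1" using D_ex_unit[OF X I(2)] by blast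
  obtain r where r: "r \<in> X k" "norm r = 1" using D_ex_unit[OF X I(3)] by blast
  have nz: "p \<noteq> 0" "q \<noteq> 0" "r \<noteq> 0" "- q \<noteq> 0" "- r \<noteq> 0" "- p \<noteq> 0" using p q r by auto
  have neg: "- z \<in> Z t" if "Z \<in> D" "z \<in> Z t" for z t and Z :: "'i \<Rightarrow> 'a set"
    using D_neg[OF that(1) that(2)] .
  have o: "cinner p q = 0" "cinner q p = 0" "cinner p r = 0" "cinner r p = 0" "cinner q r = 0" "cinner r q = 0"
    using D_orth[OF X _ p(1) q(1)] D_orth[OF X _ q(1) p(1)] D_orth[OF X _ p(1) r(1)]
      D_orth[OF X _ r(1) p(1)] D_orth[OF X _ q(1) r(1)] D_orth[OF X _ r(1) q(1)] j k jk by auto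
  define B where "B = act (p - q) X"
  define C where "C = act (q - r) B"
  define Y where "Y = act (q - r) X"
  have ex: "refl_at (p - q) p = q" "refl_at (q - r) q = r"
    using refl_at_exchange_orth[of p q] refl_at_exchange_orth[of q r] o p q r nz by auto
  have fx: "refl_at (p - q) r = r" "refl_at (q - r) p = p"
    using o by (auto intro!: refl_at_orth simp: cinner_diff_left)
  have XB: "step i j X B" unfolding B_def
    using stepI[OF X I(1,2) not_sym[OF j(1)] p(1) neg[OF X q(1)]] nz by simp
  note BD = step_D[OF XB]
  have XY: "step j k X Y" unfolding Y_def
    using stepI[OF X I(2,3) jk q(1) neg[OF X r(1)]] nz by simp
  have qB: "q \<in> B i" "r \<in> B k" "p \<in> B j"
    using p q r ex fx refl_at_invol[of "p - q" p] by (auto simp: B_def act_def refl_at_image_iff)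
  have BC: "step i k B C" unfolding C_def
    using stepI[OF BD I(1,3) not_sym[OF k(1)] qB(1) neg[OF BD qB(2)]] nz by simp
  note CD = step_D[OF BC]
  have rC: "r \<in> C i" "p \<in> C j"
    using qB ex fx refl_at_invol[of "q - r" q] by (auto simp: C_def act_def refl_at_image_iff)
  have "refl_at (q - r) (p - q) = p - r" by (simp add: refl_at_diff ex fx)
  then have "C = act (p - r) Y" unfolding C_def B_def Y_def by (metis act_conj)
  then have "act (p - r) C = Y" by simp
  moreover have "act (r - p) = act (p - r)"
    using refl_at_uminus[of "p - r"] by (intro ext) (simp add: act_def)
  moreover have "step i j C (act (r + - p) C)"
    by (rule stepI[OF CD I(1,2) not_sym[OF j(1)] rC(1) neg[OF CD rC(2)] nz(3,6)])
  ultimately have CY: "step i j C Y" by (metis diff_conv_add_uminus)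
  show ?thesis unfolding tri_def
    using step_adj[OF XB] step_adj[OF BC] step_adj[OF CY] step_adj[OF XY]
      step_diffs[OF XB] step_diffs[OF BC] step_diffs[OF CY] step_diffs[OF XY] j k T by metis
qed

lemma fibre_step:
  assumes G: "\<And>X Y. adj X Y \<Longrightarrow> diffs (G X) (G Y) = \<gamma> ` diffs X Y" and inj: "inj \<gamma>"
    and X: "X \<in> D" and Y: "Y \<in> D" and eq: "X i = Y i"
  shows "G X (\<gamma> i) = G Y (\<gamma> i)"
proof -
  have "reach {i} X Y" by (rule agree_reach[OF X Y]) (use eq in simp)
  then show ?thesis unfolding reach_def
  proof (induction rule: rtranclp_induct)
    case (step Y Z)
    then have "\<gamma> i \<notin> diffs (G Y) (G Z)"
      using G[of Y Z] inj by (auto simp: diffs_def dest: injD)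
    then show ?case using step.IH by (simp add: diffs_def)
  qed simp
qed

text \<open>\<open>reach_equal\<close> fills only a finite slot. If \<open>j\<close> is infinite, it
  is slot \<open>i\<close> that is moved, in a frame that already has \<open>Y j\<close>.\<close>

lemma frame_through_pair:
  assumes X: "X \<in> D" and Y: "Y \<in> D" and ij: "i \<in> I" "j \<in> I" "i \<noteq> j" and o: "corthogonal (X i) (Y j)"
  shows "\<exists>Z\<in>D. Z i = X i \<and> Z j = Y j"
proof (cases "n j = \<infinity>")
  case False
  then obtain k where k: "n j = enat k" by auto
  have "\<exists>Z. reach {i} X Z \<and> Z j = Y j"
    by (rule reach_equal[OF X ij(2) _ D_dimn[OF Y ij(2) k] k]) (use o ij in \<open>auto simp: corthogonal_def\<close>)
  then obtain Z where Z: "reach {i} X Z" "Z j = Y j" by blast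
  then show ?thesis using reach_D[OF Z(1) X] reach_agree[OF Z(1), of i] by auto
next
  case True
  then obtain k where k: "n i = enat k" using one_inf[OF ij(1,2)] ij(3) by (cases "n i") auto
  have "\<exists>Z. reach {j} Y Z \<and> Z i = X i"
    by (rule reach_equal[OF Y ij(1) _ D_dimn[OF X ij(1) k] k])
      (use o ij cinner_eq_0_commute in \<open>auto simp: corthogonal_def\<close>)
  then obtain Z where Z: "reach {j} Y Z" "Z i = X i" by blast
  then show ?thesis using reach_D[OF Z(1) Y] reach_agree[OF Z(1), of j] by auto
qed

text \<open>For finite \<open>n i\<close>, once frames exist, this is the whole Grassmannian of that
  dimension (\<open>slot_finite\<close>).\<close>

definition slot :: "'i \<Rightarrow> 'a::chilbert_space set set" where
  "slot i = (\<lambda>X. X i) ` D"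

lemma slot_pair:
  assumes "V \<in> slot i" "W \<in> slot j" "i \<in> I" "j \<in> I" "i \<noteq> j" "corthogonal V W"
  shows "\<exists>X\<in>D. X i = V \<and> X j = W"
  using assms frame_through_pair[of _ _ i j] unfolding slot_def by blast

end

section \<open>The permutations of types and of indices induced by an automorphism\<close>

locale frame_automorphism = frames I n for I :: "'i set" and n :: "'i \<Rightarrow> enat" +
  fixes F F' :: "('i \<Rightarrow> 'a::chilbert_space set) \<Rightarrow> ('i \<Rightarrow> 'a set)"
  assumes card_I: "card I \<ge> 3" and D_nonempty: "(D :: ('i \<Rightarrow> 'a set) set) \<noteq> {}"
    and F_D: "X \<in> D \<Longrightarrow> F X \<in> D" and F'_D: "X \<in> D \<Longrightarrow> F' X \<in> D"
    and F'_F: "X \<in> D \<Longrightarrow> F' (F X) = X" and F_F': "X \<in> D \<Longrightarrow> F (F' X) = X"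
    and F_adj: "X \<in> D \<Longrightarrow> Y \<in> D \<Longrightarrow> adj (F X) (F Y) \<longleftrightarrow> adj X Y"
begin

text \<open>Allows every preservation result to be applied to the inverse map, which turns
  implications into equivalences.\<close>

lemma inverse: "frame_automorphism I n F' F"
proof
  show "adj (F' X) (F' Y) \<longleftrightarrow> adj X Y" if "X \<in> D" "Y \<in> D" for X Y
    using F_adj[of "F' X" "F' Y"] F'_D F_F' that by simp
qed (use card_I D_nonempty F_D F'_D F'_F F_F' in auto)

lemma adj_F: "adj X Y \<Longrightarrow> adj (F X) (F Y)"
  using F_adj adj_D by blast

lemma linked_F: "adj X Y \<Longrightarrow> adj X Z \<Longrightarrow> linked X Y Z \<Longrightarrow> linked (F X) (F Y) (F Z)"
  unfolding linked_def using adj_F by blast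

lemma same_type_F:
  assumes "adj X Y" "adj X Z"
  shows "diffs (F X) (F Y) = diffs (F X) (F Z) \<longleftrightarrow> diffs X Y = diffs X Z"
proof
  assume "diffs X Y = diffs X Z"
  then have "linked X Y Z" using linked_iff assms by blast
  then have "linked (F X) (F Y) (F Z)" using linked_F assms by blast
  then show "diffs (F X) (F Y) = diffs (F X) (F Z)" using linked_iff adj_F assms by blast
next
  interpret inv: frame_automorphism I n F' F by (rule inverse)
  assume "diffs (F X) (F Y) = diffs (F X) (F Z)"
  then have "linked (F X) (F Y) (F Z)" using linked_iff adj_F assms by blast
  then have "linked (F' (F X)) (F' (F Y)) (F' (F Z))" using inv.linked_F adj_F assms by blast
  then have "linked X Y Z" using F'_F adj_D[OF assms(1)] adj_D[OF assms(2)] by simp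
  then show "diffs X Y = diffs X Z" using linked_iff assms by blast
qed

lemma irregular_F:
  assumes XY: "adj X Y" and "irregular X Y" shows "irregular (F X) (F Y)"
proof -
  obtain C E E' where a: "adj X C" "adj Y E" "adj Y E'" "adj C E" "adj C E'"
    and d: "diffs X C \<noteq> diffs X Y" "diffs Y E \<noteq> diffs Y X" "diffs Y E' \<noteq> diffs Y X" "diffs Y E \<noteq> diffs Y E'"
    using assms(2) unfolding irregular_def by blast
  have d': "diffs (F X) (F C) \<noteq> diffs (F X) (F Y)" "diffs (F Y) (F E) \<noteq> diffs (F Y) (F X)"
    "diffs (F Y) (F E') \<noteq> diffs (F Y) (F X)" "diffs (F Y) (F E) \<noteq> diffs (F Y) (F E')"
    using d same_type_F[OF a(1) XY] same_type_F[OF a(2) adj_sym[OF XY]]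
      same_type_F[OF a(3) adj_sym[OF XY]] same_type_F[OF a(2,3)] by blast+
  show ?thesis unfolding irregular_def
    using d' a(1-5)[THEN adj_F] by blast
qed

text \<open>The ingredients of \<open>irregular\<close> are adjacency and equality of types at a
  vertex. Both are preserved by the inverse, so an irregular image edge would come from an irregular
  edge.\<close>

lemma generic_F:
  assumes g: "generic X Y" shows "generic (F X) (F Y)"
proof (rule ccontr)
  interpret inv: frame_automorphism I n F' F by (rule inverse)
  assume "\<not> generic (F X) (F Y)"
  then have "irregular (F X) (F Y)" using not_generic_irregularular[OF adj_F[OF generic_adj[OF g]] _ card_I] by blast
  then have "irregular X Y"
    using inv.irregular_F[OF adj_F[OF generic_adj[OF g]]] F'_F adj_D[OF generic_adj[OF g]] by simp
  then show False using generic_not_irregular[OF g] by blast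
qed

text \<open>A type other than that of XY occurs on opposite sides of some square over XY. The image
  is a square over a generic edge, where \<open>square_types\<close> forces opposite types to
  agree.\<close>

lemma type_transport_generic:
  assumes g: "generic X Y" and C: "adj X C" and E: "adj Y E" and eq: "diffs X C = diffs Y E"
  shows "diffs (F X) (F C) = diffs (F Y) (F E)"
proof -
  note XY = generic_adj[OF g]
  note YX = adj_sym[OF XY]
  show ?thesis
  proof (cases "diffs X C = diffs X Y")
    case True
    then have "diffs (F X) (F C) = diffs (F X) (F Y)" using same_type_F[OF C XY] by blast
    moreover have "diffs Y E = diffs Y X" using True eq diffs_commute[of X Y] by simp
    then have "diffs (F Y) (F E) = diffs (F Y) (F X)" using same_type_F[OF E YX] by blast
    ultimately show ?thesis using diffs_commute[of "F X" "F Y"] by simp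
  next
    case False
    obtain i j where s: "step i j X Y" using XY by (auto simp: adj_def)
    obtain k l where kl: "k \<in> I" "l \<in> I" "k \<noteq> l" "diffs X C = {k, l}" using adj_diffs[OF C] by blast
    have "{k, l} \<noteq> {i, j}" using False kl step_diffs[OF s] by simp
    then obtain Z W where ZW: "step k l X Z" "step k l Y W" "adj Z W"
      using square_exists[OF s kl(1-3)] by blast
    note XZ = step_adj[OF ZW(1)] and YW = step_adj[OF ZW(2)]
    have d: "diffs X Z = diffs X C" "diffs Y W = diffs Y E"
      using step_diffs[OF ZW(1)] step_diffs[OF ZW(2)] kl eq by auto
    have ne: "diffs X Z \<noteq> diffs X Y" "diffs Y W \<noteq> diffs Y X"
      using d False eq diffs_commute[of X Y] by auto
    have "diffs (F X) (F Z) = diffs (F Y) (F W)"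
    proof (rule square_types[OF generic_F[OF g] adj_F[OF XZ] adj_F[OF YW] adj_F[OF ZW(3)]])
      show "diffs (F X) (F Z) \<noteq> diffs (F X) (F Y)" using same_type_F[OF XZ XY] ne by blast
      show "diffs (F Y) (F W) \<noteq> diffs (F X) (F Y)"
        using same_type_F[OF YW YX] ne diffs_commute[of "F X" "F Y"] by simp
    qed
    moreover have "diffs (F X) (F Z) = diffs (F X) (F C)" using same_type_F[OF XZ C] d by blast
    moreover have "diffs (F Y) (F W) = diffs (F Y) (F E)" using same_type_F[OF YW E] d by blast
    ultimately show ?thesis by simp
  qed
qed

lemma type_transport_adj:
  assumes XY: "adj X Y" and C: "adj X C" and E: "adj Y E" and eq: "diffs X C = diffs Y E"
  shows "diffs (F X) (F C) = diffs (F Y) (F E)"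
proof (cases "generic X Y")
  case False
  then obtain B where B: "generic X B" "generic B Y" using generic_or_via[OF XY] by blast
  have "B \<in> D" using adj_D generic_adj B by blast
  then obtain G where G: "adj B G" "diffs B G = diffs X C"
    using edge_exists[of B "diffs X C"] adj_card[OF C] adj_subset_I[OF C] by blast
  show ?thesis
    using type_transport_generic[OF B(1) C G(1)] type_transport_generic[OF B(2) G(1) E] G eq by simp
qed (use type_transport_generic assms in blast)

lemma type_transport:
  assumes C: "adj X C" and E: "adj Y E" and eq: "diffs X C = diffs Y E"
  shows "diffs (F X) (F C) = diffs (F Y) (F E)"
proof -
  have X: "X \<in> D" and Y: "Y \<in> D" using adj_D C E by blast+
  have "reach {} X Y" using agree_reach[OF X Y] by blast
  then show ?thesis using E eq unfolding reach_def
  proof (induction arbitrary: E rule: rtranclp_induct)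
    case base
    then show ?case using same_type_F[OF C] by blast
  next
    case (step Y Z)
    have "Y \<in> D" using step.hyps adj_D by blast
    then obtain G where G: "adj Y G" "diffs Y G = diffs X C"
      using edge_exists[of Y "diffs X C"] adj_card[OF C] adj_subset_I[OF C] by blast
    then show ?case using step.IH[OF G(1)] type_transport_adj[OF _ G(1) step.prems(1)] step by simp
  qed
qed

text \<open>\<open>type_transport\<close> makes the choice of the edge immaterial.\<close>

definition type_map :: "'i set \<Rightarrow> 'i set" where
  "type_map S = (SOME T. \<exists>X Y. adj X Y \<and> diffs X Y = S \<and> T = diffs (F X) (F Y))"

lemma type_map: "adj X Y \<Longrightarrow> type_map (diffs X Y) = diffs (F X) (F Y)"
proof -
  assume a: "adj X Y"
  have "\<exists>X' Y'. adj X' Y' \<and> diffs X' Y' = diffs X Y \<and> type_map (diffs X Y) = diffs (F X') (F Y')"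
    unfolding type_map_def by (rule someI) (use a in blast)
  then show ?thesis using type_transport[OF _ a] by metis
qed

lemma type_map_ex:
  assumes "S \<subseteq> I" "card S = 2"
  obtains X Y where "adj X Y" "diffs X Y = S" "type_map S = diffs (F X) (F Y)"
  using edge_exists[OF _ assms] D_nonempty type_map by (metis ex_in_conv)

lemma type_map_tri: "tri TYPE('a) S S' T \<Longrightarrow> tri TYPE('a) (type_map S) (type_map S') (type_map T)"
  unfolding tri_def using type_map adj_F by metis

lemma type_permutation: "\<exists>\<delta>. \<delta> permutes I \<and> (\<forall>X Y. adj X Y \<longrightarrow> diffs (F X) (F Y) = \<delta> ` diffs X Y)"
proof -
  interpret inv: frame_automorphism I n F' F by (rule inverse)
  let ?P = "{S. S \<subseteq> I \<and> card S = 2}"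
  have inv: "inv.type_map (type_map S) = S" if S: "S \<in> ?P" for S
  proof -
    obtain X Y where XY: "adj X Y" "diffs X Y = S" "type_map S = diffs (F X) (F Y)" using type_map_ex S by blast
    then show ?thesis using inv.type_map[OF adj_F[OF XY(1)]] F'_F adj_D[OF XY(1)] by simp
  qed
  have P: "type_map S \<in> ?P" if S: "S \<in> ?P" for S
  proof -
    obtain X Y where XY: "adj X Y" "diffs X Y = S" "type_map S = diffs (F X) (F Y)" using type_map_ex S by blast
    then show ?thesis using adj_card[OF adj_F[OF XY(1)]] adj_subset_I[OF adj_F[OF XY(1)]] by simp
  qed
  have inj: "inj_on type_map ?P" using inv by (rule inj_on_inverseI)
  have tri: "card (S \<union> S' \<union> T) = 3 \<longleftrightarrow> card (type_map S \<union> type_map S' \<union> type_map T) = 3"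
    if S: "S \<in> ?P" "S' \<in> ?P" "T \<in> ?P" "S \<noteq> S'" "S \<noteq> T" "S' \<noteq> T" for S S' T
  proof -
    have ne: "type_map S \<noteq> type_map S'" "type_map S \<noteq> type_map T" "type_map S' \<noteq> type_map T" using inv S by metis+
    show ?thesis
    proof
      assume "card (S \<union> S' \<union> T) = 3"
      then have "tri TYPE('a) S S' T" using card_tri[OF D_nonempty] S by blast
      then show "card (type_map S \<union> type_map S' \<union> type_map T) = 3" using tri_card type_map_tri ne by blast
    next
      assume "card (type_map S \<union> type_map S' \<union> type_map T) = 3"
      then have "tri TYPE('a) (type_map S) (type_map S') (type_map T)"
        using card_tri[OF D_nonempty] P[OF S(1)] P[OF S(2)] P[OF S(3)] ne by blast
      then have "tri TYPE('a) S S' T" using inv.type_map_tri inv S(1-3) by metis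
      then show "card (S \<union> S' \<union> T) = 3" using tri_card S by blast
    qed
  qed
  have "\<exists>\<delta>. \<delta> permutes I \<and> (\<forall>S\<in>?P. type_map S = \<delta> ` S)"
    by (rule pairs_permutation[OF finite_I card_I P inj tri])
  then obtain \<delta> where \<delta>: "\<delta> permutes I \<and> (\<forall>S\<in>?P. type_map S = \<delta> ` S)" by (rule exE)
  have "diffs (F X) (F Y) = \<delta> ` diffs X Y" if "adj X Y" for X Y
    using type_map[OF that] \<delta>[THEN conjunct2, rule_format, of "diffs X Y"] adj_card[OF that] adj_subset_I[OF that] by simp
  then show ?thesis using \<delta> by blast
qed

lemma slot_maps:
  "\<exists>\<delta> g. \<delta> permutes I \<and> (\<forall>X\<in>D. \<forall>i\<in>I. F X (\<delta> i) = g i (X i)) \<and>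
    (\<forall>i\<in>I. bij_betw (g i) (slot i) (slot (\<delta> i))) \<and>
    (\<forall>i\<in>I. \<forall>j\<in>I. \<forall>V\<in>slot i. \<forall>W\<in>slot j. i \<noteq> j \<longrightarrow> corthogonal V W \<longleftrightarrow> corthogonal (g i V) (g j W))"
proof -
  obtain \<delta> where perm: "\<delta> permutes I" and \<delta>: "\<And>X Y. adj X Y \<Longrightarrow> diffs (F X) (F Y) = \<delta> ` diffs X Y"
    using type_permutation by blast
  have inj: "inj \<delta>" using permutes_inj[OF perm] .
  have \<delta>I: "\<delta> i \<in> I \<longleftrightarrow> i \<in> I" for i by (rule permutes_in_image[OF perm])
  have \<delta>': "diffs (F' X) (F' Y) = inv \<delta> ` diffs X Y" if a: "adj X Y" for X Y
  proof -
    interpret inv: frame_automorphism I n F' F by (rule inverse)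
    have "diffs X Y = \<delta> ` diffs (F' X) (F' Y)"
      using \<delta>[OF inv.adj_F[OF a]] F_F' adj_D[OF a] by simp
    then show ?thesis using inj by (simp add: image_image)
  qed
  have fwd: "F X (\<delta> i) = F Y (\<delta> i)" if "X \<in> D" "Y \<in> D" "X i = Y i" for X Y i
    using fibre_step[of F \<delta>, OF \<delta> inj that] .
  have bwd: "X i = Y i" if "X \<in> D" "Y \<in> D" "F X (\<delta> i) = F Y (\<delta> i)" for X Y i
  proof -
    have "inj (inv \<delta>)" using permutes_inj[OF permutes_inv[OF perm]] .
    then have "F' (F X) (inv \<delta> (\<delta> i)) = F' (F Y) (inv \<delta> (\<delta> i))"
      using fibre_step[of F' "inv \<delta>", OF \<delta>'] F_D that by metis
    then show ?thesis using F'_F that inj by simp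
  qed
  \<comment> \<open>By \<open>fwd\<close>, any frame with the prescribed slot gives the same
    value.\<close>
  define g where "g i V = F (SOME X. X \<in> D \<and> X i = V) (\<delta> i)" for i V
  have g: "F X (\<delta> i) = g i (X i)" if X: "X \<in> D" for X i
  proof -
    define Y where "Y = (SOME Y. Y \<in> D \<and> Y i = X i)"
    have "Y \<in> D \<and> Y i = X i" unfolding Y_def by (rule someI[of _ X]) (use X in blast)
    then have "F X (\<delta> i) = F Y (\<delta> i)" using fwd[OF X, of Y i] by simp
    then show ?thesis by (simp add: g_def Y_def)
  qed
  have ginj: "V = V'" if "V \<in> slot i" "V' \<in> slot i" "g i V = g i V'" for i V V'
  proof -
    obtain X X' where "X \<in> D" "V = X i" "X' \<in> D" "V' = X' i"
      using \<open>V \<in> slot i\<close> \<open>V' \<in> slot i\<close> unfolding slot_def by blast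
    then show ?thesis using g[of X i] g[of X' i] bwd[of X X' i] that(3) by simp
  qed
  have gslot: "g i V \<in> slot (\<delta> i)" if "V \<in> slot i" for i V
  proof -
    obtain X where "X \<in> D" "V = X i" using \<open>V \<in> slot i\<close> unfolding slot_def by blast
    then show ?thesis using g[of X i] F_D[of X] unfolding slot_def by (auto intro: image_eqI[of _ _ "F X"])
  qed
  have gsurj: "\<exists>V\<in>slot i. g i V = W" if "W \<in> slot (\<delta> i)" for i W
  proof -
    obtain Y where "Y \<in> D" "W = Y (\<delta> i)" using \<open>W \<in> slot (\<delta> i)\<close> unfolding slot_def by blast
    then have "W = g i (F' Y i)" "F' Y i \<in> slot i" using g[OF F'_D] F_F' F'_D by (auto simp: slot_def)
    then show ?thesis by blast
  qed
  have bij: "bij_betw (g i) (slot i) (slot (\<delta> i))" for i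
    unfolding bij_betw_def inj_on_def using ginj gslot gsurj by blast
  \<comment> \<open>Subspaces from different slots are orthogonal exactly when one frame contains
    both (\<open>slot_pair\<close>), and frames are transported in both directions.\<close>
  have orth: "corthogonal V W \<longleftrightarrow> corthogonal (g i V) (g j W)"
    if ij: "i \<in> I" "j \<in> I" "i \<noteq> j" and V: "V \<in> slot i" and W: "W \<in> slot j" for i j V W
  proof
    assume "corthogonal V W"
    then obtain X where X: "X \<in> D" "X i = V" "X j = W" using slot_pair[OF V W ij] by blast
    have "\<delta> i \<noteq> \<delta> j" using ij inj by (auto dest: injD)
    then show "corthogonal (g i V) (g j W)"
      unfolding corthogonal_def using D_orth[OF F_D[OF X(1)], of "\<delta> i" "\<delta> j"] g[OF X(1)] X by auto
  next
    assume "corthogonal (g i V) (g j W)"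
    moreover have d: "\<delta> i \<in> I" "\<delta> j \<in> I" "\<delta> i \<noteq> \<delta> j" using ij inj \<delta>I by (auto dest: injD)
    ultimately obtain Y where Y: "Y \<in> D" "Y (\<delta> i) = g i V" "Y (\<delta> j) = g j W"
      using slot_pair[OF gslot[OF V] gslot[OF W] d] by blast
    define X where "X = F' Y"
    have X: "X \<in> D" using Y F'_D by (simp add: X_def)
    have "g i (X i) = g i V" "g j (X j) = g j W" using g[OF X] Y F_F' by (simp_all add: X_def)
    then have "X i = V" "X j = W" using ginj V W X unfolding slot_def by blast+
    then show "corthogonal V W" unfolding corthogonal_def using D_orth[OF X ij(3)] by blast
  qed
  show ?thesis by (intro exI[of _ \<delta>] exI[of _ g]) (use perm g bij orth in blast)
qed

end

subsection \<open>From subspaces to lines\<close>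

text \<open>A lower bound for the dimension of the whole space that holds vacuously in infinite
  dimension.\<close>

definition has_room :: "'a::chilbert_space itself \<Rightarrow> nat \<Rightarrow> bool" where
  "has_room _ k \<longleftrightarrow> (\<forall>l. dimn l (UNIV :: 'a set) \<longrightarrow> k \<le> l)"

lemma has_room_mono: "has_room TYPE('a::chilbert_space) k \<Longrightarrow> l \<le> k \<Longrightarrow> has_room TYPE('a) l"
  unfolding has_room_def by (meson order_trans)

lemma csubspace_UNIV: "csubspace UNIV"
  by (rule complex_vector.subspace_UNIV)

lemma dimn_UNIV_ex:
  assumes "dimn k (U :: 'a::chilbert_space set)" "has_room TYPE('a) (Suc k)"
  shows "\<exists>x. x \<notin> U"
proof (rule ccontr)
  assume "\<not> (\<exists>x. x \<notin> U)"
  then have "U = UNIV" by blast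
  then show False using assms unfolding has_room_def by force
qed

lemma dimn_cspan_finite: "finite B \<Longrightarrow> \<exists>k\<le>card B. dimn k (cspan B)"
proof -
  assume fin: "finite B"
  obtain C where C: "C \<subseteq> B" "\<not> cdependent C" "B \<subseteq> cspan C"
    using complex_vector.maximal_independent_subset[of B] by metis
  have "cspan B \<subseteq> cspan C"
    using C(3) by (intro complex_vector.span_minimal) auto
  then have "cspan B = cspan C" using complex_vector.span_mono[OF C(1)] by blast
  moreover have "finite C" "card C \<le> card B" using C fin by (auto intro: finite_subset card_mono)
  ultimately show ?thesis using C by (intro exI[of _ "card C"]) (auto simp: dimn_def)
qed

lemma dimn_cspan_Un:
  assumes "dimn k V" "dimn l W" shows "\<exists>m\<le>k + l. dimn m (cspan (V \<union> W))"
proof -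
  obtain B where B: "finite B" "card B = k" "V = cspan B" using assms by (auto simp: dimn_def)
  obtain C where C: "finite C" "card C = l" "W = cspan C" using assms by (auto simp: dimn_def)
  have "cspan (V \<union> W) = cspan (B \<union> C)"
  proof
    show "cspan (V \<union> W) \<subseteq> cspan (B \<union> C)"
      using complex_vector.span_mono[of B "B \<union> C"] complex_vector.span_mono[of C "B \<union> C"] B C
      by (intro complex_vector.span_minimal) auto
    show "cspan (B \<union> C) \<subseteq> cspan (V \<union> W)"
      using B C complex_vector.span_superset[of B] complex_vector.span_superset[of C]
      by (intro complex_vector.span_mono) auto
  qed
  moreover have "card (B \<union> C) \<le> k + l" using B C card_Un_le by metis
  ultimately show ?thesis using dimn_cspan_finite[of "B \<union> C"] B C by (metis finite_UnI order_trans)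
qed

lemma dimn_1_cspan: "x \<noteq> 0 \<Longrightarrow> dimn 1 (cspan {x})"
  using dimn_insert[of 0 "{0}" x] by (simp add: dimn_0_iff insert_commute[of x 0])

text \<open>The subspace and its complement span everything, so their dimensions add up to at least
  that of the space.\<close>

lemma corth_comp_dimn:
  assumes V: "dimn k (V :: 'a::chilbert_space set)" and r: "has_room TYPE('a) (k + m)" and l: "dimn l (corth_comp V)"
  shows "m \<le> l"
proof -
  have "x \<in> cspan (V \<union> corth_comp V)" for x
  proof -
    obtain v where v: "v \<in> V" "\<forall>y\<in>V. cinner y (x - v) = 0" using dimn_orth_proj[OF V] by blast
    then have "v \<in> cspan (V \<union> corth_comp V)" "x - v \<in> cspan (V \<union> corth_comp V)"
      by (auto intro!: complex_vector.span_base simp: corth_comp_def)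
    then show ?thesis using complex_vector.span_add by force
  qed
  then have "cspan (V \<union> corth_comp V) = UNIV" by blast
  then obtain j where "j \<le> k + l" "dimn j (UNIV :: 'a set)" using dimn_cspan_Un[OF V l] by metis
  then show ?thesis using r unfolding has_room_def by fastforce
qed

lemma corthogonal_commute: "corthogonal V W \<longleftrightarrow> corthogonal W V"
  unfolding corthogonal_def by (metis cinner_eq_0_commute)

lemma corthogonal_mono: "corthogonal V W \<Longrightarrow> V' \<subseteq> V \<Longrightarrow> corthogonal V' W"
  by (auto simp: corthogonal_def)

lemma corthogonal_cspan:
  assumes "corthogonal V W" shows "corthogonal (cspan V) W"
  unfolding corthogonal_def
proof (intro ballI)
  fix x w assume "x \<in> cspan V" "w \<in> W"
  then have "cinner w x = 0"
    using assms cspan_orth_right[of x V w] cinner_eq_0_commute by (auto simp: corthogonal_def)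
  then show "cinner x w = 0" using cinner_eq_0_commute by blast
qed

text \<open>The finite-dimensional form of $V^{\perp\perp} = V$, relative to the $m$-dimensional subspaces
  of $V^\perp$.\<close>

lemma separating_subspace:
  assumes V: "dimn k (V :: 'a::chilbert_space set)" and x: "x \<notin> V" and m: "0 < m" and r: "has_room TYPE('a) (k + m)"
  shows "\<exists>W. dimn m W \<and> corthogonal V W \<and> (\<exists>w\<in>W. cinner w x \<noteq> 0)"
proof -
  obtain v where v: "v \<in> V" "\<forall>y\<in>V. cinner y (x - v) = 0" using dimn_orth_proj[OF V] by blast
  define y where "y = x - v"
  have y: "y \<noteq> 0" "\<forall>u\<in>V. cinner u y = 0" using v x by (auto simp: y_def)
  have "cspan {y} \<subseteq> corth_comp V"
    using y csubspace_corth_comp by (intro complex_vector.span_minimal) (auto simp: corth_comp_def)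
  then obtain W where W: "cspan {y} \<subseteq> W" "W \<subseteq> corth_comp V" "dimn m W"
    using dimn_between[OF dimn_1_cspan[OF y(1)] _ csubspace_corth_comp, of V m] corth_comp_dimn[OF V r] m
    by (metis One_nat_def Suc_leI)
  have yW: "y \<in> W" using W(1) complex_vector.span_superset[of "{y}"] by blast
  have "cinner v y = 0" using y v by blast
  then have "cinner y v = 0" using cinner_eq_0_commute by blast
  then have "cinner y x = cinner y y" by (simp add: y_def cinner_diff_right)
  then have "cinner y x \<noteq> 0" using y by simp
  moreover have "corthogonal V W" using W(2) by (auto simp: corthogonal_def corth_comp_def)
  ultimately show ?thesis using W(3) yW by blast
qed

text \<open>Source and target carry separate dimensions because \<delta> is not yet known to
  preserve \<open>n\<close>.\<close>

definition orth_pair :: "nat \<Rightarrow> nat \<Rightarrow> nat \<Rightarrow> nat \<Rightarrow> ('a::chilbert_space set \<Rightarrow> 'a set) \<Rightarrow> ('a set \<Rightarrow> 'a set) \<Rightarrow> bool" where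
  "orth_pair n m n' m' g h \<longleftrightarrow> bij_betw g {V. dimn n V} {V. dimn n' V} \<and> bij_betw h {V. dimn m V} {V. dimn m' V}
    \<and> (\<forall>V W. dimn n V \<longrightarrow> dimn m W \<longrightarrow> corthogonal V W \<longleftrightarrow> corthogonal (g V) (h W))"

text \<open>The summand 1 leaves room for an m-dimensional subspace orthogonal to the
  (n+1)-dimensional span of two adjacent ones. A third slot supplies it.\<close>

definition fits :: "'a::chilbert_space itself \<Rightarrow> nat \<Rightarrow> nat \<Rightarrow> bool" where
  "fits T n m \<longleftrightarrow> 0 < n \<and> 0 < m \<and> has_room T (n + m + 1)"

lemma fits_room: "fits TYPE('a::chilbert_space) n m \<Longrightarrow> k \<le> n + m + 1 \<Longrightarrow> has_room TYPE('a) k"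
  unfolding fits_def by (elim conjE) (rule has_room_mono)

lemma orth_pair_D:
  assumes "orth_pair n m n' m' g h"
  shows "dimn n V \<Longrightarrow> dimn n' (g V)" "dimn m W \<Longrightarrow> dimn m' (h W)"
    "dimn n V \<Longrightarrow> dimn m W \<Longrightarrow> corthogonal (g V) (h W) \<longleftrightarrow> corthogonal V W"
    "dimn n V \<Longrightarrow> dimn n V' \<Longrightarrow> g V = g V' \<Longrightarrow> V = V'"
    "dimn m' W' \<Longrightarrow> \<exists>W. dimn m W \<and> h W = W'"
    "dimn n' V'' \<Longrightarrow> \<exists>V. dimn n V \<and> g V = V''"
proof -
  have g: "inj_on g {V. dimn n V}" "g ` {V. dimn n V} = {V. dimn n' V}" and h: "h ` {V. dimn m V} = {V. dimn m' V}"
    and o: "\<And>V W. dimn n V \<Longrightarrow> dimn m W \<Longrightarrow> corthogonal V W \<longleftrightarrow> corthogonal (g V) (h W)"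
    using assms by (auto simp: orth_pair_def bij_betw_def)
  show "dimn n V \<Longrightarrow> dimn n' (g V)" "dimn m W \<Longrightarrow> dimn m' (h W)" using g(2) h by blast+
  show "dimn n V \<Longrightarrow> dimn m W \<Longrightarrow> corthogonal (g V) (h W) \<longleftrightarrow> corthogonal V W" using o by simp
  show "dimn n V \<Longrightarrow> dimn n V' \<Longrightarrow> g V = g V' \<Longrightarrow> V = V'" using g(1) by (auto dest: inj_onD)
  show "dimn m' W' \<Longrightarrow> \<exists>W. dimn m W \<and> h W = W'" using h by (metis image_iff mem_Collect_eq)
  show "dimn n' V'' \<Longrightarrow> \<exists>V. dimn n V \<and> g V = V''" using g(2) by (metis image_iff mem_Collect_eq)
qed

lemma orth_pair_inverse:
  assumes o: "orth_pair n m n' m' g h"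
  shows "orth_pair n' m' n m (the_inv_into {V. dimn n V} g) (the_inv_into {V. dimn m V} h)"
proof -
  have g: "bij_betw g {V. dimn n V} {V. dimn n' V}" and h: "bij_betw h {V. dimn m V} {V. dimn m' V}"
    using o by (auto simp: orth_pair_def)
  note gi = bij_betw_the_inv_into[OF g] and hi = bij_betw_the_inv_into[OF h]
  have gg: "dimn n (the_inv_into {V. dimn n V} g V) \<and> g (the_inv_into {V. dimn n V} g V) = V" if "dimn n' V" for V
    using that gi f_the_inv_into_f_bij_betw[OF g, of V] by (auto simp: bij_betw_def)
  have hh: "dimn m (the_inv_into {V. dimn m V} h V) \<and> h (the_inv_into {V. dimn m V} h V) = V" if "dimn m' V" for V
    using that hi f_the_inv_into_f_bij_betw[OF h, of V] by (auto simp: bij_betw_def)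
  show ?thesis unfolding orth_pair_def using gi hi gg hh orth_pair_D(3)[OF o] by metis
qed

lemma orth_pair_inv_cancel:
  assumes o: "orth_pair n m n' m' g h"
  shows "dimn n V \<Longrightarrow> the_inv_into {V. dimn n V} g (g V) = V"
    and "dimn n' V' \<Longrightarrow> g (the_inv_into {V. dimn n V} g V') = V'"
proof -
  have g: "bij_betw g {V. dimn n V} {V. dimn n' V}" using o by (auto simp: orth_pair_def)
  show "dimn n V \<Longrightarrow> the_inv_into {V. dimn n V} g (g V) = V"
    using g the_inv_into_f_f[of g "{V. dimn n V}" V] by (auto simp: bij_betw_def)
  show "dimn n' V' \<Longrightarrow> g (the_inv_into {V. dimn n V} g V') = V'"
    using f_the_inv_into_f_bij_betw[OF g, of V'] by auto
qed

text \<open>Containment in the double complement of \<open>V1 \<union> V2\<close>, tested by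
  m-dimensional subspaces only, so that an \<open>orth_pair\<close> preserves it. It means
  containment in the span when there is room (\<open>in_closure_iff\<close>); for larger spans the
  test may be vacuous.\<close>

definition in_closure :: "nat \<Rightarrow> 'a::chilbert_space set \<Rightarrow> 'a set \<Rightarrow> 'a set \<Rightarrow> bool" where
  "in_closure m V1 V2 V \<longleftrightarrow> (\<forall>W. dimn m W \<longrightarrow> corthogonal V1 W \<longrightarrow> corthogonal V2 W \<longrightarrow> corthogonal V W)"

lemma in_closure_preserved:
  assumes o: "orth_pair n m n' m' g h" and V: "dimn n V1" "dimn n V2" "dimn n V"
  shows "in_closure m' (g V1) (g V2) (g V) \<longleftrightarrow> in_closure m V1 V2 V"
proof
  assume c: "in_closure m' (g V1) (g V2) (g V)"
  show "in_closure m V1 V2 V"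
    unfolding in_closure_def
  proof (intro allI impI)
    fix W assume "dimn m W" "corthogonal V1 W" "corthogonal V2 W"
    then show "corthogonal V W"
      using c orth_pair_D(2)[OF o, of W] orth_pair_D(3)[OF o V(1), of W] orth_pair_D(3)[OF o V(2), of W]
        orth_pair_D(3)[OF o V(3), of W] by (simp add: in_closure_def)
  qed
next
  assume c: "in_closure m V1 V2 V"
  show "in_closure m' (g V1) (g V2) (g V)"
    unfolding in_closure_def
  proof (intro allI impI)
    fix W' assume W': "dimn m' W'" "corthogonal (g V1) W'" "corthogonal (g V2) W'"
    obtain W where W: "dimn m W" "h W = W'" using orth_pair_D(5)[OF o W'(1)] by blast
    then show "corthogonal (g V) W'"
      using c W' orth_pair_D(3)[OF o V(1) W(1)] orth_pair_D(3)[OF o V(2) W(1)]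
        orth_pair_D(3)[OF o V(3) W(1)] by (simp add: in_closure_def)
  qed
qed

lemma subset_in_closure: "V \<subseteq> cspan (V1 \<union> V2) \<Longrightarrow> in_closure m V1 V2 V"
proof -
  assume V: "V \<subseteq> cspan (V1 \<union> V2)"
  have "corthogonal V W" if "corthogonal V1 W" "corthogonal V2 W" for W
    using corthogonal_mono[OF corthogonal_cspan V, of W] that by (auto simp: corthogonal_def)
  then show ?thesis by (simp add: in_closure_def)
qed

lemma in_closure_iff:
  assumes d: "dimn k (cspan (V1 \<union> V2) :: 'a::chilbert_space set)" and m: "0 < m" and r: "has_room TYPE('a) (k + m)"
  shows "in_closure m V1 V2 V \<longleftrightarrow> V \<subseteq> cspan (V1 \<union> V2)"
proof
  assume c: "in_closure m V1 V2 V"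
  show "V \<subseteq> cspan (V1 \<union> V2)"
  proof (rule subsetI, rule ccontr)
    fix x assume x: "x \<in> V" "x \<notin> cspan (V1 \<union> V2)"
    obtain W w where W: "dimn m W" "corthogonal (cspan (V1 \<union> V2)) W" "w \<in> W" "cinner w x \<noteq> 0"
      using separating_subspace[OF d x(2) m r] by blast
    have "corthogonal V1 W" "corthogonal V2 W"
      using corthogonal_mono[OF W(2)] complex_vector.span_superset[of "V1 \<union> V2"] by auto
    then have "corthogonal V W" using c W(1) by (auto simp: in_closure_def)
    then show False using W(3,4) x(1) cinner_eq_0_commute by (auto simp: corthogonal_def)
  qed
qed (rule subset_in_closure)

text \<open>Adjacency in the Grassmannian, phrased by the span instead of the intersection because
  spans are what \<open>in_closure\<close> can see.\<close>

definition nb :: "nat \<Rightarrow> 'a::chilbert_space set \<Rightarrow> 'a set \<Rightarrow> bool" where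
  "nb n V1 V2 \<longleftrightarrow> V1 \<noteq> V2 \<and> dimn n V1 \<and> dimn n V2 \<and> dimn (Suc n) (cspan (V1 \<union> V2))"

lemma nb_commute: "nb n V1 V2 \<Longrightarrow> nb n V2 V1"
  by (auto simp: nb_def Un_commute)

lemma cspan_Un_subset: "csubspace U \<Longrightarrow> V1 \<subseteq> U \<Longrightarrow> V2 \<subseteq> U \<Longrightarrow> cspan (V1 \<union> V2) \<subseteq> U"
  by (intro complex_vector.span_minimal) auto

lemma Un_subset_cspan:
  shows "V1 \<subseteq> cspan (V1 \<union> V2)" and "V2 \<subseteq> cspan (V1 \<union> V2)"
  using complex_vector.span_superset[of "V1 \<union> V2"] by auto

lemma subset_cspan_insert: "V \<subseteq> cspan (insert x V)" "x \<in> cspan (insert x V)"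
  using complex_vector.span_superset[of "insert x V"] by auto

lemma cspan_insert_subset: "csubspace U \<Longrightarrow> V \<subseteq> U \<Longrightarrow> x \<in> U \<Longrightarrow> cspan (insert x V) \<subseteq> U"
  by (intro complex_vector.span_minimal) auto

lemma nb_sup_eq:
  assumes "dimn (Suc n) U" "dimn n V1" "dimn n V2" "V1 \<noteq> V2" "V1 \<subseteq> U" "V2 \<subseteq> U"
  shows "cspan (V1 \<union> V2) = U \<and> nb n V1 V2"
proof -
  have "\<not> V2 \<subseteq> V1" using dimn_eq[OF assms(2,3)] assms(4) by blast
  then obtain x where x: "x \<in> V2" "x \<notin> V1" by blast
  note d = dimn_insert[OF assms(2) x(2)]
  have "cspan (insert x V1) = U"
    using dimn_eq[OF assms(1) d] cspan_insert_subset[OF dimn_csubspace[OF assms(1)] assms(5)] x assms(6) by blast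
  moreover have "cspan (insert x V1) \<subseteq> cspan (V1 \<union> V2)"
    using x by (intro complex_vector.span_mono) auto
  ultimately have "cspan (V1 \<union> V2) = U"
    using cspan_Un_subset[OF dimn_csubspace[OF assms(1)] assms(5,6)] by blast
  then show ?thesis using assms by (auto simp: nb_def)
qed

text \<open>In the span of an adjacent pair, \<open>V1\<close> and any other \<open>V3\<close>
  recover \<open>V2\<close>. In general, let \<open>V3\<close> be spanned by one \<open>x\<close> of
  \<open>V2\<close> and a hyperplane of \<open>V1\<close>: its span with \<open>V1\<close> has
  dimension n + 1, small enough for the closure to be exact, so recovering \<open>V2\<close> from it
  forces adjacency.\<close>

lemma nb_iff_closure:
  assumes V: "dimn n V1" "dimn n (V2 :: 'a::chilbert_space set)" and ne: "V1 \<noteq> V2" and f: "fits TYPE('a) n m"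
  shows "nb n V1 V2 \<longleftrightarrow> (\<forall>V3. dimn n V3 \<longrightarrow> V3 \<noteq> V1 \<longrightarrow> in_closure m V1 V2 V3 \<longrightarrow> in_closure m V1 V3 V2)"
proof
  have m: "0 < m" and r: "has_room TYPE('a) (Suc n + m)" using f by (auto simp: fits_def)
  {
    assume n: "nb n V1 V2"
    then have d: "dimn (Suc n) (cspan (V1 \<union> V2))" by (simp add: nb_def)
    have "in_closure m V1 V3 V2" if V3: "dimn n V3" "V3 \<noteq> V1" "in_closure m V1 V2 V3" for V3
    proof -
      have "V3 \<subseteq> cspan (V1 \<union> V2)" using V3(3) in_closure_iff[OF d m r] by blast
      then have "cspan (V1 \<union> V3) = cspan (V1 \<union> V2)"
        using nb_sup_eq[OF d V(1) V3(1) not_sym[OF V3(2)]] Un_subset_cspan by blast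
      then show ?thesis using Un_subset_cspan by (intro subset_in_closure) blast
    qed
    then show "\<forall>V3. dimn n V3 \<longrightarrow> V3 \<noteq> V1 \<longrightarrow> in_closure m V1 V2 V3 \<longrightarrow> in_closure m V1 V3 V2" by blast
  }
  assume *: "\<forall>V3. dimn n V3 \<longrightarrow> V3 \<noteq> V1 \<longrightarrow> in_closure m V1 V2 V3 \<longrightarrow> in_closure m V1 V3 V2"
  have "\<not> V2 \<subseteq> V1" using dimn_eq[OF V] ne by blast
  then obtain x where x: "x \<in> V2" "x \<notin> V1" by blast
  obtain k where k: "n = Suc k" using f by (auto simp: fits_def gr0_conv_Suc)
  obtain K where K: "dimn k K" "K \<subseteq> V1" using dimn_Suc_split V(1) unfolding k by metis
  define V3 where "V3 = cspan (insert x K)"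
  have "x \<notin> K" using K x by blast
  then have V3: "dimn n V3" using dimn_insert[OF K(1)] by (simp add: V3_def k)
  have xV3: "x \<in> V3" unfolding V3_def by (rule subset_cspan_insert)
  have "V3 \<subseteq> cspan (V1 \<union> V2)" unfolding V3_def
    using K x Un_subset_cspan[where ?V1.0 = V1 and ?V2.0 = V2]
    by (intro cspan_insert_subset complex_vector.subspace_span) blast+
  then have "in_closure m V1 V2 V3" by (rule subset_in_closure)
  moreover have ne3: "V3 \<noteq> V1" using xV3 x by blast
  ultimately have c: "in_closure m V1 V3 V2" using * V3 by blast
  have U: "dimn (Suc n) (cspan (insert x V1))" by (rule dimn_insert[OF V(1) x(2)])
  have "V3 \<subseteq> cspan (insert x V1)" unfolding V3_def using K by (intro complex_vector.span_mono) auto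
  then have eq: "cspan (V1 \<union> V3) = cspan (insert x V1)"
    using nb_sup_eq[OF U V(1) V3 not_sym[OF ne3]] subset_cspan_insert by blast
  have "V2 \<subseteq> cspan (insert x V1)" using c in_closure_iff[of "Suc n" V1 V3 m V2] U m r unfolding eq by blast
  then show "nb n V1 V2" using nb_sup_eq[OF U V ne] subset_cspan_insert by blast
qed

lemma nb_preserved:
  assumes o: "orth_pair n m n' m' g (h :: 'a::chilbert_space set \<Rightarrow> 'a set)" and f: "fits TYPE('a) n m" "fits TYPE('a) n' m'"
    and V: "dimn n V1" "dimn n V2"
  shows "nb n' (g V1) (g V2) \<longleftrightarrow> nb n V1 V2"
proof (cases "V1 = V2")
  case True
  then show ?thesis by (simp add: nb_def)
next
  case False
  have ne: "g V1 \<noteq> g V2" using orth_pair_D(4)[OF o V] False by blast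
  note gV = orth_pair_D(1)[OF o V(1)] orth_pair_D(1)[OF o V(2)]
  have all: "(\<forall>V3. dimn n' V3 \<longrightarrow> P V3) \<longleftrightarrow> (\<forall>V3. dimn n V3 \<longrightarrow> P (g V3))" for P
    using orth_pair_D(1,6)[OF o] by metis
  have "nb n' (g V1) (g V2) \<longleftrightarrow> (\<forall>V3. dimn n V3 \<longrightarrow> g V3 \<noteq> g V1 \<longrightarrow>
      in_closure m' (g V1) (g V2) (g V3) \<longrightarrow> in_closure m' (g V1) (g V3) (g V2))"
    unfolding nb_iff_closure[OF gV ne f(2)]
    by (rule all[of "\<lambda>V3. V3 \<noteq> g V1 \<longrightarrow> in_closure m' (g V1) (g V2) V3 \<longrightarrow> in_closure m' (g V1) V3 (g V2)"])
  also have "\<dots> \<longleftrightarrow> nb n V1 V2"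
    unfolding nb_iff_closure[OF V False f(1)]
    using in_closure_preserved[OF o V] in_closure_preserved[OF o V(1) _ V(2)] orth_pair_D(4)[OF o _ V(1)] by metis
  finally show ?thesis .
qed

lemma nb_span_preserved:
  assumes o: "orth_pair n m n' m' g (h :: 'a::chilbert_space set \<Rightarrow> 'a set)" and f: "fits TYPE('a) n m" "fits TYPE('a) n' m'"
    and nb: "nb n V1 V2" and V: "dimn n V"
  shows "g V \<subseteq> cspan (g V1 \<union> g V2) \<longleftrightarrow> V \<subseteq> cspan (V1 \<union> V2)"
proof -
  have V12: "dimn n V1" "dimn n V2" and d: "dimn (Suc n) (cspan (V1 \<union> V2))" using nb by (auto simp: nb_def)
  have "nb n' (g V1) (g V2)" using nb_preserved[OF o f V12] nb by blast
  then have d': "dimn (Suc n') (cspan (g V1 \<union> g V2))" by (simp add: nb_def)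
  have r: "0 < m" "has_room TYPE('a) (Suc n + m)" "0 < m'" "has_room TYPE('a) (Suc n' + m')"
    using f by (auto simp: fits_def)
  show ?thesis
    using in_closure_iff[OF d r(1,2)] in_closure_iff[OF d' r(3,4)] in_closure_preserved[OF o V12 V] by blast
qed

lemma nb_inter:
  assumes "nb (Suc k) V1 V2" shows "dimn k (V1 \<inter> V2)"
proof -
  have V: "dimn (Suc k) V1" "dimn (Suc k) V2" "V1 \<noteq> V2" and U: "dimn (Suc (Suc k)) (cspan (V1 \<union> V2))"
    using assms by (auto simp: nb_def)
  have "\<not> V2 \<subseteq> V1" using dimn_eq[OF V(1,2)] V(3) by blast
  then obtain y where y: "y \<in> V2" "y \<notin> V1" by blast
  have sub: "csubspace V1" "csubspace V2" "csubspace (V1 \<inter> V2)"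
    using V dimn_csubspace complex_vector.subspace_inter by blast+
  have "cspan (insert y V1) = cspan (V1 \<union> V2)"
  proof (rule dimn_eq[OF U dimn_insert[OF V(1) y(2)]])
    show "cspan (insert y V1) \<subseteq> cspan (V1 \<union> V2)" using y by (intro complex_vector.span_mono) auto
  qed
  then have "V2 \<subseteq> cspan (insert y V1)" using Un_subset_cspan by blast
  have "V2 \<subseteq> cspan (insert y (V1 \<inter> V2))"
  proof
    fix x assume x: "x \<in> V2"
    then obtain c where c: "x - c *\<^sub>C y \<in> V1"
      using \<open>V2 \<subseteq> cspan (insert y V1)\<close> cspan_insert_iff[OF sub(1)] by blast
    have "x - c *\<^sub>C y \<in> V2"
      using x y complex_vector.subspace_diff[OF sub(2)] complex_vector.subspace_scale[OF sub(2)] by blast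
    then show "x \<in> cspan (insert y (V1 \<inter> V2))" using c cspan_insert_iff[OF sub(3)] by blast
  qed
  then have V2: "cspan (insert y (V1 \<inter> V2)) = V2"
    using cspan_insert_subset[OF sub(2), of "V1 \<inter> V2" y] y by blast
  obtain l where l: "dimn l (V1 \<inter> V2)" using dimn_sub[OF V(2) sub(3)] by blast
  have "dimn (Suc l) V2" using dimn_insert[OF l, of y] y V2 by simp
  then have "l = k" using dimn_unique V(2) by blast
  then show ?thesis using l by simp
qed

lemma nb_of_common:
  assumes K: "dimn k K" "K \<subseteq> V1" "K \<subseteq> V2" and V: "dimn (Suc k) V1" "dimn (Suc k) V2" "V1 \<noteq> V2"
  shows "nb (Suc k) V1 V2" "V1 \<inter> V2 = K"
proof -
  have "\<not> V2 \<subseteq> V1" using dimn_eq[OF V(1,2)] V(3) by blast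
  then obtain y where y: "y \<in> V2" "y \<notin> V1" by blast
  have "dimn (Suc k) (cspan (insert y K))" using K y by (intro dimn_insert) auto
  then have V2: "cspan (insert y K) = V2"
    using dimn_eq[OF V(2)] cspan_insert_subset[OF dimn_csubspace[OF V(2)] K(3) y(1)] by blast
  have U: "dimn (Suc (Suc k)) (cspan (insert y V1))" by (rule dimn_insert[OF V(1) y(2)])
  have "V2 \<subseteq> cspan (insert y V1)" unfolding V2[symmetric] using K by (intro complex_vector.span_mono) auto
  then show n: "nb (Suc k) V1 V2" using nb_sup_eq[OF U V] subset_cspan_insert by blast
  show "V1 \<inter> V2 = K" using dimn_eq[OF nb_inter[OF n] K(1)] K by blast
qed

text \<open>A vector of \<open>A2 \<inter> A3\<close> outside \<open>A1\<close> would span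
  \<open>A3\<close> together with \<open>A1 \<inter> A3\<close>, and so put \<open>A3\<close> inside
  the span of \<open>A1\<close> and \<open>A2\<close>. Hence the pairwise intersections
  coincide.\<close>

lemma nb_triple:
  assumes n: "nb (Suc k) A1 A2" "nb (Suc k) A1 A3" "nb (Suc k) A2 A3" and s: "\<not> A3 \<subseteq> cspan (A1 \<union> A2)"
  shows "A1 \<inter> A3 = A1 \<inter> A2"
proof -
  note d = nb_inter[OF n(1)] nb_inter[OF n(2)] nb_inter[OF n(3)]
  have A3: "dimn (Suc k) A3" using n by (simp add: nb_def)
  have "A2 \<inter> A3 \<subseteq> A1 \<inter> A3"
  proof (rule subsetI, rule ccontr)
    fix z assume z: "z \<in> A2 \<inter> A3" "z \<notin> A1 \<inter> A3"
    have "cspan (insert z (A1 \<inter> A3)) = A3"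
      using dimn_eq[OF A3 dimn_insert[OF d(2) z(2)]] cspan_insert_subset[OF dimn_csubspace[OF A3]] z by blast
    moreover have "cspan (insert z (A1 \<inter> A3)) \<subseteq> cspan (A1 \<union> A2)" using z by (intro complex_vector.span_mono) auto
    ultimately show False using s by blast
  qed
  then have "A2 \<inter> A3 = A1 \<inter> A3" using dimn_eq[OF d(2,3)] by blast
  then have "A1 \<inter> A3 \<subseteq> A1 \<inter> A2" by blast
  then show ?thesis using dimn_eq[OF d(1,2)] by blast
qed

text \<open>The subspaces through a fixed $K$ of codimension 1 are recovered from three of them which
  are pairwise adjacent but not contained in a common subspace of dimension $n + 1$.\<close>

definition star_triple :: "nat \<Rightarrow> 'a::chilbert_space set \<Rightarrow> 'a set \<Rightarrow> 'a set \<Rightarrow> bool" where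
  "star_triple n V1 V2 V3 \<longleftrightarrow> nb n V1 V2 \<and> nb n V1 V3 \<and> nb n V2 V3 \<and> \<not> V3 \<subseteq> cspan (V1 \<union> V2)"

lemma star_triple_preserved:
  assumes o: "orth_pair n m n' m' g (h :: 'a::chilbert_space set \<Rightarrow> 'a set)" and f: "fits TYPE('a) n m" "fits TYPE('a) n' m'"
    and t: "star_triple n V1 V2 V3"
  shows "star_triple n' (g V1) (g V2) (g V3)"
proof -
  have "dimn n V1" "dimn n V2" "dimn n V3" using t by (auto simp: star_triple_def nb_def)
  then show ?thesis
    using t nb_preserved[OF o f] nb_span_preserved[OF o f] unfolding star_triple_def by blast
qed

lemma star_triple_exists:
  assumes K: "dimn k (K :: 'a::chilbert_space set)" and r: "has_room TYPE('a) (k + 3)"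
  shows "\<exists>V1 V2 V3. star_triple (Suc k) V1 V2 V3 \<and> V1 \<inter> V2 = K"
proof -
  have r': "has_room TYPE('a) (Suc k)" "has_room TYPE('a) (Suc (Suc k))" "has_room TYPE('a) (Suc (Suc (Suc k)))"
    by (rule has_room_mono[OF r], simp)+
  obtain x where x: "x \<notin> K" using dimn_UNIV_ex[OF K r'(1)] by blast
  define V1 where "V1 = cspan (insert x K)"
  have V1: "dimn (Suc k) V1" unfolding V1_def by (rule dimn_insert[OF K x])
  obtain y where y: "y \<notin> V1" using dimn_UNIV_ex[OF V1 r'(2)] by blast
  define U where "U = cspan (insert y V1)"
  have U: "dimn (Suc (Suc k)) U" unfolding U_def by (rule dimn_insert[OF V1 y])
  obtain z where z: "z \<notin> U" using dimn_UNIV_ex[OF U r'(3)] by blast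
  have KV: "K \<subseteq> V1" unfolding V1_def by (rule subset_cspan_insert)
  have VU: "V1 \<subseteq> U" "y \<in> U" unfolding U_def by (rule subset_cspan_insert)+
  have yK: "y \<notin> K" and zK: "z \<notin> K" using y z KV VU by blast+
  define V2 where "V2 = cspan (insert y K)"
  define V3 where "V3 = cspan (insert z K)"
  have V2: "dimn (Suc k) V2" "K \<subseteq> V2" "y \<in> V2" unfolding V2_def
    by (rule dimn_insert[OF K yK], rule subset_cspan_insert, rule subset_cspan_insert)
  have V3: "dimn (Suc k) V3" "K \<subseteq> V3" "z \<in> V3" unfolding V3_def
    by (rule dimn_insert[OF K zK], rule subset_cspan_insert, rule subset_cspan_insert)
  have V2U: "V2 \<subseteq> U" unfolding V2_def using KV VU by (intro cspan_insert_subset dimn_csubspace[OF U]) auto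
  have ne: "V1 \<noteq> V2" "V1 \<noteq> V3" "V2 \<noteq> V3" using V2 V3 y z VU V2U by blast+
  have "cspan (V1 \<union> V2) \<subseteq> U" by (rule cspan_Un_subset[OF dimn_csubspace[OF U] VU(1) V2U])
  then have "\<not> V3 \<subseteq> cspan (V1 \<union> V2)" using z V3(3) by blast
  then have "star_triple (Suc k) V1 V2 V3" unfolding star_triple_def
    using nb_of_common(1)[OF K KV V2(2) V1 V2(1) ne(1)] nb_of_common(1)[OF K KV V3(2) V1 V3(1) ne(2)]
      nb_of_common(1)[OF K V2(2) V3(2) V2(1) V3(1) ne(3)] by blast
  then show ?thesis using nb_of_common(2)[OF K KV V2(2) V1 V2(1) ne(1)] by blast
qed

lemma star_triple_common:
  assumes "star_triple (Suc k) V1 V2 V3" shows "V1 \<inter> V3 = V1 \<inter> V2" "V2 \<inter> V3 = V1 \<inter> V2"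
proof -
  have n: "nb (Suc k) V1 V2" "nb (Suc k) V1 V3" "nb (Suc k) V2 V3" "\<not> V3 \<subseteq> cspan (V1 \<union> V2)"
    using assms by (auto simp: star_triple_def)
  show "V1 \<inter> V3 = V1 \<inter> V2" by (rule nb_triple[OF n])
  have "V2 \<inter> V3 = V2 \<inter> V1" by (rule nb_triple[OF nb_commute[OF n(1)] n(3,2)]) (use n(4) in \<open>simp add: Un_commute\<close>)
  then show "V2 \<inter> V3 = V1 \<inter> V2" by blast
qed

text \<open>Intersecting over all \<open>V\<close> avoids the choice of a triple;
  \<open>star_image_triple\<close> shows that two members of a triple already give the
  result.\<close>

definition star_image :: "nat \<Rightarrow> ('a::chilbert_space set \<Rightarrow> 'a set) \<Rightarrow> 'a set \<Rightarrow> 'a set" where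
  "star_image n g K = \<Inter> (g ` {V. dimn n V \<and> K \<subseteq> V})"

text \<open>For another \<open>V\<close> through the common hyperplane, \<open>nb_triple\<close>
  applies to the images unless \<open>V\<close> lies in the span of \<open>V1\<close> and
  \<open>V2\<close>. In that case it lies outside the span of \<open>V1\<close> and
  \<open>V3\<close>, and \<open>V3\<close> takes the place of \<open>V2\<close>.\<close>

lemma star_image_triple:
  assumes o: "orth_pair (Suc k) m (Suc k') m' g (h :: 'a::chilbert_space set \<Rightarrow> 'a set)"
    and f: "fits TYPE('a) (Suc k) m" "fits TYPE('a) (Suc k') m'"
    and t: "star_triple (Suc k) V1 V2 V3"
  shows "star_image (Suc k) g (V1 \<inter> V2) = g V1 \<inter> g V2" "dimn k' (g V1 \<inter> g V2)"
proof -
  have gt: "star_triple (Suc k') (g V1) (g V2) (g V3)" by (rule star_triple_preserved[OF o f t])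
  have n: "nb (Suc k) V1 V2" "nb (Suc k) V1 V3" "nb (Suc k) V2 V3" "\<not> V3 \<subseteq> cspan (V1 \<union> V2)"
    using t by (auto simp: star_triple_def)
  have gn: "nb (Suc k') (g V1) (g V2)" "nb (Suc k') (g V1) (g V3)"
    using gt by (auto simp: star_triple_def)
  have d: "dimn (Suc k) V1" "dimn (Suc k) V2" "dimn (Suc k) V3" using n by (auto simp: nb_def)
  note K = nb_inter[OF n(1)]
  show "dimn k' (g V1 \<inter> g V2)" by (rule nb_inter[OF gn(1)])
  have main: "g V1 \<inter> g V2 \<subseteq> g V" if V: "dimn (Suc k) V" "V1 \<inter> V2 \<subseteq> V" for V
  proof (cases "V = V1 \<or> V = V2")
    case False
    have n1: "nb (Suc k) V1 V" and n2: "nb (Suc k) V2 V"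
      using nb_of_common(1)[OF K _ V(2) d(1) V(1)] nb_of_common(1)[OF K _ V(2) d(2) V(1)] False by auto
    note g1 = nb_preserved[OF o f d(1) V(1), THEN iffD2, OF n1]
    note g2 = nb_preserved[OF o f d(2) V(1), THEN iffD2, OF n2]
    show ?thesis
    proof (cases "V \<subseteq> cspan (V1 \<union> V2)")
      case False
      then have "\<not> g V \<subseteq> cspan (g V1 \<union> g V2)" using nb_span_preserved[OF o f n(1) V(1)] by blast
      then show ?thesis using nb_triple[OF gn(1) g1 g2] by blast
    next
      case True
      have ne3: "V3 \<noteq> V" using True n(4) by blast
      have K3: "V1 \<inter> V2 \<subseteq> V3" using star_triple_common[OF t] by blast
      have n3: "nb (Suc k) V3 V" by (rule nb_of_common(1)[OF K K3 V(2) d(3) V(1) ne3])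
      note g3 = nb_preserved[OF o f d(3) V(1), THEN iffD2, OF n3]
      have "\<not> V \<subseteq> cspan (V1 \<union> V3)"
      proof
        assume V13: "V \<subseteq> cspan (V1 \<union> V3)"
        have d12: "dimn (Suc (Suc k)) (cspan (V1 \<union> V2))" and d13: "dimn (Suc (Suc k)) (cspan (V1 \<union> V3))"
          using n by (auto simp: nb_def)
        have "V1 \<noteq> V" using False by blast
        then have "cspan (V1 \<union> V) = cspan (V1 \<union> V2)" "cspan (V1 \<union> V) = cspan (V1 \<union> V3)"
          using nb_sup_eq[OF d12 d(1) V(1) _ _ True] nb_sup_eq[OF d13 d(1) V(1) _ _ V13] Un_subset_cspan by blast+
        then show False using n(4) Un_subset_cspan[of V3 V1] by (metis Un_commute)
      qed
      then have "\<not> g V \<subseteq> cspan (g V1 \<union> g V3)" using nb_span_preserved[OF o f n(2) V(1)] by blast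
      then have "g V1 \<inter> g V = g V1 \<inter> g V3" by (rule nb_triple[OF gn(2) g1 g3])
      then show ?thesis using star_triple_common(1)[OF gt] by blast
    qed
  qed auto
  show "star_image (Suc k) g (V1 \<inter> V2) = g V1 \<inter> g V2"
  proof
    show "star_image (Suc k) g (V1 \<inter> V2) \<subseteq> g V1 \<inter> g V2" using d by (auto simp: star_image_def)
    show "g V1 \<inter> g V2 \<subseteq> star_image (Suc k) g (V1 \<inter> V2)" using main by (auto simp: star_image_def)
  qed
qed

lemma star_image_inverse:
  assumes o: "orth_pair (Suc k) m (Suc k') m' g (h :: 'a::chilbert_space set \<Rightarrow> 'a set)"
    and f: "fits TYPE('a) (Suc k) m" "fits TYPE('a) (Suc k') m'" and K: "dimn k K"
  shows "dimn k' (star_image (Suc k) g K)"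
    and "star_image (Suc k') (the_inv_into {V. dimn (Suc k) V} g) (star_image (Suc k) g K) = K"
proof -
  have "has_room TYPE('a) (k + 3)" using fits_room[OF f(1), of "k + 3"] f(1) by (simp add: fits_def)
  then obtain V1 V2 V3 where t: "star_triple (Suc k) V1 V2 V3" "V1 \<inter> V2 = K"
    using star_triple_exists[OF K] by blast
  note s = star_image_triple[OF o f t(1), unfolded t(2)]
  show "dimn k' (star_image (Suc k) g K)" using s by simp
  have d: "dimn (Suc k) V1" "dimn (Suc k) V2" using t by (auto simp: star_triple_def nb_def)
  show "star_image (Suc k') (the_inv_into {V. dimn (Suc k) V} g) (star_image (Suc k) g K) = K"
    using star_image_triple(1)[OF orth_pair_inverse[OF o] f(2,1) star_triple_preserved[OF o f t(1)]]
      orth_pair_inv_cancel(1)[OF o d(1)] orth_pair_inv_cancel(1)[OF o d(2)] t(2) s(1) by simp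
qed

lemma star_image_subset: "dimn n V \<Longrightarrow> K \<subseteq> V \<Longrightarrow> star_image n g K \<subseteq> g V"
  by (auto simp: star_image_def)

lemma extend_orthogonal:
  assumes K: "dimn k (K :: 'a::chilbert_space set)" and W: "dimn m W" "corthogonal K W" and r: "has_room TYPE('a) (k + m + 1)"
  shows "\<exists>V. dimn (Suc k) V \<and> K \<subseteq> V \<and> corthogonal V W"
proof -
  have KW: "K \<subseteq> corth_comp W"
    using W(2) by (auto simp: corth_comp_def corthogonal_def cinner_eq_0_commute)
  have "\<exists>V. K \<subseteq> V \<and> V \<subseteq> corth_comp W \<and> dimn (Suc k) V"
  proof (rule dimn_between[OF K KW csubspace_corth_comp])
    show "Suc k \<le> l" if "dimn l (corth_comp W)" for l
      using corth_comp_dimn[OF W(1) _ that, of "Suc k"] r by (simp add: add.commute)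
  qed simp
  then obtain V where V: "K \<subseteq> V" "V \<subseteq> corth_comp W" "dimn (Suc k) V" by blast
  have "corthogonal W V" using V(2) by (auto simp: corth_comp_def corthogonal_def)
  then show ?thesis using V corthogonal_commute by blast
qed

text \<open>Orthogonality descends because \<open>K\<close> is orthogonal to \<open>W\<close>
  exactly when some (k+1)-dimensional subspace containing \<open>K\<close> is, and there is room for
  such a subspace on both the source and the target side.\<close>

lemma orth_pair_descend:
  assumes o: "orth_pair (Suc k) m (Suc k') m' g (h :: 'a::chilbert_space set \<Rightarrow> 'a set)"
    and f: "fits TYPE('a) (Suc k) m" "fits TYPE('a) (Suc k') m'"
  defines "g' \<equiv> star_image (Suc k) g"
  shows "orth_pair k m k' m' g' h" and "dimn k K \<Longrightarrow> dimn (Suc k) V \<Longrightarrow> K \<subseteq> V \<longleftrightarrow> g' K \<subseteq> g V"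
proof -
  let ?gi = "the_inv_into {V. dimn (Suc k) V} g" and ?hi = "the_inv_into {V. dimn m V} h"
  note oi = orth_pair_inverse[OF o]
  define g'' where "g'' = star_image (Suc k') ?gi"
  have 1: "dimn k' (g' K)" "g'' (g' K) = K" if "dimn k K" for K
    using star_image_inverse[OF o f that] by (simp_all add: g'_def g''_def)
  \<comment> \<open>The inverse of the inverse is identified with \<open>g\<close> on
    (k+1)-dimensional subspaces, the only ones that \<open>star_image\<close> uses.\<close>
  have inv_inv: "the_inv_into {V. dimn (Suc k') V} ?gi V = g V" if "dimn (Suc k) V" for V
    using orth_pair_inv_cancel(1)[OF oi orth_pair_D(1)[OF o that]] orth_pair_inv_cancel(1)[OF o that] by simp
  have ii: "star_image (Suc k) (the_inv_into {V. dimn (Suc k') V} ?gi) = g'"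
    unfolding g'_def star_image_def using inv_inv by (intro ext arg_cong[of _ _ Inter] image_cong) auto
  have 2: "dimn k (g'' K)" "g' (g'' K) = K" if "dimn k' K" for K
    using star_image_inverse[OF oi f(2,1) that] by (simp_all add: ii g''_def)
  have bij: "bij_betw g' {V. dimn k V} {V. dimn k' V}"
    by (rule bij_betw_byWitness[where f' = g'']) (use 1 2 in auto)
  show sub: "K \<subseteq> V \<longleftrightarrow> g' K \<subseteq> g V" if K: "dimn k K" and V: "dimn (Suc k) V" for K V
  proof
    show "K \<subseteq> V \<Longrightarrow> g' K \<subseteq> g V" unfolding g'_def by (rule star_image_subset[OF V])
    assume "g' K \<subseteq> g V"
    then have "g'' (g' K) \<subseteq> ?gi (g V)" unfolding g''_def
      by (rule star_image_subset[OF orth_pair_D(1)[OF o V]])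
    then show "K \<subseteq> V" using 1(2)[OF K] orth_pair_inv_cancel(1)[OF o V] by simp
  qed
  have room: "has_room TYPE('a) (k + m + 1)" "has_room TYPE('a) (k' + m' + 1)"
    using fits_room[OF f(1), of "k + m + 1"] fits_room[OF f(2), of "k' + m' + 1"] by simp_all
  have "corthogonal K W \<longleftrightarrow> corthogonal (g' K) (h W)" if K: "dimn k K" and W: "dimn m W" for K W
  proof
    assume "corthogonal K W"
    then obtain V where V: "dimn (Suc k) V" "K \<subseteq> V" "corthogonal V W"
      using extend_orthogonal[OF K W _ room(1)] by blast
    then have "corthogonal (g V) (h W)" using orth_pair_D(3)[OF o V(1) W] by blast
    then show "corthogonal (g' K) (h W)" using corthogonal_mono sub[OF K V(1)] V(2) by blast
  next
    assume "corthogonal (g' K) (h W)"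
    then obtain V' where V': "dimn (Suc k') V'" "g' K \<subseteq> V'" "corthogonal V' (h W)"
      using extend_orthogonal[OF 1(1)[OF K] orth_pair_D(2)[OF o W] _ room(2)] by blast
    obtain V where V: "dimn (Suc k) V" "g V = V'" using orth_pair_D(6)[OF o V'(1)] by blast
    then have "corthogonal V W" using orth_pair_D(3)[OF o V(1) W] V'(3) by blast
    then show "corthogonal K W" using corthogonal_mono sub[OF K V(1)] V(2) V'(2) by blast
  qed
  then show "orth_pair k m k' m' g' h" using bij o unfolding orth_pair_def by blast
qed

text \<open>Dimension 1 is recognised by the adjacency of all distinct subspaces. For larger
  \<open>n\<close> this fails: \<open>V2\<close> is made to contain two vectors that are independent
  modulo \<open>V1\<close>.\<close>

lemma non_nb_exists:
  assumes n: "n \<ge> 2" and r: "has_room TYPE('a::chilbert_space) (Suc (Suc n))"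
  shows "\<exists>V1 V2 :: 'a set. dimn n V1 \<and> dimn n V2 \<and> V1 \<noteq> V2 \<and> \<not> nb n V1 V2"
proof -
  have 0: "dimn 0 {0 :: 'a}" by (simp add: dimn_0_iff)
  have room: "j \<le> l" if "j \<le> Suc (Suc n)" "dimn l (UNIV :: 'a set)" for j l
    using r that unfolding has_room_def by (meson order_trans)
  have "\<exists>W. {0 :: 'a} \<subseteq> W \<and> W \<subseteq> UNIV \<and> dimn n W"
    by (rule dimn_between[OF 0 _ csubspace_UNIV]) (use room in auto)
  then obtain V1 :: "'a set" where V1: "dimn n V1" by blast
  obtain x where x: "x \<notin> V1" using dimn_UNIV_ex[OF V1 has_room_mono[OF r]] by auto
  note U = dimn_insert[OF V1 x]
  obtain y where y: "y \<notin> cspan (insert x V1)" using dimn_UNIV_ex[OF U r] by blast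
  have xn: "x \<noteq> 0" using x complex_vector.subspace_0[OF dimn_csubspace[OF V1]] by blast
  have "cspan {x} \<subseteq> cspan (insert x V1)" by (rule complex_vector.span_mono) simp
  then have "y \<notin> cspan {x}" using y by blast
  then have d2: "dimn 2 (cspan (insert y (cspan {x})))"
    using dimn_insert[OF dimn_1_cspan[OF xn]] by (simp add: numeral_2_eq_2)
  have "\<exists>W. cspan (insert y (cspan {x})) \<subseteq> W \<and> W \<subseteq> UNIV \<and> dimn n W"
    by (rule dimn_between[OF d2 _ csubspace_UNIV]) (use room n in auto)
  then obtain V2 where V2: "cspan (insert y (cspan {x})) \<subseteq> V2" "dimn n V2" by blast
  have "y \<in> V2" using V2(1) subset_cspan_insert(2)[of y "cspan {x}"] by blast
  moreover have "x \<in> cspan {x}" by (rule complex_vector.span_base) simp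
  then have "x \<in> V2" using V2(1) subset_cspan_insert(1)[of "cspan {x}" y] by blast
  ultimately have xy: "x \<in> V2" "y \<in> V2" by blast+
  have "\<not> nb n V1 V2"
  proof
    assume nb: "nb n V1 V2"
    then have "dimn (Suc n) (cspan (V1 \<union> V2))" by (simp add: nb_def)
    moreover have "cspan (insert x V1) \<subseteq> cspan (V1 \<union> V2)" using xy by (intro complex_vector.span_mono) auto
    ultimately have "cspan (insert x V1) = cspan (V1 \<union> V2)" using dimn_eq[OF _ U] by blast
    then show False using y xy Un_subset_cspan[of V2 V1] by (metis Un_commute subsetD)
  qed
  moreover have "V1 \<noteq> V2" using xy x by blast
  ultimately show ?thesis using V1 V2 by blast
qed

lemma lines_nb:
  assumes "dimn 1 V1" "dimn 1 V2" "V1 \<noteq> V2" shows "nb 1 V1 V2"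
proof -
  have z: "dimn 0 {0}" by (simp add: dimn_0_iff)
  have "{0} \<subseteq> V1" "{0} \<subseteq> V2" using assms dimn_csubspace complex_vector.subspace_0 by blast+
  then show ?thesis using nb_of_common(1)[OF z, of V1 V2] assms by simp
qed

lemma orth_pair_one:
  assumes o: "orth_pair 1 m n' m' g (h :: 'a::chilbert_space set \<Rightarrow> 'a set)"
    and f: "fits TYPE('a) 1 m" "fits TYPE('a) n' m'"
  shows "n' = 1"
proof (rule ccontr)
  assume "n' \<noteq> 1"
  then have n2: "n' \<ge> 2" using f(2) by (simp add: fits_def)
  moreover have "has_room TYPE('a) (Suc (Suc n'))"
    using fits_room[OF f(2), of "Suc (Suc n')"] f(2) by (simp add: fits_def)
  ultimately have "\<exists>V1 V2 :: 'a set. dimn n' V1 \<and> dimn n' V2 \<and> V1 \<noteq> V2 \<and> \<not> nb n' V1 V2"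
    by (rule non_nb_exists)
  then obtain V1 V2 :: "'a set" where V: "dimn n' V1" "dimn n' V2" "V1 \<noteq> V2" "\<not> nb n' V1 V2"
    by (elim exE conjE)
  obtain U1 where U1: "dimn 1 U1" "g U1 = V1" using orth_pair_D(6)[OF o V(1)] by blast
  obtain U2 where U2: "dimn 1 U2" "g U2 = V2" using orth_pair_D(6)[OF o V(2)] by blast
  have "U1 \<noteq> U2" using U1 U2 V by blast
  then have "nb 1 U1 U2" by (rule lines_nb[OF U1(1) U2(1)])
  then have "nb n' (g U1) (g U2)" using nb_preserved[OF o f U1(1) U2(1)] by blast
  then show False using V U1 U2 by simp
qed

text \<open>Each descent removes one dimension on both sides, and by \<open>orth_pair_one\<close>
  both sides reach dimension 1 together. Containment of a line in \<open>V\<close> passes through an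
  intermediate subspace of dimension one less.\<close>

lemma orth_pair_lines:
  assumes "orth_pair n m n' m' g (h :: 'a::chilbert_space set \<Rightarrow> 'a set)"
    and "fits TYPE('a) n m" "fits TYPE('a) n' m'"
  shows "\<exists>\<gamma>. bij_betw \<gamma> {p. dimn 1 p} {p. dimn 1 p} \<and> (\<forall>p V. dimn 1 p \<longrightarrow> dimn n V \<longrightarrow> p \<subseteq> V \<longleftrightarrow> \<gamma> p \<subseteq> g V)"
  using assms
proof (induction n arbitrary: n' g)
  case 0
  then show ?case by (simp add: fits_def)
next
  case (Suc k)
  note o = Suc.prems(1) and f = Suc.prems(2,3)
  show ?case
  proof (cases "k = 0")
    case True
    then have n': "n' = 1" using orth_pair_one[of m n' m' g h] o f by simp
    have "p \<subseteq> V \<longleftrightarrow> g p \<subseteq> g V" if "dimn 1 p" "dimn (Suc k) V" for p V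
    proof -
      have "p \<subseteq> V \<longleftrightarrow> p = V" using dimn_eq[of 1 V p] that True by auto
      moreover have "g p \<subseteq> g V \<longleftrightarrow> g p = g V"
        using dimn_eq[of 1 "g V" "g p"] orth_pair_D(1)[OF o] that True n' by auto
      ultimately show ?thesis using orth_pair_D(4)[OF o, of p V] that True by auto
    qed
    then show ?thesis using o True n' unfolding orth_pair_def by (intro exI[of _ g]) simp
  next
    case False
    have "n' \<noteq> 1"
    proof
      assume "n' = 1"
      then have "Suc k = 1" using orth_pair_one[OF orth_pair_inverse[OF o[unfolded \<open>n' = 1\<close>]]] f by simp
      then show False using False by simp
    qed
    then obtain k' where k': "n' = Suc k'" "0 < k'" using f(2) by (cases n') (auto simp: fits_def)
    note o' = o[unfolded k'(1)] and f' = f(1) f(2)[unfolded k'(1)]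
    note desc = orth_pair_descend[OF o' f']
    have f2: "fits TYPE('a) k m" "fits TYPE('a) k' m'"
      using f' False k' fits_room[OF f'(1), of "k + m + 1"] fits_room[OF f'(2), of "k' + m' + 1"]
      by (simp_all add: fits_def)
    obtain \<gamma> where \<gamma>: "bij_betw \<gamma> {p. dimn 1 p} {p. dimn 1 p}"
      "\<And>p V. dimn 1 p \<Longrightarrow> dimn k V \<Longrightarrow> p \<subseteq> V \<longleftrightarrow> \<gamma> p \<subseteq> star_image (Suc k) g V"
      using Suc.IH[OF desc(1) f2] by blast
    have "p \<subseteq> V \<longleftrightarrow> \<gamma> p \<subseteq> g V" if p: "dimn 1 p" and V: "dimn (Suc k) V" for p V
    proof
      assume "p \<subseteq> V"
      then have "\<exists>K. p \<subseteq> K \<and> K \<subseteq> V \<and> dimn k K"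
        using False dimn_unique[OF V]
        by (intro dimn_between[OF p _ dimn_csubspace[OF V]]) fastforce+
      then show "\<gamma> p \<subseteq> g V" using \<gamma>(2)[OF p] desc(2)[OF _ V] by blast
    next
      have \<gamma>p: "dimn 1 (\<gamma> p)" using \<gamma>(1) p by (auto simp: bij_betw_def)
      have gV: "dimn (Suc k') (g V)" using orth_pair_D(1)[OF o' V] .
      assume "\<gamma> p \<subseteq> g V"
      then have "\<exists>K. \<gamma> p \<subseteq> K \<and> K \<subseteq> g V \<and> dimn k' K"
        using k'(2) dimn_unique[OF gV]
        by (intro dimn_between[OF \<gamma>p _ dimn_csubspace[OF gV]]) fastforce+
      then obtain K' where K': "\<gamma> p \<subseteq> K'" "K' \<subseteq> g V" "dimn k' K'" by blast
      obtain K where "dimn k K" "star_image (Suc k) g K = K'" using orth_pair_D(6)[OF desc(1) K'(3)] by blast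
      then show "p \<subseteq> V" using \<gamma>(2)[OF p] desc(2)[OF _ V] K' by blast
    qed
    then show ?thesis using \<gamma>(1) by blast
  qed
qed

lemma line_eq_cspan:
  assumes "dimn 1 p" "u \<in> p" "u \<noteq> 0" shows "p = cspan {u}"
proof -
  have "cspan {u} \<subseteq> p" using assms by (intro complex_vector.span_minimal dimn_csubspace) auto
  then show ?thesis using dimn_eq[OF assms(1) dimn_1_cspan[OF assms(3)]] by blast
qed

lemma line_generator: "dimn 1 p \<Longrightarrow> \<exists>u. u \<noteq> 0 \<and> p = cspan {u}"
proof -
  assume p: "dimn 1 p"
  have "p \<noteq> {0}" using dimn_unique[OF p, of 0] dimn_0_iff[of p] by auto
  then obtain u where "u \<in> p" "u \<noteq> 0" using complex_vector.subspace_0[OF dimn_csubspace[OF p]] by blast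
  then show ?thesis using line_eq_cspan[OF p] by blast
qed

lemma mem_cspan_singleton: "x \<in> cspan {u} \<longleftrightarrow> (\<exists>c. x = c *\<^sub>C u)"
  by (auto simp: complex_vector.span_singleton)

lemma corthogonal_line: "corthogonal (cspan {x}) V \<longleftrightarrow> (\<forall>v\<in>V. cinner x v = 0)"
proof
  assume "corthogonal (cspan {x}) V"
  then show "\<forall>v\<in>V. cinner x v = 0"
    using complex_vector.span_superset[of "{x}"] by (auto simp: corthogonal_def)
next
  assume "\<forall>v\<in>V. cinner x v = 0"
  then show "corthogonal (cspan {x}) V" by (intro corthogonal_cspan) (auto simp: corthogonal_def)
qed

lemma corthogonal_lines: "corthogonal (cspan {x}) (cspan {y}) \<longleftrightarrow> cinner x y = 0"
proof
  assume "corthogonal (cspan {x}) (cspan {y})"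
  then show "cinner x y = 0" unfolding corthogonal_line
    using complex_vector.span_superset[of "{y}"] by auto
next
  assume "cinner x y = 0"
  then show "corthogonal (cspan {x}) (cspan {y})"
    unfolding corthogonal_line using cspan_orth_right[of _ "{y}" x] by blast
qed

section \<open>Frames through given vectors and lines\<close>

context frames
begin

text \<open>\<open>x\<close> is placed first. Inserting \<open>y\<close> into slot \<open>j\<close>
  leaves \<open>x\<close> in slot \<open>i\<close> because the two are orthogonal, by the last
  clause of \<open>reach_vector\<close>.\<close>

lemma frame_through_vectors:
  fixes X :: "'i \<Rightarrow> 'a::chilbert_space set" and x y :: 'a
  assumes X: "X \<in> D" and ij: "i \<in> I" "j \<in> I" "i \<noteq> j" and xy: "cinner x y = 0"
  shows "\<exists>Z\<in>D. x \<in> Z i \<and> y \<in> Z j"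
proof -
  have "\<exists>Y. reach {} X Y \<and> {} \<subseteq> Y i \<and> x \<in> Y i
      \<and> (\<forall>m v. m \<noteq> i \<longrightarrow> v \<in> X m \<longrightarrow> cinner v x = 0 \<longrightarrow> v \<in> Y m)"
    by (rule reach_vector[OF X ij(1)]) (use D_ex[OF X ij(1)] in auto)
  then obtain Y where Y: "reach {} X Y" "x \<in> Y i" by blast
  note YD = reach_D[OF Y(1) X]
  have "\<exists>Z. reach {} Y Z \<and> {} \<subseteq> Z j \<and> y \<in> Z j
      \<and> (\<forall>m v. m \<noteq> j \<longrightarrow> v \<in> Y m \<longrightarrow> cinner v y = 0 \<longrightarrow> v \<in> Z m)"
    by (rule reach_vector[OF YD ij(2)]) (use D_ex[OF YD ij(2)] in auto)
  then obtain Z where Z: "reach {} Y Z" "y \<in> Z j" "x \<in> Z i" using Y(2) ij(3) xy by blast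
  then show ?thesis using reach_D[OF Z(1) YD] by blast
qed

lemma frame_through_line:
  assumes X: "X \<in> D" and st: "s \<in> I" "s \<noteq> t" and p: "dimn 1 p" and o: "corthogonal p (X t)"
  shows "\<exists>Z\<in>D. p \<subseteq> Z s \<and> Z t = X t"
proof -
  have "\<exists>Y. reach {t} X Y \<and> p \<subseteq> Y s"
  proof (rule reach_subspace[OF X st(1) _ p])
    show "enat 1 \<le> n s" using n_pos[OF st(1)] by (cases "n s") (auto simp: zero_enat_def)
    show "cinner z v = 0" if "t' \<in> {t}" "z \<in> X t'" "v \<in> p" for t' z v
      using o that cinner_eq_0_commute[of v z] by (auto simp: corthogonal_def)
  qed (use st in simp)
  then obtain Y where Y: "reach {t} X Y" "p \<subseteq> Y s" by blast
  then show ?thesis using reach_D[OF Y(1) X] reach_agree[OF Y(1), of t] by auto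
qed

end

section \<open>One isometry inducing all slot maps\<close>

locale slot_isomorphism = frames I n for I :: "'i set" and n :: "'i \<Rightarrow> enat" +
  fixes \<delta> :: "'i \<Rightarrow> 'i" and g :: "'i \<Rightarrow> 'a::chilbert_space set \<Rightarrow> 'a set"
  assumes card_I: "card I \<ge> 3" and D_nonempty: "(D :: ('i \<Rightarrow> 'a set) set) \<noteq> {}"
    and dim_sum: "(\<Sum>i\<in>I. n i) = cdim (UNIV :: 'a set)"
    and perm: "\<delta> permutes I"
    and g_bij: "i \<in> I \<Longrightarrow> bij_betw (g i) (slot i) (slot (\<delta> i))"
    and g_orth: "i \<in> I \<Longrightarrow> j \<in> I \<Longrightarrow> V \<in> slot i \<Longrightarrow> W \<in> slot j \<Longrightarrow> i \<noteq> j \<Longrightarrow>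
      corthogonal V W \<longleftrightarrow> corthogonal (g i V) (g j W)"
begin

lemma \<delta>_I: "i \<in> I \<Longrightarrow> \<delta> i \<in> I"
  using permutes_in_image[OF perm] by blast

lemma \<delta>_neq: "i \<noteq> j \<Longrightarrow> \<delta> i \<noteq> \<delta> j"
  using permutes_inj[OF perm] by (auto dest: injD)

lemma third_index: "\<exists>k\<in>I. k \<noteq> i \<and> k \<noteq> j"
proof -
  have "card {i, j} < card I" using card_I card_insert_le_m1[of 2 "{j}" i] by simp
  then show ?thesis
    by (metis card_mono finite.emptyI finite_insert insertCI linorder_not_less subsetI)
qed

lemma g_slot: "i \<in> I \<Longrightarrow> V \<in> slot i \<Longrightarrow> g i V \<in> slot (\<delta> i)"
  using g_bij[of i] by (auto simp: bij_betw_def)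

lemma g_surj: "i \<in> I \<Longrightarrow> W \<in> slot (\<delta> i) \<Longrightarrow> \<exists>V\<in>slot i. g i V = W"
  using g_bij[of i] unfolding bij_betw_def by (metis imageE)

lemma slot_mem: "X \<in> D \<Longrightarrow> X i \<in> slot i"
  by (simp add: slot_def)

lemma slot_finite:
  assumes i: "i \<in> I" and k: "n i = enat k" shows "(slot i :: 'a set set) = {V. dimn k V}"
proof (intro set_eqI iffI)
  fix V :: "'a set" assume "V \<in> slot i"
  then show "V \<in> {V. dimn k V}" using D_dimn[OF _ i k] by (auto simp: slot_def)
next
  fix V :: "'a set" assume V: "V \<in> {V. dimn k V}"
  obtain X :: "'i \<Rightarrow> 'a set" where X: "X \<in> D" using D_nonempty by blast
  have "\<exists>Y. reach {} X Y \<and> Y i = V"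
    by (rule reach_equal[OF X i _ _ k]) (use V in auto)
  then obtain Y where Y: "reach {} X Y" "Y i = V" by blast
  then show "V \<in> slot i" using slot_mem[OF reach_D[OF Y(1) X], of i] by simp
qed

text \<open>If a finite slot \<open>i\<close> went to the infinite slot \<open>k\<close>, any two
  members of slot \<open>k\<close> would have a common orthogonal partner in slot
  \<open>\<delta> j\<close>, since two finite-dimensional subspaces fit into one infinite slot. But
  \<open>X k\<close> and a \<open>Y k\<close> containing the complement of \<open>X k\<close> have
  no nonzero vector orthogonal to both.\<close>

lemma \<delta>_infinite:
  assumes k: "k \<in> I" "n k = \<infinity>" shows "\<delta> k = k"
proof (rule ccontr)
  assume ne: "\<delta> k \<noteq> k"
  define i where "i = inv \<delta> k"
  have \<delta>i: "\<delta> i = k" using permutes_inverses(1)[OF perm] by (simp add: i_def)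
  have i: "i \<in> I" "i \<noteq> k" using \<delta>i ne k permutes_in_image[OF perm, of i] by auto
  obtain j where j: "j \<in> I" "j \<noteq> i" "j \<noteq> k" using third_index by blast
  have fin: "n i \<noteq> \<infinity>" using one_inf[OF i(1) k(1)] k i by blast
  then obtain l where l: "n i = enat l" by auto
  obtain X :: "'i \<Rightarrow> 'a set" where X: "X \<in> D" using D_nonempty by blast
  have *: "\<exists>W\<in>slot (\<delta> j). corthogonal V W \<and> corthogonal V' W" if V: "V \<in> slot k" "V' \<in> slot k" for V V' :: "'a set"
  proof -
    obtain U where U: "U \<in> slot i" "g i U = V" using g_surj[OF i(1)] V(1) \<delta>i by auto
    obtain U' where U': "U' \<in> slot i" "g i U' = V'" using g_surj[OF i(1)] V(2) \<delta>i by auto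
    obtain m where m: "dimn m (cspan (U \<union> U'))"
      using dimn_cspan_Un U(1) U'(1) unfolding slot_finite[OF i(1) l] by blast
    have "\<exists>Y. reach {} X Y \<and> cspan (U \<union> U') \<subseteq> Y k"
      by (rule reach_subspace[OF X k(1) _ m]) (use k in auto)
    then obtain Y where Y: "reach {} X Y" "cspan (U \<union> U') \<subseteq> Y k" by blast
    note YD = reach_D[OF Y(1) X]
    have "U \<subseteq> Y k" "U' \<subseteq> Y k" using Y(2) Un_subset_cspan by blast+
    then have "corthogonal U (Y j)" "corthogonal U' (Y j)"
      using D_orth[OF YD not_sym[OF j(3)]] by (auto simp: corthogonal_def)
    then show ?thesis
      using g_orth[OF i(1) j(1) U(1) slot_mem[OF YD] not_sym[OF j(2)]]
        g_orth[OF i(1) j(1) U'(1) slot_mem[OF YD] not_sym[OF j(2)]]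
        g_slot[OF j(1) slot_mem[OF YD]] U U' by blast
  qed
  have "cdim (corth_comp (X k)) \<noteq> \<infinity>"
    using cofinite_corth_comp[OF X k] by (simp only: ccodim_def not_False_eq_True)
  then have "\<exists>m. dimn m (corth_comp (X k))"
    unfolding cdim_infinite_iff[OF csubspace_corth_comp] by simp
  then obtain m where m: "dimn m (corth_comp (X k))" by (rule exE)
  have "\<exists>Y. reach {} X Y \<and> corth_comp (X k) \<subseteq> Y k"
    by (rule reach_subspace[OF X k(1) _ m]) (use k in auto)
  then obtain Y where Y: "reach {} X Y" "corth_comp (X k) \<subseteq> Y k" by blast
  note YD = reach_D[OF Y(1) X]
  obtain W where W: "W \<in> slot (\<delta> j)" "corthogonal (X k) W" "corthogonal (Y k) W"
    using *[OF slot_mem[OF X] slot_mem[OF YD]] by blast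
  obtain Z where Z: "Z \<in> D" "W = Z (\<delta> j)" using W(1) by (auto simp: slot_def)
  obtain w where w: "w \<in> W" "w \<noteq> 0" using D_ex[OF Z(1) \<delta>_I[OF j(1)]] Z(2) by blast
  have "w \<in> corth_comp (X k)" using W(2) w by (auto simp: corthogonal_def corth_comp_def)
  then have "w \<in> Y k" using Y(2) by blast
  then have "cinner w w = 0" using W(3) w(1) unfolding corthogonal_def by blast
  then show False using w by simp
qed

lemma \<delta>_finite: "i \<in> I \<Longrightarrow> n i \<noteq> \<infinity> \<Longrightarrow> n (\<delta> i) \<noteq> \<infinity>"
  using \<delta>_infinite[OF \<delta>_I, of i] \<delta>_neq[of "\<delta> i" i] by metis

lemma fits_slots:
  assumes ij: "i \<in> I" "j \<in> I" "i \<noteq> j" and ab: "n i = enat a" "n j = enat b"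
  shows "fits TYPE('a) a b"
proof -
  obtain k where k: "k \<in> I" "k \<noteq> i" "k \<noteq> j" using third_index by blast
  have "a + b + 1 \<le> l" if l: "dimn l (UNIV :: 'a set)" for l
  proof -
    have "sum n {i, j, k} \<le> sum n I" using ij k finite_I by (intro sum_mono2) auto
    also have "sum n I = enat l" using dim_sum dimn_iff_cdim[OF csubspace_UNIV] l by metis
    finally have s: "n i + (n j + n k) \<le> enat l" using ij k by (simp add: add.assoc)
    obtain c where c: "n k = enat c" using s by (cases "n k") auto
    then have "0 < c" using n_pos[OF k(1)] by (simp add: zero_enat_def)
    then show ?thesis using s ab c by simp
  qed
  moreover have "0 < a" "0 < b" using n_pos[OF ij(1)] n_pos[OF ij(2)] ab by (simp_all add: zero_enat_def)
  ultimately show ?thesis by (auto simp: fits_def has_room_def)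
qed

definition line_map :: "'i \<Rightarrow> ('a set \<Rightarrow> 'a set) \<Rightarrow> bool" where
  "line_map s \<gamma> \<longleftrightarrow> bij_betw \<gamma> {p. dimn 1 p} {p. dimn 1 p} \<and>
    (\<forall>p. \<forall>V\<in>slot s. dimn 1 p \<longrightarrow> p \<subseteq> V \<longleftrightarrow> \<gamma> p \<subseteq> g s V)"

lemma line_mapD:
  assumes "line_map s \<gamma>"
  shows "dimn 1 p \<Longrightarrow> dimn 1 (\<gamma> p)" "dimn 1 p \<Longrightarrow> V \<in> slot s \<Longrightarrow> \<gamma> p \<subseteq> g s V \<longleftrightarrow> p \<subseteq> V"
  using assms by (auto simp: line_map_def bij_betw_def)

lemma line_map_exists:
  assumes st: "s \<in> I" "t \<in> I" "s \<noteq> t" and fin: "n s \<noteq> \<infinity>" "n t \<noteq> \<infinity>"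
  shows "\<exists>\<gamma>. line_map s \<gamma>"
proof -
  obtain a b where ab: "n s = enat a" "n t = enat b" using fin by auto
  obtain a' b' where ab': "n (\<delta> s) = enat a'" "n (\<delta> t) = enat b'" using \<delta>_finite st fin by force
  note sl = slot_finite[OF st(1) ab(1)] slot_finite[OF st(2) ab(2)]
    slot_finite[OF \<delta>_I[OF st(1)] ab'(1)] slot_finite[OF \<delta>_I[OF st(2)] ab'(2)]
  have "orth_pair a b a' b' (g s) (g t)"
    using g_bij[OF st(1)] g_bij[OF st(2)] g_orth[OF st(1,2) _ _ st(3)]
    unfolding orth_pair_def sl by auto
  then obtain \<gamma> where "bij_betw \<gamma> {p. dimn 1 p} {p. dimn 1 p}"
      "\<forall>p V. dimn 1 p \<longrightarrow> dimn a V \<longrightarrow> p \<subseteq> V \<longleftrightarrow> \<gamma> p \<subseteq> g s V"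
    using orth_pair_lines[OF _ fits_slots[OF st ab] fits_slots[OF \<delta>_I[OF st(1)] \<delta>_I[OF st(2)] \<delta>_neq[OF st(3)] ab']]
    by metis
  then show ?thesis unfolding line_map_def sl(1) by (intro exI[of _ \<gamma>]) simp
qed

text \<open>\<open>p\<close> and \<open>V\<close> are orthogonal exactly when some frame has
  \<open>p\<close> inside slot \<open>s\<close> and \<open>V\<close> as slot \<open>t\<close>; this
  is transported both ways. Here slot \<open>t\<close> may be infinite.\<close>

lemma line_map_orth:
  assumes \<gamma>: "line_map s \<gamma>" and st: "s \<in> I" "t \<in> I" "s \<noteq> t" and p: "dimn 1 p" and V: "V \<in> slot t"
  shows "corthogonal (\<gamma> p) (g t V) \<longleftrightarrow> corthogonal p V"
proof
  assume o: "corthogonal p V"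
  obtain X where X: "X \<in> D" "V = X t" using V by (auto simp: slot_def)
  obtain Z where Z: "Z \<in> D" "p \<subseteq> Z s" "Z t = V"
    using frame_through_line[OF X(1) st(1,3) p] o X(2) by blast
  have "corthogonal (Z s) V" using D_orth[OF Z(1) st(3)] Z(3) by (auto simp: corthogonal_def)
  then have "corthogonal (g s (Z s)) (g t V)"
    using g_orth[OF st(1,2) slot_mem[OF Z(1)] V st(3)] by blast
  moreover have "\<gamma> p \<subseteq> g s (Z s)" using line_mapD(2)[OF \<gamma> p slot_mem[OF Z(1)]] Z(2) by blast
  ultimately show "corthogonal (\<gamma> p) (g t V)" by (rule corthogonal_mono)
next
  assume o: "corthogonal (\<gamma> p) (g t V)"
  obtain X where X: "X \<in> D" "g t V = X (\<delta> t)" using g_slot[OF st(2) V] by (auto simp: slot_def)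
  obtain Z where Z: "Z \<in> D" "\<gamma> p \<subseteq> Z (\<delta> s)" "Z (\<delta> t) = g t V"
    using frame_through_line[OF X(1) \<delta>_I[OF st(1)] \<delta>_neq[OF st(3)] line_mapD(1)[OF \<gamma> p]] o X(2) by auto
  obtain U where U: "U \<in> slot s" "g s U = Z (\<delta> s)" using g_surj[OF st(1) slot_mem[OF Z(1)]] by blast
  have "corthogonal (g s U) (g t V)"
    using D_orth[OF Z(1) \<delta>_neq[OF st(3)]] Z(3) U(2) by (auto simp: corthogonal_def)
  then have "corthogonal U V" using g_orth[OF st(1,2) U(1) V st(3)] by blast
  moreover have "p \<subseteq> U" using line_mapD(2)[OF \<gamma> p U(1)] U(2) Z(2) by blast
  ultimately show "corthogonal p V" by (rule corthogonal_mono)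
qed

text \<open>Lines are compared through frames containing them in different slots, hence the two line
  maps. Orthogonality under a single map follows once \<open>line_map_unique\<close> identifies
  them.\<close>

lemma line_map_pair_orth:
  assumes \<gamma>: "line_map s \<gamma>" and \<gamma>': "line_map t \<gamma>'" and st: "s \<in> I" "t \<in> I" "s \<noteq> t"
    and p: "dimn 1 p" and q: "dimn 1 q"
  shows "corthogonal (\<gamma> p) (\<gamma>' q) \<longleftrightarrow> corthogonal p q"
proof -
  obtain X0 :: "'i \<Rightarrow> 'a set" where X0: "X0 \<in> D" using D_nonempty by blast
  have frame: "\<exists>Z\<in>D. p \<subseteq> Z i \<and> q \<subseteq> Z j"
    if pq: "dimn 1 p" "dimn 1 q" "corthogonal p q" and ij: "i \<in> I" "j \<in> I" "i \<noteq> j" for p q :: "'a set" and i j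
  proof -
    obtain u where u: "p = cspan {u}" using line_generator[OF pq(1)] by blast
    obtain v where v: "q = cspan {v}" using line_generator[OF pq(2)] by blast
    have "cinner u v = 0" using pq(3) unfolding u v corthogonal_lines .
    then obtain Z where Z: "Z \<in> D" "u \<in> Z i" "v \<in> Z j" using frame_through_vectors[OF X0 ij] by blast
    then show ?thesis unfolding u v
      using complex_vector.span_minimal[OF _ D_sub[OF Z(1)]] by (metis empty_subsetI insert_subset)
  qed
  show ?thesis
  proof
    assume "corthogonal p q"
    then obtain Z where Z: "Z \<in> D" "p \<subseteq> Z s" "q \<subseteq> Z t" using frame[OF p q _ st] by blast
    have "corthogonal (Z s) (Z t)" using D_orth[OF Z(1) st(3)] by (auto simp: corthogonal_def)
    then have "corthogonal (g s (Z s)) (g t (Z t))"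
      using g_orth[OF st(1,2) slot_mem[OF Z(1)] slot_mem[OF Z(1)] st(3)] by blast
    moreover have "\<gamma> p \<subseteq> g s (Z s)" "\<gamma>' q \<subseteq> g t (Z t)"
      using line_mapD(2)[OF \<gamma> p slot_mem[OF Z(1)]] line_mapD(2)[OF \<gamma>' q slot_mem[OF Z(1)]] Z(2,3) by blast+
    ultimately show "corthogonal (\<gamma> p) (\<gamma>' q)" unfolding corthogonal_def by blast
  next
    assume "corthogonal (\<gamma> p) (\<gamma>' q)"
    then obtain Z where Z: "Z \<in> D" "\<gamma> p \<subseteq> Z (\<delta> s)" "\<gamma>' q \<subseteq> Z (\<delta> t)"
      using frame[OF line_mapD(1)[OF \<gamma> p] line_mapD(1)[OF \<gamma>' q] _ \<delta>_I[OF st(1)] \<delta>_I[OF st(2)] \<delta>_neq[OF st(3)]] by blast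
    obtain U where U: "U \<in> slot s" "g s U = Z (\<delta> s)" using g_surj[OF st(1) slot_mem[OF Z(1)]] by blast
    obtain W where W: "W \<in> slot t" "g t W = Z (\<delta> t)" using g_surj[OF st(2) slot_mem[OF Z(1)]] by blast
    have "corthogonal (g s U) (g t W)"
      using D_orth[OF Z(1) \<delta>_neq[OF st(3)]] U(2) W(2) by (auto simp: corthogonal_def)
    then have "corthogonal U W" using g_orth[OF st(1,2) U(1) W(1) st(3)] by blast
    moreover have "p \<subseteq> U" "q \<subseteq> W"
      using line_mapD(2)[OF \<gamma> p U(1)] line_mapD(2)[OF \<gamma>' q W(1)] U(2) W(2) Z(2,3) by blast+
    ultimately show "corthogonal p q" unfolding corthogonal_def by blast
  qed
qed

text \<open>Both image lines are orthogonal to the same images of members of a third slot. If they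
  differed, the component of \<open>v\<close> orthogonal to \<open>u\<close> could be placed in the
  image of that slot, with \<open>u\<close> in slot \<open>\<delta> s\<close>; the member containing
  it would be orthogonal to one line but not to the other.\<close>

lemma line_map_unique:
  assumes \<gamma>: "line_map s \<gamma>" and \<gamma>': "line_map t \<gamma>'" and st: "s \<in> I" "t \<in> I" "s \<noteq> t" and p: "dimn 1 p"
  shows "\<gamma>' p = \<gamma> p"
proof -
  obtain r where r: "r \<in> I" "r \<noteq> s" "r \<noteq> t" using third_index by blast
  obtain X0 :: "'i \<Rightarrow> 'a set" where X0: "X0 \<in> D" using D_nonempty by blast
  have l: "dimn 1 (\<gamma> p)" "dimn 1 (\<gamma>' p)" using line_mapD(1) \<gamma> \<gamma>' p by blast+
  obtain u where u: "u \<noteq> 0" "\<gamma> p = cspan {u}" using line_generator[OF l(1)] by blast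
  obtain v where v: "v \<noteq> 0" "\<gamma>' p = cspan {v}" using line_generator[OF l(2)] by blast
  obtain w where w: "w \<in> cspan {u}" "\<forall>y\<in>cspan {u}. cinner y (v - w) = 0"
    using dimn_orth_proj l(1) unfolding u(2) by metis
  have "v - w = 0"
  proof (rule ccontr)
    assume nz: "v - w \<noteq> 0"
    have "cinner u (v - w) = 0" using w complex_vector.span_base[of u "{u}"] by blast
    then obtain Z where Z: "Z \<in> D" "u \<in> Z (\<delta> s)" "v - w \<in> Z (\<delta> r)"
      using frame_through_vectors[OF X0 \<delta>_I[OF st(1)] \<delta>_I[OF r(1)] \<delta>_neq[OF not_sym[OF r(2)]]] by blast
    obtain V where V: "V \<in> slot r" "g r V = Z (\<delta> r)" using g_surj[OF r(1) slot_mem[OF Z(1)]] by blast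
    have "corthogonal (\<gamma> p) (g r V)" unfolding u(2) V(2) corthogonal_line
      using D_orth[OF Z(1) \<delta>_neq[OF not_sym[OF r(2)]] Z(2)] by blast
    then have "corthogonal p V" using line_map_orth[OF \<gamma> st(1) r(1) not_sym[OF r(2)] p V(1)] by blast
    then have "corthogonal (\<gamma>' p) (g r V)" using line_map_orth[OF \<gamma>' st(2) r(1) not_sym[OF r(3)] p V(1)] by blast
    then have "cinner v (v - w) = 0" unfolding v(2) V(2) corthogonal_line using Z(3) by blast
    moreover have "cinner w (v - w) = 0" using w by blast
    ultimately have "cinner (v - w) (v - w) = 0" unfolding cinner_diff_left[of v w] by simp
    then show False using nz by simp
  qed
  then have "v \<in> \<gamma> p" using w(1) u(2) by simp
  then show ?thesis using line_eq_cspan[OF l(1) _ v(1)] v(2) by simp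
qed

theorem slots_isometry:
  "\<exists>U. (unitary U \<or> antiunitary U) \<and> (\<forall>t\<in>I. \<forall>V\<in>slot t. g t V = U ` V)"
proof -
  have "\<exists>s t. s \<in> I \<and> t \<in> I \<and> s \<noteq> t \<and> n s \<noteq> \<infinity> \<and> n t \<noteq> \<infinity>"
  proof (cases "\<exists>k\<in>I. n k = \<infinity>")
    case True
    then obtain k where k: "k \<in> I" "n k = \<infinity>" by blast
    obtain s where s: "s \<in> I" "s \<noteq> k" using third_index by blast
    obtain t where t: "t \<in> I" "t \<noteq> k" "t \<noteq> s" using third_index by blast
    then show ?thesis using one_inf[OF _ k(1)] k(2) s by metis
  next
    case False
    obtain s where s: "s \<in> I" using third_index by blast
    obtain t where t: "t \<in> I" "t \<noteq> s" using third_index by blast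
    show ?thesis using s t False by (intro exI[of _ s] exI[of _ t]) auto
  qed
  then obtain s t where st: "s \<in> I" "t \<in> I" "s \<noteq> t" and fin: "n s \<noteq> \<infinity>" "n t \<noteq> \<infinity>" by blast
  obtain \<gamma> where \<gamma>: "line_map s \<gamma>" using line_map_exists[OF st fin] by blast
  obtain \<gamma>' where \<gamma>': "line_map t \<gamma>'" using line_map_exists[OF st(2,1) not_sym[OF st(3)] fin(2,1)] by blast
  have eq: "\<gamma>' p = \<gamma> p" if "dimn 1 p" for p by (rule line_map_unique[OF \<gamma> \<gamma>' st that])
  define \<psi> where "\<psi> x = (SOME u. u \<noteq> 0 \<and> \<gamma> (cspan {x}) = cspan {u})" for x
  have \<psi>: "\<psi> x \<noteq> 0 \<and> \<gamma> (cspan {x}) = cspan {\<psi> x}" if "x \<noteq> 0" for x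
    unfolding \<psi>_def
    by (rule someI_ex) (rule line_generator[OF line_mapD(1)[OF \<gamma> dimn_1_cspan[OF that]]])
  obtain a b where ab: "n s = enat a" "n t = enat b" using fin by auto
  have f: "fits TYPE('a) a b" by (rule fits_slots[OF st ab])
  then have room: "has_room TYPE('a) 3" using fits_room[OF f, of 3] by (simp add: fits_def)
  interpret orth_bijection \<psi>
  proof
    show "\<psi> x \<noteq> 0" if "x \<noteq> 0" for x using \<psi> that by blast
    \<comment> \<open>One line is mapped through slot \<open>s\<close> and the other through slot
      \<open>t\<close>; \<open>eq\<close> identifies the two maps.\<close>
    show "cinner (\<psi> x) (\<psi> y) = 0 \<longleftrightarrow> cinner x y = 0" if "x \<noteq> 0" "y \<noteq> 0" for x y
      using line_map_pair_orth[OF \<gamma> \<gamma>' st dimn_1_cspan[OF that(1)] dimn_1_cspan[OF that(2)]]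
      unfolding eq[OF dimn_1_cspan[OF that(2)]] \<psi>[OF that(1), THEN conjunct2] \<psi>[OF that(2), THEN conjunct2]
        corthogonal_lines .
    show "\<exists>x c. x \<noteq> 0 \<and> \<psi> x = c *\<^sub>C z" if z: "z \<noteq> 0" for z
    proof -
      have "cspan {z} \<in> \<gamma> ` {p. dimn 1 p}"
        using \<gamma> dimn_1_cspan[OF z] unfolding line_map_def bij_betw_def by blast
      then obtain p where p: "dimn 1 p" "\<gamma> p = cspan {z}" by auto
      obtain x where x: "x \<noteq> 0" "p = cspan {x}" using line_generator[OF p(1)] by blast
      have "\<psi> x \<in> cspan {\<psi> x}" by (rule complex_vector.span_base) simp
      then have "\<psi> x \<in> cspan {z}" using \<psi>[OF x(1)] p x by simp
      then show ?thesis using x(1) unfolding mem_cspan_singleton by blast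
    qed
    show "\<exists>z. z \<noteq> 0 \<and> cinner x z = 0 \<and> cinner y z = 0" for x y :: 'a
    proof -
      obtain k where k: "k \<le> card {x, y}" "dimn k (cspan {x, y})" using dimn_cspan_finite[of "{x, y}"] by auto
      have "Suc k \<le> 3" using k(1) card_insert_le_m1[of 2 "{y}" x] by simp
      then obtain w where w: "w \<notin> cspan {x, y}" using dimn_UNIV_ex[OF k(2) has_room_mono[OF room]] by blast
      obtain v where v: "v \<in> cspan {x, y}" "\<forall>u\<in>cspan {x, y}. cinner u (w - v) = 0"
        using dimn_orth_proj[OF k(2)] by blast
      have "x \<in> cspan {x, y}" "y \<in> cspan {x, y}" by (rule complex_vector.span_base, simp)+
      then show ?thesis using v w by (intro exI[of _ "w - v"]) auto
    qed
  qed
  obtain U where U': "(unitary U \<or> antiunitary U) \<and> (\<forall>x. x \<noteq> 0 \<longrightarrow> (\<exists>c. c \<noteq> 0 \<and> U x = c *\<^sub>C \<psi> x))"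
    using induced_by_isometry by (rule exE)
  then have U: "unitary U \<or> antiunitary U" "\<And>x. x \<noteq> 0 \<Longrightarrow> \<exists>c. c \<noteq> 0 \<and> U x = c *\<^sub>C \<psi> x"
    by auto
  have U_add: "U (x + y) = U x + U y" for x y using U(1) by (auto simp: unitary_def antiunitary_def)
  have U_surj: "\<exists>x. U x = y" for y using U(1) unfolding unitary_def antiunitary_def surj_def by metis
  have U_orth: "cinner (U x) (U y) = 0 \<longleftrightarrow> cinner x y = 0" for x y
    using U(1) by (auto simp: unitary_def antiunitary_def)
  have U_0: "U 0 = 0" using U_add[of 0 0] by simp
  have "g r V = U ` V" if r: "r \<in> I" and V: "V \<in> slot r" for r V
  proof -
    \<comment> \<open>Orthogonality to slot \<open>r\<close> is tested by lines in another slot;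
      \<open>\<gamma>\<close> is a line map for both \<open>s\<close> and \<open>t\<close>, one of
      which differs from \<open>r\<close>.\<close>
    obtain q where q: "q \<in> I" "q \<noteq> r" "line_map q \<gamma>"
    proof (cases "r = s")
      case False then show ?thesis using that[of s] st \<gamma> by blast
    next
      case True
      have "line_map t \<gamma>" using \<gamma> \<gamma>' eq unfolding line_map_def by metis
      then show ?thesis using that[of t] st True by blast
    qed
    have perp: "(\<forall>v\<in>g r V. cinner (U x) v = 0) \<longleftrightarrow> (\<forall>v\<in>V. cinner x v = 0)" for x
    proof (cases "x = 0")
      case True then show ?thesis by (simp add: U_0)
    next
      case False
      obtain c where c: "c \<noteq> 0" "U x = c *\<^sub>C \<psi> x" using U(2)[OF False] by blast
      have "(\<forall>v\<in>g r V. cinner (U x) v = 0) \<longleftrightarrow> corthogonal (\<gamma> (cspan {x})) (g r V)"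
        unfolding \<psi>[OF False, THEN conjunct2] corthogonal_line using c by (simp add: cinner_scaleC_left)
      also have "\<dots> \<longleftrightarrow> corthogonal (cspan {x}) V"
        by (rule line_map_orth[OF q(3,1) r q(2) dimn_1_cspan[OF False] V])
      finally show ?thesis unfolding corthogonal_line .
    qed
    obtain X where X: "X \<in> D" "V = X r" using V by (auto simp: slot_def)
    obtain Y where Y: "Y \<in> D" "g r V = Y (\<delta> r)" using g_slot[OF r V] by (auto simp: slot_def)
    \<comment> \<open>\<open>V\<close> may be infinite-dimensional, so it is recovered from its
      orthogonal vectors: membership means a zero residual, and the residual is a vector to which
      \<open>perp\<close> applies.\<close>
    have residual: "z - cproj (Z i) z = 0 \<longleftrightarrow> z \<in> Z i" "\<And>v. v \<in> Z i \<Longrightarrow> cinner (z - cproj (Z i) z) v = 0"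
      "cinner (z - cproj (Z i) z) z = cinner (z - cproj (Z i) z) (z - cproj (Z i) z)"
      if "Z \<in> D" "i \<in> I" for Z :: "'i \<Rightarrow> 'a set" and i z
    proof -
      have orth: "cinner v (z - cproj (Z i) z) = 0" if "v \<in> Z i" for v
        using cproj_cinner[OF \<open>Z \<in> D\<close> \<open>i \<in> I\<close> that, of z] by (simp add: cinner_diff_right)
      then show *: "cinner (z - cproj (Z i) z) v = 0" if "v \<in> Z i" for v using that cinner_eq_0_commute by blast
      show "z - cproj (Z i) z = 0 \<longleftrightarrow> z \<in> Z i"
      proof
        assume "z - cproj (Z i) z = 0"
        then show "z \<in> Z i" using cproj_mem[OF that] by (metis eq_iff_diff_eq_0)
      next
        assume "z \<in> Z i"
        then have "z - cproj (Z i) z \<in> Z i"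
          using cproj_mem[OF that] D_diff[OF that(1)] by blast
        then show "z - cproj (Z i) z = 0" using orth cinner_self_eq_0 by blast
      qed
      show "cinner (z - cproj (Z i) z) z = cinner (z - cproj (Z i) z) (z - cproj (Z i) z)"
        using *[OF cproj_mem[OF that]] by (simp add: cinner_diff_right[of "z - cproj (Z i) z" z])
    qed
    show ?thesis
    proof (intro set_eqI iffI)
      fix z assume z: "z \<in> g r V"
      obtain x where x: "U x = z" using U_surj by blast
      define e where "e = x - cproj (X r) x"
      have "\<forall>v\<in>V. cinner e v = 0" using residual(2)[OF X(1) r] X(2) by (simp add: e_def)
      then have "cinner (U e) (U x) = 0" using perp[of e] z x by blast
      then have "cinner e e = 0" using U_orth residual(3)[OF X(1) r, of x] by (simp add: e_def)
      then have "x \<in> V" using residual(1)[OF X(1) r, of x] X(2) by (simp add: e_def)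
      then show "z \<in> U ` V" using x by blast
    next
      fix z assume "z \<in> U ` V"
      then obtain x where x: "x \<in> V" "z = U x" by blast
      define e where "e = z - cproj (Y (\<delta> r)) z"
      obtain y where y: "U y = e" using U_surj by blast
      have "\<forall>v\<in>g r V. cinner (U y) v = 0"
        using residual(2)[OF Y(1) \<delta>_I[OF r]] Y(2) y by (simp add: e_def)
      then have "cinner y x = 0" using perp[of y] x(1) by blast
      then have "cinner e z = 0" using U_orth[of y x] y x by simp
      then have "cinner e e = 0" using residual(3)[OF Y(1) \<delta>_I[OF r], of z] by (simp add: e_def)
      then show "z \<in> g r V" using residual(1)[OF Y(1) \<delta>_I[OF r], of z] Y(2) by (simp add: e_def)
    qed
  qed
  then show ?thesis using U(1) by blast
qed

end

section \<open>Adjoints and conjugation of spectral operators\<close>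

lemma cinner_ext: "(\<And>x. cinner x y = cinner x z) \<Longrightarrow> y = z"
  by (metis cinner_diff_right cinner_self_eq_0 eq_iff_diff_eq_0)

text \<open>\<open>inv U\<close> witnesses the choice in \<open>cadjoint\<close>, and nondegeneracy
  of the inner product determines the chosen value.\<close>

lemma cadjoint_unitary:
  assumes U: "unitary U" shows "cadjoint U (U y) = y"
proof -
  have "\<forall>x y. cinner (U x) y = cinner x (cadjoint U y)"
    unfolding cadjoint_def
  proof (rule someI[where x = "inv U"], intro allI)
    fix x y
    have "surj U" using U by (simp add: unitary_def)
    then have "U (inv U y) = y" by (rule surj_f_inv_f)
    then show "cinner (U x) y = cinner x (inv U y)" using U by (metis unitary_def)
  qed
  then show ?thesis using U by (intro cinner_ext) (metis unitary_def)
qed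

lemma conj_adjoint_antiunitary:
  assumes U: "antiunitary U" shows "conj_adjoint U (U y) = y"
proof -
  have "\<forall>x y. cinner (U x) y = cnj (cinner x (conj_adjoint U y))"
    unfolding conj_adjoint_def
  proof (rule someI[where x = "inv U"], intro allI)
    fix x y
    have "surj U" using U by (simp add: antiunitary_def)
    then have "U (inv U y) = y" by (rule surj_f_inv_f)
    then show "cinner (U x) y = cnj (cinner x (inv U y))" using U by (metis antiunitary_def)
  qed
  then show ?thesis using U by (intro cinner_ext) (metis antiunitary_def complex_cnj_cancel_iff)
qed

lemma isometry_semilinear:
  assumes "unitary U \<or> antiunitary U"
  shows "\<exists>\<sigma>. (\<sigma> = id \<or> \<sigma> = cnj) \<and> (\<forall>c x. U (c *\<^sub>C x) = \<sigma> c *\<^sub>C U x)"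
  using assms
proof
  assume "unitary U"
  then show ?thesis by (intro exI[of _ id]) (simp add: unitary_def)
next
  assume "antiunitary U"
  then show ?thesis by (intro exI[of _ cnj]) (simp add: antiunitary_def)
qed

lemma unitary_id: "unitary id"
  by (simp add: unitary_def)

context frames
begin

lemma spectral_op_image:
  assumes X: "X \<in> D" and p: "p permutes I" and U: "unitary U \<or> antiunitary U"
  shows "spectral_op I a (\<lambda>i. U ` X (p i)) (U x) = U (spectral_op I a (\<lambda>i. X (p i)) x)"
proof -
  obtain \<sigma> where \<sigma>: "\<sigma> = id \<or> \<sigma> = cnj" and scale: "\<And>c x. U (c *\<^sub>C x) = \<sigma> c *\<^sub>C U x"
    using isometry_semilinear[OF U] by blast
  have add: "U (x + y) = U x + U y" for x y using U by (auto simp: unitary_def antiunitary_def)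
  have orth: "cinner (U x) (U y) = 0 \<longleftrightarrow> cinner x y = 0" for x y
    using U by (auto simp: unitary_def antiunitary_def)
  have U0: "U 0 = 0" using add[of 0 0] by simp
  have sum: "U (\<Sum>i\<in>S. h i) = (\<Sum>i\<in>S. U (h i))" for S and h :: "'i \<Rightarrow> 'a"
    by (induction S rule: infinite_finite_induct) (simp_all add: U0 add)
  have diff: "U (x - y) = U x - U y" for x y using add[of "x - y" y] by simp
  have cp: "cproj (U ` X (p i)) (U x) = U (cproj (X (p i)) x)" if i: "i \<in> I" for i
  proof (rule cproj_eqI)
    have pi: "p i \<in> I" using permutes_in_image[OF p] i by blast
    show "csubspace (U ` X (p i))"
      by (rule csubspace_semilinear_image[of U, OF add scale \<sigma> D_sub[OF X]])
    show "U (cproj (X (p i)) x) \<in> U ` X (p i)" using cproj_mem[OF X pi] by blast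
    fix v assume "v \<in> U ` X (p i)"
    then obtain y where y: "y \<in> X (p i)" "v = U y" by blast
    have "cinner y (x - cproj (X (p i)) x) = 0"
      using cproj_cinner[OF X pi y(1), of x] by (simp add: cinner_diff_right)
    then show "cinner v (U x - U (cproj (X (p i)) x)) = 0"
      unfolding y(2) diff[symmetric] using orth by blast
  qed
  \<comment> \<open>The eigenvalues are real, so an antiunitary \<open>U\<close> passes them
    unconjugated.\<close>
  have "\<sigma> (complex_of_real r) = complex_of_real r" for r using \<sigma> by auto
  then show ?thesis by (simp add: spectral_op_def sum scale cp)
qed

end

theorem theorem1:
  fixes I :: "'i set" and a :: "'i \<Rightarrow> real" and n :: "'i \<Rightarrow> enat"
    and f :: "('a::chilbert_space \<Rightarrow> 'a) \<Rightarrow> ('a \<Rightarrow> 'a)"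
  assumes "cdim (UNIV :: 'a set) \<ge> 3"
    and "finite I" and "card I \<ge> 3"
    and "inj_on a I"
    and "\<forall>i\<in>I. n i > 0"
    and "(\<Sum>i\<in>I. n i) = cdim (UNIV :: 'a set)"
    and "card {i \<in> I. n i = \<infinity>} \<le> 1"
    and "\<forall>i\<in>I. n i = \<infinity> \<longrightarrow> a i = 0"
    and "graph_automorphism (op_graph I a n) f"
  shows "\<exists>U. \<exists>\<delta>\<in>dim_perms I n.
    (unitary U \<and> (\<forall>A\<in>op_class I a n. f A = U \<circ> perm_op I a \<delta> A \<circ> cadjoint U)) \<or>
    (antiunitary U \<and> (\<forall>A\<in>op_class I a n. f A = U \<circ> perm_op I a \<delta> A \<circ> conj_adjoint U))"
proof -
  note a = assms(4)
  interpret frames I n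
  proof
    show "finite I" by fact
    show "0 < n i" if "i \<in> I" for i using assms(5) that by blast
    fix i j assume ij: "i \<in> I" "j \<in> I" "n i = \<infinity>" "n j = \<infinity>"
    \<comment> \<open>A bound on \<open>card\<close> is informative only for a finite set, since
      infinite sets have \<open>card\<close> 0.\<close>
    have "finite {i \<in> I. n i = \<infinity>}" using assms(2) by simp
    then show "i = j" using assms(7) ij card_le_Suc0_iff_eq[of "{i \<in> I. n i = \<infinity>}"] by auto
  qed
  let ?C = "op_class I a n :: ('a \<Rightarrow> 'a) set"
  show ?thesis
  proof (cases "(D :: ('i \<Rightarrow> 'a set) set) = {}")
    \<comment> \<open>Without frames the operator class is empty, and the identity with the identity
      permutation will do.\<close>
    case True
    then have "?C = {}" by (simp add: op_class_eq)
    moreover have "id \<in> dim_perms I n" by (simp add: dim_perms_def permutes_id)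
    ultimately show ?thesis using unitary_id by blast
  next
    case False
    have f_bij: "bij_betw f ?C ?C"
      and f_edge: "\<And>A B. A \<in> ?C \<Longrightarrow> B \<in> ?C \<Longrightarrow>
        {A, B} \<in> snd (op_graph I a n) \<longleftrightarrow> {f A, f B} \<in> snd (op_graph I a n)"
      using assms(9) by (auto simp: graph_automorphism_def op_graph_def)
    have f_C: "f A \<in> ?C" if "A \<in> ?C" for A using f_bij that by (auto simp: bij_betw_def)
    \<comment> \<open>Edges are unordered pairs, so equality of doubletons yields adjacency in one
      of two orders; symmetry of \<open>adj\<close> merges them.\<close>
    have edge: "{A, B} \<in> snd (op_graph I a n) \<longleftrightarrow> adj (spaces a A) (spaces a B)"
      if AB: "A \<in> ?C" "B \<in> ?C" for A B
    proof -
      have "{A, B} \<in> snd (op_graph I a n) \<longleftrightarrow> adjacent_ops I a A B \<or> adjacent_ops I a B A"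
        using AB by (auto simp: op_graph_def doubleton_eq_iff)
      then show ?thesis
        using adjacent_ops_iff[OF a AB] adjacent_ops_iff[OF a AB(2,1)] adj_sym by blast
    qed
    define h where "h = the_inv_into ?C f"
    have h: "h A \<in> ?C" "f (h A) = A" if "A \<in> ?C" for A
      using that f_bij bij_betw_the_inv_into[OF f_bij] f_the_inv_into_f_bij_betw[OF f_bij, of A]
      by (auto simp: h_def bij_betw_def)
    have hf: "h (f A) = A" if "A \<in> ?C" for A
      using that f_bij by (auto simp: h_def bij_betw_def the_inv_into_f_f)
    define F where "F X = spaces a (f (spectral_op I a X))" for X
    define F' where "F' X = spaces a (h (spectral_op I a X))" for X
    have C: "spectral_op I a X \<in> ?C" if "X \<in> D" for X using that by (simp add: op_class_eq)
    interpret frame_automorphism I n F F'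
    proof
      show "3 \<le> card I" by fact
      show "(D :: ('i \<Rightarrow> 'a set) set) \<noteq> {}" by fact
      show "F X \<in> D" "F' X \<in> D" if "X \<in> D" for X
        using spaces_D[OF a] f_C h C[OF that] by (auto simp: F_def F'_def)
      show "F' (F X) = X" "F (F' X) = X" if "X \<in> D" for X
        using spectral_op_spaces[OF a f_C[OF C[OF that]]] spectral_op_spaces[OF a h(1)[OF C[OF that]]]
          hf[OF C[OF that]] h(2)[OF C[OF that]] spaces_spectral_op[OF that a]
        by (simp_all add: F_def F'_def)
      show "adj (F X) (F Y) \<longleftrightarrow> adj X Y" if "X \<in> D" "Y \<in> D" for X Y
        using edge[OF f_C[OF C[OF that(1)]] f_C[OF C[OF that(2)]]] f_edge[OF C[OF that(1)] C[OF that(2)]]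
          edge[OF C[OF that(1)] C[OF that(2)]] spaces_spectral_op[OF that(1) a] spaces_spectral_op[OF that(2) a]
        by (simp add: F_def)
    qed
    obtain \<delta> g where \<delta>: "\<delta> permutes I" and Fg: "\<And>X i. X \<in> D \<Longrightarrow> i \<in> I \<Longrightarrow> F X (\<delta> i) = g i (X i)"
      and bij: "\<And>i. i \<in> I \<Longrightarrow> bij_betw (g i) (slot i) (slot (\<delta> i))"
      and orth: "\<And>i j V W. i \<in> I \<Longrightarrow> j \<in> I \<Longrightarrow> V \<in> slot i \<Longrightarrow> W \<in> slot j \<Longrightarrow> i \<noteq> j \<Longrightarrow>
        corthogonal V W \<longleftrightarrow> corthogonal (g i V) (g j W)"
      using slot_maps by (elim exE conjE) blast
    interpret slot_isomorphism I n \<delta> g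
      by unfold_locales (use assms(3,6) False \<delta> bij orth in auto)
    obtain U where U: "unitary U \<or> antiunitary U" and gU: "\<And>t V. t \<in> I \<Longrightarrow> V \<in> slot t \<Longrightarrow> g t V = U ` V"
      using slots_isometry by (elim exE conjE) blast
    obtain \<sigma> where \<sigma>: "\<sigma> = id \<or> \<sigma> = cnj" and scale: "\<And>c x. U (c *\<^sub>C x) = \<sigma> c *\<^sub>C U x"
      using isometry_semilinear[OF U] by blast
    have add: "U (x + y) = U x + U y" for x y using U by (auto simp: unitary_def antiunitary_def)
    have "inj U"
    proof (rule injI)
      fix x y assume "U x = U y"
      then have "U (x - y) = 0" using add[of "x - y" y] by simp
      moreover have "cinner (U (x - y)) (U (x - y)) = 0 \<longleftrightarrow> cinner (x - y) (x - y) = 0"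
        using U unfolding unitary_def antiunitary_def by fastforce
      ultimately have "cinner (x - y) (x - y) = 0" by simp
      then show "x = y" by simp
    qed
    \<comment> \<open>Slot \<open>\<delta> i\<close> of the image comes from slot \<open>i\<close>,
      whereas \<open>perm_op\<close> reads slot \<open>p i\<close> into position \<open>i\<close>;
      hence the inverse.\<close>
    define p where "p = inv \<delta>"
    have p: "p permutes I" unfolding p_def by (rule permutes_inv[OF \<delta>])
    have \<delta>p: "\<delta> (p i) = i" for i unfolding p_def by (rule permutes_inverses(1)[OF \<delta>])
    have pI: "p i \<in> I" if "i \<in> I" for i using permutes_in_image[OF p] that by blast
    have FU: "F X i = U ` X (p i)" if "X \<in> D" "i \<in> I" for X i
      using Fg[OF that(1) pI[OF that(2)]] gU[OF pI[OF that(2)] slot_mem[OF that(1)]] \<delta>p[of i] by simp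
    \<comment> \<open>Dimensions are preserved because the slots of an image frame are images of
      slots under the injective \<open>U\<close>.\<close>
    have "n (p i) = n i" if i: "i \<in> I" for i
    proof -
      obtain X :: "'i \<Rightarrow> 'a set" where X: "X \<in> D" using False by blast
      have "n i = cdim (U ` X (p i))" using D_cdim[OF F_D[OF X] i] FU[OF X i] by simp
      also have "\<dots> = cdim (X (p i))"
        by (rule cdim_semilinear_image[of U, OF add scale \<sigma> \<open>inj U\<close> D_sub[OF X]])
      finally show ?thesis using D_cdim[OF X pI[OF i]] by simp
    qed
    then have dp: "p \<in> dim_perms I n" using p by (simp add: dim_perms_def)
    \<comment> \<open>Stated at \<open>U x\<close>, where the chosen adjoint returns
      \<open>x\<close>; surjectivity of \<open>U\<close> then covers all arguments.\<close>
    have main: "f A (U x) = U (perm_op I a p A x)" if A: "A \<in> ?C" for A x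
    proof -
      define X where "X = spaces a A"
      have X: "X \<in> D" unfolding X_def by (rule spaces_D[OF a A])
      have "F X = spaces a (f A)" by (simp add: F_def X_def spectral_op_spaces[OF a A])
      then have "f A = spectral_op I a (F X)" using spectral_op_spaces[OF a f_C[OF A]] by simp
      also have "\<dots> = spectral_op I a (\<lambda>i. U ` X (p i))"
        unfolding spectral_op_def using FU[OF X] by (intro ext sum.cong) simp_all
      finally have "f A (U x) = U (spectral_op I a (\<lambda>i. X (p i)) x)"
        using spectral_op_image[OF X p U] by simp
      moreover have "spectral_op I a (\<lambda>i. X (p i)) x = perm_op I a p A x"
        unfolding perm_op_def spectral_op_def using pI by (intro sum.cong) (simp_all add: X_def spaces_def)
      ultimately show ?thesis by simp
    qed
    from U show ?thesis
    proof
      assume u: "unitary U"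
      have "f A = U \<circ> perm_op I a p A \<circ> cadjoint U" if A: "A \<in> ?C" for A
      proof
        fix z
        obtain x where x: "z = U x" using u unfolding unitary_def surj_def by blast
        show "f A z = (U \<circ> perm_op I a p A \<circ> cadjoint U) z"
          unfolding x using main[OF A] cadjoint_unitary[OF u] by simp
      qed
      then show ?thesis using u dp by blast
    next
      assume u: "antiunitary U"
      have "f A = U \<circ> perm_op I a p A \<circ> conj_adjoint U" if A: "A \<in> ?C" for A
      proof
        fix z
        obtain x where x: "z = U x" using u unfolding antiunitary_def surj_def by blast
        show "f A z = (U \<circ> perm_op I a p A \<circ> conj_adjoint U) z"
          unfolding x using main[OF A] conj_adjoint_antiunitary[OF u] by simp
      qed
      then show ?thesis using u dp by blast
    qed
  qed
qed

end
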